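(* Let $\Omega \subseteq \mathbb{C}$ be a Koenigs domain. Then $\mathrm{h}(\Omega) \geq 1/2$ if and only if $\Omega$ is a regular domain. In particular, for every Koenigs domain $\Omega$ it holds that $\mathrm{h}(\Omega)\in \{0\}\cup [1/2,+\infty]$.
   Context: A domain is a nonempty open connected subset of $\mathbb{C}$. A domain is hyperbolic if its boundary in $\mathbb{C}$ contains at least two points. A Koenigs domain is a hyperbolic domain $\Omega\subseteq\mathbb{C}$ such that $\Omega+1\subseteq\Omega$. Hardy number. Let $\mathbb{D}$ be the open unit disc, $\mathbb{T}=\partial\mathbb{D}$, and $m$ the normalized length measure on $\mathbb{T}$. For $0<p<+\infty$, $H^p(\mathbb{D})$ is the set of holomorphic $f:\mathbb{D}\to\mathbb{C}$ with $\sup_{0<r<1}\int_{\mathbb{T}}|f(r\xi)|^p\,dm(\xi)<+\infty$. The Hardy number of a holomorphic $f:\mathbb{D}\to\mathbb{C}$ is $\mathrm{h}(f)=\sup(\{0\}\cup\{p>0: f\in H^p(\mathbb{D})\})\in[0,+\infty]$. The Hardy number of a domain $\Omega$ is $\mathrm{h}(\Omega)=\inf\{\mathrm{h}(f): f:\mathbb{D}\to\mathbb{C} \text{ holomorphic},\ f(\mathbb{D})\subseteq\Omega\}$. Logarithmic capacity. For a finite positive Borel measure $\mu$ on $\mathbb{C}$ with compact support, its energy is $I(\mu)=\int\int\log|z-w|\,d\mu(w)\,d\mu(z)\in[-\infty,+\infty)$. For $X\subseteq\mathbb{C}$, $\operatorname{cap}(X)=\sup_\mu \exp(I(\mu))$,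 the supremum being over all Borel probability measures $\mu$ whose support is a compact subset of $X$ (with $\exp(-\infty)=0$). A domain $\Omega$ is regular if $\operatorname{cap}(\mathbb{C}\setminus\Omega)>0$. *)

theory Defs
  imports "HOL-Probability.Probability" "HOL-Complex_Analysis.Complex_Analysis"
begin

definition complex_domain :: "complex set \<Rightarrow> bool" where
  "complex_domain \<Omega> \<longleftrightarrow> \<Omega> \<noteq> {} \<and> open \<Omega> \<and> connected \<Omega>"

definition hyperbolic_domain :: "complex set \<Rightarrow> bool" where
  "hyperbolic_domain \<Omega> \<longleftrightarrow>
     complex_domain \<Omega> \<and> (\<exists>a\<in>frontier \<Omega>. \<exists>b\<in>frontier \<Omega>. a \<noteq> b)"

definition Koenigs_domain :: "complex set \<Rightarrow> bool" where
  "Koenigs_domain \<Omega> \<longleftrightarrow> hyperbolic_domain \<Omega> \<and> (\<lambda>z. z + 1) ` \<Omega> \<subseteq> \<Omega>"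

(* Normalized length measure of the unit circle, as a measure on the complex plane. *)
definition circle_measure :: "complex measure" where
  "circle_measure = distr (uniform_measure lborel {0..2 * pi}) borel cis"

definition hardy_space :: "real \<Rightarrow> (complex \<Rightarrow> complex) set" where
  "hardy_space p = {f. f holomorphic_on ball 0 1 \<and>
     (SUP r\<in>{0<..<1}. \<integral>\<^sup>+ \<xi>. ennreal (norm (f (complex_of_real r * \<xi>)) powr p)
        \<partial>circle_measure) < \<infinity>}"

definition hardy_number_fun :: "(complex \<Rightarrow> complex) \<Rightarrow> ennreal" where
  "hardy_number_fun f = Sup ({0} \<union> {ennreal p | p. p > 0 \<and> f \<in> hardy_space p})"

definition hardy_number :: "complex set \<Rightarrow> ennreal" where
  "hardy_number \<Omega> =
     Inf {hardy_number_fun f | f. f holomorphic_on ball 0 1 \<and> f ` ball 0 1 \<subseteq> \<Omega>}"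

(* The library's real ln satisfies ln 0 = 0, which would give atoms finite energy. *)
definition log_ext :: "real \<Rightarrow> ereal" where
  "log_ext x = (if x = 0 then -\<infinity> else ereal (ln x))"

definition exp_ext :: "ereal \<Rightarrow> ennreal" where
  "exp_ext x = (case x of ereal r \<Rightarrow> ennreal (exp r) | PInfty \<Rightarrow> \<infinity> | MInfty \<Rightarrow> 0)"

(* Integral of an extended-real function as the integral of its positive part minus that of
   its negative part (e2ennreal sends negative numbers to 0). It is only meaningful when one
   of the two is finite; below, the positive part always has a finite integral, because
   log |z - w| is bounded above for z and w in a compact set. *)
definition integral_ext :: "'a measure \<Rightarrow> ('a \<Rightarrow> ereal) \<Rightarrow> ereal" where
  "integral_ext M f =
     enn2ereal (\<integral>\<^sup>+ x. e2ennreal (f x) \<partial>M) - enn2ereal (\<integral>\<^sup>+ x. e2ennreal (- f x) \<partial>M)"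

definition energy :: "complex measure \<Rightarrow> ereal" where
  "energy \<mu> = integral_ext \<mu> (\<lambda>z. integral_ext \<mu> (\<lambda>w. log_ext (norm (z - w))))"

definition measure_support :: "'a::topological_space measure \<Rightarrow> 'a set" where
  "measure_support \<mu> = {z. \<forall>U. open U \<and> z \<in> U \<longrightarrow> emeasure \<mu> U > 0}"

(* In ennreal the supremum over no measures (X empty) is 0. *)
definition log_capacity :: "complex set \<Rightarrow> ennreal" where
  "log_capacity X =
     (SUP \<mu>\<in>{\<mu>. prob_space \<mu> \<and> sets \<mu> = sets borel \<and>
                 compact (measure_support \<mu>) \<and> measure_support \<mu> \<subseteq> X}.
        exp_ext (energy \<mu>))"

definition regular_domain :: "complex set \<Rightarrow> bool" where
  "regular_domain \<Omega> \<longleftrightarrow> complex_domain \<Omega> \<and> log_capacity (- \<Omega>) > 0"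

end

theory Submission
  imports Defs
begin

text \<open>
  Let \<open>E\<close> be the complement of the Koenigs domain \<open>\<Omega>\<close>; it is closed and \<open>E - 1 \<subseteq> E\<close>. The theorem
  follows from two statements, according to whether the capacity of \<open>E\<close> is positive or zero.

  If the capacity is positive, \<open>E\<close> carries a probability measure \<open>\<nu>\<close> of compact support whose
  logarithmic potential is bounded below off \<open>E\<close>
  (\<open>positive_capacity_bounded_potential\<close>). The translates of \<open>\<nu>\<close> by \<open>- n\<close> are again measures on \<open>E\<close>. With weights comparable to \<open>n powr (-1/2)\<close>, the first \<open>N\<close> of
  them imitate the density \<open>t powr (-1/2)\<close> on a segment of length \<open>N\<close> of the negative half-line,
  the density that belongs to the harmonic function \<open>Re (sqrt z)\<close> of the slit plane. The resulting
  potential \<open>u N\<close> is harmonic on \<open>\<Omega>\<close>, bounded below independently of \<open>N\<close>, bounded at each fixed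
  point independently of \<open>N\<close>, and at least \<open>2 * sqrt N\<close> at points whose modulus is large compared
  with \<open>N\<close>. For \<open>f\<close> from the disc to \<open>\<Omega>\<close> the mean value property of \<open>u N\<close> along \<open>f\<close> bounds the
  measure of the set where \<open>\<bar>f\<bar>\<close> exceeds a multiple of \<open>N\<close> by a constant times \<open>1 / sqrt N\<close>,
  uniformly over all circles (\<open>Koenigs_weak_type\<close>). Hence \<open>f\<close> is in every Hardy space with exponent
  below \<open>1/2\<close>.

  If the capacity is zero, the Hardy number is zero. Each compact part of \<open>E\<close> admits finitely many points whose average
  logarithmic potential is as negative there as desired (\<open>capacity_zero_small_potential\<close>). On the other
  side, consider for a point \<open>z\<close> the supremum of the boundary means of a fixed bounded function over all
  analytic discs in \<open>\<Omega>\<close> centred at \<open>z\<close>. It satisfies the super-mean value inequality, because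
  discs centred at the boundary points of another disc can be glued to it
  (\<open>glue_discs\<close>), which is Poletsky's idea. Comparing this supremum with the very negative
  potentials yields, for every \<open>R\<close>, discs centred at any given point on whose boundary
  \<open>min 1 (\<bar>f\<bar> / R)\<close> has mean above \<open>1/2\<close> (\<open>disc_reaching_far\<close>). Gluing such discs
  to each other again and again, with corrections that are small on compact subsets, produces in the limit a single map from the disc to \<open>\<Omega>\<close> outside a prescribed
  Hardy space (\<open>exists_disc_outside_hardy_space\<close>).
\<close>

section \<open>Means over the unit circle\<close>

lemma cis_borel [measurable]: "cis \<in> borel_measurable borel"
  by (auto intro!: borel_measurable_continuous_onI continuous_intros)

lemma prob_space_circle: "prob_space circle_measure"
proof -
  have "prob_space (uniform_measure lborel {0..2*pi})"
    by (rule prob_space_uniform_measure) auto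
  then show ?thesis unfolding circle_measure_def
    by (rule prob_space.prob_space_distr) simp
qed

lemma space_circle [simp]: "space circle_measure = UNIV"
  and sets_circle [simp, measurable_cong]: "sets circle_measure = sets borel"
  by (auto simp: circle_measure_def)

lemma AE_circle: "AE \<xi> in circle_measure. norm \<xi> = 1"
  unfolding circle_measure_def by (subst AE_distr_iff) auto

lemma circle_integral:
  fixes \<phi> :: "complex \<Rightarrow> 'a::euclidean_space"
  assumes [measurable]: "\<phi> \<in> borel_measurable borel" and c: "continuous_on {0..2*pi} (\<lambda>t. \<phi> (cis t))"
  shows "integral\<^sup>L circle_measure \<phi> = (1/(2*pi)) *\<^sub>R integral {0..2*pi} (\<lambda>t. \<phi> (cis t))"
    and "integrable circle_measure \<phi>"
proof -
  let ?d = "\<lambda>t::real. indicator {0..2*pi} t / (2*pi)"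
  have d: "uniform_measure lborel {0..2*pi} = density lborel (\<lambda>t. ennreal (?d t))"
    unfolding uniform_measure_def
    by (rule density_cong) (auto simp: divide_ennreal indicator_def ennreal_1[symmetric] simp del: ennreal_1)
  have i: "set_integrable lborel {0..2*pi} (\<lambda>t. \<phi> (cis t))"
    using c by (rule borel_integrable_atLeastAtMost')
  have eq: "?d t *\<^sub>R x = (1/(2*pi)) *\<^sub>R (indicator {0..2*pi} t *\<^sub>R x)" for t and x :: 'a
    by (simp add: scaleR_scaleR)
  have i': "integrable lborel (\<lambda>t. ?d t *\<^sub>R \<phi> (cis t))"
    unfolding eq using i unfolding set_integrable_def by (rule integrable_scaleR_right)
  have "integrable (uniform_measure lborel {0..2*pi}) (\<lambda>t. \<phi> (cis t))"
    unfolding d by (subst integrable_density) (use i' in auto)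
  then show "integrable circle_measure \<phi>"
    unfolding circle_measure_def by (subst integrable_distr_eq) auto
  have "integral\<^sup>L circle_measure \<phi> = (LINT t|uniform_measure lborel {0..2*pi}. \<phi> (cis t))"
    unfolding circle_measure_def by (subst integral_distr) auto
  also have "\<dots> = (LINT t|lborel. ?d t *\<^sub>R \<phi> (cis t))"
    unfolding d by (subst integral_density) auto
  also have "\<dots> = (1/(2*pi)) *\<^sub>R (LINT t:{0..2*pi}|lborel. \<phi> (cis t))"
    unfolding set_lebesgue_integral_def eq by (rule integral_scaleR_right)
  also have "(LINT t:{0..2*pi}|lborel. \<phi> (cis t)) = integral {0..2*pi} (\<lambda>t. \<phi> (cis t))"
    using i by (rule set_borel_integral_eq_integral)
  finally show "integral\<^sup>L circle_measure \<phi> = (1/(2*pi)) *\<^sub>R integral {0..2*pi} (\<lambda>t. \<phi> (cis t))" .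
qed

lemma circle_mean_value:
  fixes g :: "complex \<Rightarrow> complex"
  assumes g: "g holomorphic_on ball c R" and r: "0 \<le> r" "r < R"
  shows "((\<lambda>t. g (c + of_real r * cis t)) has_integral (2 * pi * g c)) {0..2*pi}"
proof (cases "r = 0")
  case True
  then show ?thesis using has_integral_const_real[of "g c" 0 "2*pi"] by (simp add: scaleR_conv_of_real)
next
  case False
  then have r0: "r > 0" using r by simp
  have "((\<lambda>u. g u / (u - c)) has_contour_integral (2 * of_real pi * \<i> * g c)) (circlepath c r)"
    using r r0 by (intro Cauchy_integral_circlepath_simple holomorphic_on_subset[OF g]) auto
  then have "((\<lambda>t. g (c + r * cis t) / (r * cis t) * r * \<i> * cis t) has_integral (2 * pi * \<i> * g c)) {0..2*pi}"
    unfolding circlepath_def by (subst (asm) has_contour_integral_part_circlepath_iff) auto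
  then have "((\<lambda>t. (-\<i>) * (g (c + r * cis t) / (r * cis t) * r * \<i> * cis t)) has_integral (-\<i>) * (2 * pi * \<i> * g c)) {0..2*pi}"
    by (rule has_integral_mult_right)
  then show ?thesis using r0 by (simp add: field_simps)
qed

text \<open>A zero-free function on a disc has a holomorphic logarithm, whose real part satisfies the mean
  value equation; this is harmonicity of \<open>ln \<bar>g\<bar>\<close> in the form used below.\<close>

lemma circle_log_mean_value:
  fixes g :: "complex \<Rightarrow> complex"
  assumes g: "g holomorphic_on ball c R" and r: "0 \<le> r" "r < R"
   and nz: "\<And>z. z \<in> ball c R \<Longrightarrow> g z \<noteq> 0"
  shows "((\<lambda>t. ln (norm (g (c + of_real r * cis t)))) has_integral (2 * pi * ln (norm (g c)))) {0..2*pi}"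
proof -
  obtain h where h: "h holomorphic_on ball c R" "\<And>z. z \<in> ball c R \<Longrightarrow> g z = exp (h z)"
    using contractible_imp_holomorphic_log[OF g convex_imp_contractible[OF convex_ball] nz] by metis
  have m: "c + of_real r * cis t \<in> ball c R" for t using r by (simp add: dist_norm norm_mult)
  have "((\<lambda>t. Re (h (c + of_real r * cis t))) has_integral Re (2 * pi * h c)) {0..2*pi}"
    using has_integral_linear[OF circle_mean_value[OF h(1) r] bounded_linear_Re] by (simp add: o_def)
  moreover have "Re (2 * pi * h c) = 2 * pi * ln (norm (g c))"
    using h(2)[of c] r by simp
  moreover have "Re (h (c + of_real r * cis t)) = ln (norm (g (c + of_real r * cis t)))" for t
    using h(2)[OF m] by simp
  ultimately show ?thesis by simp
qed

lemma circle_rotate: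
  fixes \<phi> :: "complex \<Rightarrow> real"
  assumes a: "norm a = 1" and c: "continuous_on UNIV \<phi>"
  shows "(LINT \<xi>|circle_measure. \<phi> (a * \<xi>)) = (LINT \<xi>|circle_measure. \<phi> \<xi>)"
proof -
  obtain s where s: "a = cis s" "0 \<le> s" "s < 2*pi" 
  proof -
    have "0 \<le> Arg2pi a" "Arg2pi a < 2*pi" "a = of_real (norm a) * exp (\<i> * of_real (Arg2pi a))"
      using Arg2pi_ge_0 Arg2pi_lt_2pi Arg2pi_eq by blast+
    then show ?thesis using that[of "Arg2pi a"] a cis_conv_exp[of "Arg2pi a"] by (metis mult_1 of_real_1)
  qed
  have cc: "continuous_on A (\<lambda>t. \<phi> (cis t))" for A
    by (intro continuous_intros continuous_on_compose2[OF c]) auto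
  then have ii: "(\<lambda>t. \<phi> (cis t)) integrable_on {x..y}" for x y by (rule integrable_continuous_real)
  have 1: "integral {0..2*pi} (\<lambda>t. \<phi> (a * cis t)) = integral {s..2*pi+s} (\<lambda>t. \<phi> (cis t))"
    using integral_shift_real_ivl[of s s "2*pi+s" "\<lambda>t. \<phi> (cis t)"] by (simp add: s cis_mult add.commute)
  have 2: "integral {0..s} (\<lambda>t. \<phi> (cis t)) = integral {2*pi..2*pi+s} (\<lambda>t. \<phi> (cis t))"
    using integral_shift_real_ivl[of "2*pi" "2*pi" "2*pi+s" "\<lambda>t. \<phi> (cis t)"] by (simp add: cis_mult[symmetric])
  have 3: "integral {s..2*pi+s} (\<lambda>t. \<phi> (cis t)) = integral {0..2*pi} (\<lambda>t. \<phi> (cis t))"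
    using Henstock_Kurzweil_Integration.integral_combine[of s "2*pi" "2*pi+s" "\<lambda>t. \<phi> (cis t)", OF _ _ ii]
     Henstock_Kurzweil_Integration.integral_combine[of 0 s "2*pi" "\<lambda>t. \<phi> (cis t)", OF _ _ ii] 2 s by simp
  have m: "\<phi> \<in> borel_measurable borel" "(\<lambda>\<xi>. \<phi> (a * \<xi>)) \<in> borel_measurable borel"
    using c by (auto intro!: borel_measurable_continuous_onI continuous_intros continuous_on_compose2[OF c])
  show ?thesis
    by (subst (1 2) circle_integral(1)) (auto simp: m cc 1 3 intro!: continuous_intros continuous_on_compose2[OF c])
qed

interpretation circle: prob_space circle_measure by (rule prob_space_circle)
interpretation circle_pair: pair_prob_space circle_measure circle_measure ..

lemma circle_UNIV [simp]: "measure circle_measure UNIV = 1"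
  using circle.prob_space by simp

lemma borel_measurable_contI: "continuous_on UNIV f \<Longrightarrow> f \<in> borel_measurable borel"
  by (rule borel_measurable_continuous_onI)

lemma circle_integrable:
  fixes \<phi> :: "complex \<Rightarrow> 'a::euclidean_space"
  assumes "continuous_on UNIV \<phi>"
  shows "integrable circle_measure \<phi>"
proof (rule circle_integral(2))
  show "\<phi> \<in> borel_measurable borel" using assms by (rule borel_measurable_contI)
  show "continuous_on {0..2*pi} (\<lambda>t. \<phi> (cis t))"
    by (rule continuous_on_compose2[OF assms]) (auto intro!: continuous_intros)
qed

lemma circle_pair_integrable:
  fixes H :: "complex \<times> complex \<Rightarrow> real"
  assumes H: "continuous_on UNIV H"
  shows "integrable (circle_measure \<Otimes>\<^sub>M circle_measure) H"
proof -
  have "compact (H ` (sphere 0 1 \<times> sphere 0 1))"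
    by (intro compact_continuous_image continuous_on_subset[OF H] compact_Times) auto
  then obtain B where B: "\<And>x y. norm x = 1 \<Longrightarrow> norm y = 1 \<Longrightarrow> norm (H (x,y)) \<le> B"
    unfolding bounded_iff by (force dest!: compact_imp_bounded simp: bounded_iff)
  have "sets (circle_measure \<Otimes>\<^sub>M circle_measure) = sets (borel \<Otimes>\<^sub>M borel :: (complex \<times> complex) measure)"
    by (rule sets_pair_measure_cong) simp_all
  then have sets: "sets (circle_measure \<Otimes>\<^sub>M circle_measure) = sets borel" by (simp only: borel_prod)
  have [measurable]: "H \<in> borel_measurable (circle_measure \<Otimes>\<^sub>M circle_measure)"
    using borel_measurable_continuous_onI[OF H] by (simp only: measurable_cong_sets[OF sets refl])
  have "AE p in circle_measure \<Otimes>\<^sub>M circle_measure. norm (H p) \<le> B"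
  proof (rule circle_pair.AE_pair_measure)
    show "AE x in circle_measure. AE y in circle_measure. norm (H (x, y)) \<le> B"
    proof (rule AE_mp[OF AE_circle], rule AE_I2, rule impI)
      fix x :: complex assume x: "norm x = 1"
      show "AE y in circle_measure. norm (H (x, y)) \<le> B"
        by (rule AE_mp[OF AE_circle], rule AE_I2, rule impI) (rule B[OF x])
    qed
  qed measurable
  then show ?thesis
    by (intro circle_pair.P.integrable_const_bound[where B=B]) auto
qed

lemma circle_AE_neq: "AE \<xi> in circle_measure. \<xi> \<noteq> a"
proof -
  have sub: "{t \<in> {0..2*pi}. cis t = a} \<subseteq> {Arg2pi a, 2*pi}"
  proof
    fix t assume t: "t \<in> {t \<in> {0..2*pi}. cis t = a}"
    have "of_real 1 * exp (\<i> * of_real t) = cis t" by (simp add: cis_conv_exp)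
    from Arg2pi_unique[OF this] have "t \<noteq> 2*pi \<Longrightarrow> Arg2pi a = t" using t by auto
    then show "t \<in> {Arg2pi a, 2*pi}" by auto
  qed
  have "AE t in lborel. t \<notin> {Arg2pi a, 2*pi}"
    by (rule AE_not_in) (auto intro: finite_imp_null_set_lborel)
  then have "AE t in lborel. t \<in> {0..2*pi} \<longrightarrow> cis t \<noteq> a"
    by eventually_elim (use sub in auto)
  then have "AE t in uniform_measure lborel {0..2*pi}. cis t \<noteq> a"
    by (rule AE_uniform_measureI[rotated]) auto
  then show ?thesis unfolding circle_measure_def
    by (subst AE_distr_iff) auto
qed

text \<open>A second circle centred on the unit circle meets it in at most two points. Hence the pieces into
  which finitely many such circles cut the unit circle exhaust it up to a null set.\<close>

lemma circle_AE_not_sphere: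
  assumes x: "norm x = 1"
  shows "AE \<xi> in circle_measure. dist x \<xi> \<noteq> r"
proof -
  define c where "c = 1 - r^2/2"
  define A where "A = {x * Complex c (sqrt (1 - c^2)), x * Complex c (- sqrt (1 - c^2))}"
  have "AE \<xi> in circle_measure. \<forall>a\<in>A. \<xi> \<noteq> a"
    by (rule AE_finite_allI) (auto simp: A_def circle_AE_neq)
  with AE_circle show ?thesis
  proof eventually_elim
    case (elim \<xi>)
    show ?case
    proof
      assume d: "dist x \<xi> = r"
      define \<zeta> where "\<zeta> = \<xi> / x"
      have x0: "x \<noteq> 0" using x by auto
      have \<xi>: "\<xi> = x * \<zeta>" using x0 by (simp add: \<zeta>_def)
      have n: "norm \<zeta> = 1" using elim x by (simp add: \<zeta>_def norm_divide)
      have "x - \<xi> = x * (1 - \<zeta>)" by (simp add: \<xi> algebra_simps)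
      then have "norm (1 - \<zeta>) = r" using d x by (simp add: dist_norm norm_mult)
      then have "r^2 = (1 - Re \<zeta>)^2 + (Im \<zeta>)^2"
        using cmod_power2[of "1 - \<zeta>"] by simp
      moreover have ri: "(Re \<zeta>)^2 + (Im \<zeta>)^2 = 1" using n cmod_power2[of \<zeta>] by simp
      moreover have xx: "(1 - Re \<zeta>)^2 = 1 + (Re \<zeta>)^2 - 2 * Re \<zeta>" by (simp add: power2_diff)
      ultimately have re: "Re \<zeta> = c"
        unfolding c_def using xx by linarith
      then have yy: "1 - c^2 = (Im \<zeta>)^2" using ri by simp
      have "Im \<zeta> = sqrt (1 - c^2) \<or> Im \<zeta> = - sqrt (1 - c^2)"
        using real_sqrt_abs[of "Im \<zeta>"] yy by (auto simp: abs_if split: if_splits)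
      then have "\<zeta> = Complex c (sqrt (1 - c^2)) \<or> \<zeta> = Complex c (- sqrt (1 - c^2))"
        using re by (auto simp: complex_eq_iff)
      then have "\<xi> \<in> A" unfolding A_def by (subst \<xi>) blast
      then show False using elim by auto
    qed
  qed
qed

lemma compact_uniform_modulus:
  fixes \<psi> :: "'a::euclidean_space \<Rightarrow> real"
  assumes K: "compact K" and \<psi>: "continuous_on UNIV \<psi>" and e: "\<epsilon> > 0"
  obtains \<delta> where "\<delta> > 0" "\<And>x y. x \<in> K \<Longrightarrow> norm (y - x) < \<delta> \<Longrightarrow> \<bar>\<psi> y - \<psi> x\<bar> < \<epsilon>"
proof -
  define L where "L = {x + y |x y. x \<in> K \<and> y \<in> cball 0 1}"
  have "compact L" unfolding L_def by (rule compact_sums[OF K]) auto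
  then have "uniformly_continuous_on L \<psi>"
    by (intro compact_uniformly_continuous continuous_on_subset[OF \<psi>]) auto
  then obtain d where d: "d > 0" "\<forall>x\<in>L. \<forall>y\<in>L. dist y x < d \<longrightarrow> dist (\<psi> y) (\<psi> x) < \<epsilon>"
    using e unfolding uniformly_continuous_on_def by blast
  show ?thesis
  proof (rule that[of "min d 1"])
    fix x y assume xy: "x \<in> K" "norm (y - x) < min d 1"
    have "x \<in> L" unfolding L_def using xy(1) by (intro CollectI exI[of _ x] exI[of _ 0]) auto
    moreover have "y \<in> L" unfolding L_def using xy by (intro CollectI exI[of _ x] exI[of _ "y - x"]) auto
    moreover have "dist y x < d" using xy(2) by (simp add: dist_norm)
    ultimately have "dist (\<psi> y) (\<psi> x) < \<epsilon>" using d(2) by blast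
    then show "\<bar>\<psi> y - \<psi> x\<bar> < \<epsilon>" by (simp add: dist_norm)
  qed (use d in auto)
qed

lemma compact_open_margin:
  fixes K :: "'a::euclidean_space set"
  assumes "compact K" "open S" "K \<subseteq> S"
  obtains \<delta> where "\<delta> > 0" "\<And>x y. x \<in> K \<Longrightarrow> norm (y - x) < \<delta> \<Longrightarrow> y \<in> S"
proof (rule compact_subset_open_imp_ball_epsilon_subset[OF assms])
  fix e assume e: "e > 0" "(\<Union>x\<in>K. ball x e) \<subseteq> S"
  show ?thesis
  proof (rule that[OF e(1)])
    fix x y assume x: "x \<in> K" "norm (y - x) < e"
    have "dist x y < e" using x(2) by (simp add: dist_norm norm_minus_commute)
    then have "y \<in> ball x e" by simp
    then show "y \<in> S" using e(2) x(1) by blast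
  qed
qed

lemma circle_mean_mono:
  fixes f g :: "complex \<Rightarrow> real"
  assumes "integrable circle_measure f" "integrable circle_measure g"
    "\<And>\<xi>. norm \<xi> = 1 \<Longrightarrow> f \<xi> \<le> g \<xi>"
  shows "(LINT \<xi>|circle_measure. f \<xi>) \<le> (LINT \<xi>|circle_measure. g \<xi>)"
proof (rule integral_mono_AE[OF assms(1,2)])
  show "AE \<xi> in circle_measure. f \<xi> \<le> g \<xi>"
    by (rule AE_mp[OF AE_circle], rule AE_I2, rule impI) (rule assms(3))
qed

lemma circle_mean_bound:
  fixes f :: "complex \<Rightarrow> real"
  assumes "integrable circle_measure f" "\<And>\<xi>. norm \<xi> = 1 \<Longrightarrow> f \<xi> \<le> B"
  shows "(LINT \<xi>|circle_measure. f \<xi>) \<le> B"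
proof -
  have "(LINT \<xi>|circle_measure. f \<xi>) \<le> (LINT \<xi>|circle_measure. B)"
    by (rule circle_mean_mono[OF assms(1) _ assms(2)]) simp_all
  then show ?thesis by simp
qed

text \<open>On the unit circle the conjugate of \<open>\<xi>\<close> is its inverse, so every real polynomial in
  the coordinates becomes a Laurent polynomial. The negative powers that appear are what the factor
  \<open>z ^ N\<close> cancels when discs are glued.\<close>

lemma polynomial_on_circle_is_Laurent:
  fixes p :: "complex \<Rightarrow> real"
  assumes "real_polynomial_function p"
  shows "\<exists>m q. q holomorphic_on UNIV \<and> (\<forall>\<xi>. norm \<xi> = 1 \<longrightarrow> of_real (p \<xi>) = q \<xi> / \<xi>^m)"
  using assms
proof induction
  case (linear f)
  interpret f: bounded_linear f by fact
  have lin: "f z = Re z * f 1 + Im z * f \<i>" for z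
  proof -
    have "z = Re z *\<^sub>R 1 + Im z *\<^sub>R \<i>" by (simp add: complex_eq_iff)
    then have "f z = f (Re z *\<^sub>R 1 + Im z *\<^sub>R \<i>)" by simp
    then show ?thesis by (simp only: f.add f.scaleR real_scaleR_def)
  qed
  have xi: "of_real (Re \<xi>) = (\<xi>^2 + 1) / 2 / \<xi>^1" "of_real (Im \<xi>) = (\<xi>^2 - 1) / (2*\<i>) / \<xi>^1" if "norm \<xi> = 1" for \<xi>
  proof -
    have "\<xi> * cnj \<xi> = 1" using that complex_norm_square[of \<xi>] by simp
    then have c: "cnj \<xi> = inverse \<xi>" "\<xi> \<noteq> 0" using that by (metis inverse_unique, auto)
    have "of_real (Re \<xi>) = (\<xi> + cnj \<xi>) / 2" "of_real (Im \<xi>) = (\<xi> - cnj \<xi>) / (2*\<i>)"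
      using complex_add_cnj[of \<xi>] complex_diff_cnj[of \<xi>]
      by (simp_all add: mult.commute[of "complex_of_real (Im \<xi>)" \<i>])
    then show "of_real (Re \<xi>) = (\<xi>^2 + 1) / 2 / \<xi>^1" "of_real (Im \<xi>) = (\<xi>^2 - 1) / (2*\<i>) / \<xi>^1"
      unfolding c(1) using c(2) by (simp_all add: field_simps power2_eq_square)
  qed
  have "of_real (f \<xi>) = ((\<xi>^2 + 1) / 2 * f 1 + (\<xi>^2 - 1) / (2*\<i>) * f \<i>) / \<xi>^1" if "norm \<xi> = 1" for \<xi>
  proof -
    have "of_real (f \<xi>) = of_real (Re \<xi>) * of_real (f 1) + of_real (Im \<xi>) * complex_of_real (f \<i>)"
      by (subst lin) simp
    also have "\<dots> = ((\<xi>^2 + 1) / 2 / \<xi>^1) * of_real (f 1) + ((\<xi>^2 - 1) / (2*\<i>) / \<xi>^1) * of_real (f \<i>)"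
      by (simp only: xi[OF that])
    also have "\<dots> = ((\<xi>^2 + 1) / 2 * f 1 + (\<xi>^2 - 1) / (2*\<i>) * f \<i>) / \<xi>^1"
    proof -
      have "A / X * u + B / X * v = (A * u + B * v) / X" for A B u v X :: complex
        by (simp add: add_divide_distrib)
      then show ?thesis .
    qed
    finally show ?thesis .
  qed
  moreover have "(\<lambda>\<xi>. (\<xi>^2 + 1) / 2 * f 1 + (\<xi>^2 - 1) / (2*\<i>) * f \<i>) holomorphic_on UNIV"
    by (intro holomorphic_intros) auto
  ultimately show ?case by blast
next
  case (const c)
  have "of_real c = (\<lambda>_. of_real c) \<xi> / \<xi> ^ 0" for \<xi> :: complex by simp
  moreover have "(\<lambda>_::complex. of_real c :: complex) holomorphic_on UNIV" by (rule holomorphic_on_const)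
  ultimately show ?case by blast
next
  case (add f g)
  then obtain m q m' q' where q: "q holomorphic_on UNIV" "\<And>\<xi>. norm \<xi> = 1 \<Longrightarrow> of_real (f \<xi>) = q \<xi> / \<xi>^m"
    "q' holomorphic_on UNIV" "\<And>\<xi>. norm \<xi> = 1 \<Longrightarrow> of_real (g \<xi>) = q' \<xi> / \<xi>^m'" by blast
  have "of_real (f \<xi> + g \<xi>) = (\<lambda>\<xi>. q \<xi> * \<xi>^m' + q' \<xi> * \<xi>^m) \<xi> / \<xi>^(m+m')" if "norm \<xi> = 1" for \<xi>
  proof -
    have "\<xi> \<noteq> 0" using that by auto
    then show ?thesis using q(2)[OF that] q(4)[OF that] by (simp add: power_add add_divide_distrib)
  qed
  moreover have "(\<lambda>\<xi>. q \<xi> * \<xi>^m' + q' \<xi> * \<xi>^m) holomorphic_on UNIV"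
    by (intro holomorphic_intros q)
  ultimately show ?case by blast
next
  case (mult f g)
  then obtain m q m' q' where q: "q holomorphic_on UNIV" "\<And>\<xi>. norm \<xi> = 1 \<Longrightarrow> of_real (f \<xi>) = q \<xi> / \<xi>^m"
    "q' holomorphic_on UNIV" "\<And>\<xi>. norm \<xi> = 1 \<Longrightarrow> of_real (g \<xi>) = q' \<xi> / \<xi>^m'" by blast
  have "of_real (f \<xi> * g \<xi>) = (\<lambda>\<xi>. q \<xi> * q' \<xi>) \<xi> / \<xi>^(m+m')" if "norm \<xi> = 1" for \<xi>
    using q(2)[OF that] q(4)[OF that] by (simp add: power_add)
  moreover have "(\<lambda>\<xi>. q \<xi> * q' \<xi>) holomorphic_on UNIV"
    by (intro holomorphic_intros q)
  ultimately show ?case by blast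
qed

lemma Laurent_approximation:
  fixes \<tau> :: "complex \<Rightarrow> real"
  assumes "continuous_on UNIV \<tau>" "\<kappa> > 0"
  shows "\<exists>m q. q holomorphic_on UNIV \<and> (\<forall>\<xi>. norm \<xi> = 1 \<longrightarrow> norm (q \<xi> / \<xi>^m - of_real (\<tau> \<xi>)) < \<kappa>)"
proof -
  obtain p where p: "polynomial_function p" "\<And>\<xi>. \<xi> \<in> sphere 0 1 \<Longrightarrow> norm (\<tau> \<xi> - p \<xi>) < \<kappa>"
    using Stone_Weierstrass_polynomial_function[of "sphere 0 1" \<tau> \<kappa>] assms
    by (metis compact_sphere continuous_on_subset real_norm_def subset_UNIV)
  from p(1) have "real_polynomial_function p" by (simp add: real_polynomial_function_eq)
  then obtain m q where q: "q holomorphic_on UNIV" "\<And>\<xi>. norm \<xi> = 1 \<Longrightarrow> of_real (p \<xi>) = q \<xi> / \<xi>^m"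
    using polynomial_on_circle_is_Laurent by blast
  have "norm (q \<xi> / \<xi>^m - of_real (\<tau> \<xi>)) < \<kappa>" if "norm \<xi> = 1" for \<xi>
  proof -
    have "q \<xi> / \<xi>^m - of_real (\<tau> \<xi>) = of_real (p \<xi> - \<tau> \<xi>)" using q(2)[OF that] by simp
    then show ?thesis using p(2)[of \<xi>] that by (simp add: norm_of_real abs_minus_commute del: of_real_diff)
  qed
  then show ?thesis using q by blast
qed

text \<open>The boundary values of a dilated map, made continuous on the whole plane by projecting onto the
  closed unit disc. Hardy space integrands say nothing off the circle, so they may be
  replaced by these functions, which are measurable.\<close>

lemma radial_extension:
  assumes f: "f holomorphic_on ball 0 1" and r: "0 \<le> r" "r < 1"
  shows "\<exists>g :: complex \<Rightarrow> complex. continuous_on UNIV g \<and> (\<forall>\<xi>. norm \<xi> = 1 \<longrightarrow> g \<xi> = f (of_real r * \<xi>))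
    \<and> (\<forall>\<xi>. g \<xi> \<in> f ` cball 0 r)"
proof -
  define g where "g \<xi> = f (of_real r * \<xi> / of_real (max 1 (norm \<xi>)))" for \<xi> :: complex
  have m: "norm (of_real r * \<xi> / of_real (max 1 (norm \<xi>))) \<le> r" for \<xi> :: complex
  proof -
    have "r * norm \<xi> \<le> r * max 1 (norm \<xi>)" using r by (intro mult_left_mono) auto
    then show ?thesis using r by (simp add: norm_mult norm_divide field_simps)
  qed
  have "continuous_on UNIV g"
    unfolding g_def
  proof (rule continuous_on_compose2[OF holomorphic_on_imp_continuous_on[OF f]])
    have "max 1 (norm \<xi>) \<noteq> 0" for \<xi> :: complex by (metis max.cobounded1 not_one_le_zero)
    then show "continuous_on UNIV (\<lambda>\<xi>::complex. of_real r * \<xi> / of_real (max 1 (norm \<xi>)))"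
      by (intro continuous_intros) auto
    show "(\<lambda>\<xi>::complex. of_real r * \<xi> / of_real (max 1 (norm \<xi>))) ` UNIV \<subseteq> ball 0 1"
      using le_less_trans[OF m r(2)] by auto
  qed
  moreover have "g \<xi> = f (of_real r * \<xi>)" if "norm \<xi> = 1" for \<xi> using that by (simp add: g_def)
  moreover have "g \<xi> \<in> f ` cball 0 r" for \<xi> unfolding g_def using m by auto
  ultimately show ?thesis by blast
qed

section \<open>Gluing analytic discs\<close>

text \<open>Requiring the disc to be entire costs nothing, since dilations of a holomorphic map on the unit
  disc can be approximated by polynomials; it makes composition and translation of discs immediate.\<close>

definition disc_into :: "complex set \<Rightarrow> (complex \<Rightarrow> complex) \<Rightarrow> bool" where
  "disc_into \<Omega> f \<longleftrightarrow> f holomorphic_on UNIV \<and> f ` cball 0 1 \<subseteq> \<Omega>"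

lemma disc_into_cont: "disc_into \<Omega> f \<Longrightarrow> continuous_on A f"
  unfolding disc_into_def using holomorphic_on_imp_continuous_on continuous_on_subset by blast

text \<open>Poletsky's construction. The family \<open>G \<xi> w\<close> attaches to each boundary point
  \<open>\<xi>\<close> of the disc \<open>b\<close> a disc centred at \<open>b \<xi>\<close>. Replace the weights
  \<open>\<tau>\<close> by Laurent polynomials and \<open>w\<close> by \<open>c * z ^ N\<close>: for large \<open>N\<close> the poles disappear
  and the result is a single entire disc which stays close to \<open>b\<close> inside the unit disc, while
  on the circle its values wander through all the attached discs. Averaging over the rotation \<open>c\<close>
  turns its boundary mean into the double mean of the family, so some \<open>c\<close> does at least as well.\<close>

lemma glue_discs_approx:
  fixes b :: "complex \<Rightarrow> complex" and f :: "'i \<Rightarrow> complex \<Rightarrow> complex" and \<tau> :: "'i \<Rightarrow> complex \<Rightarrow> real"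
    and \<psi> :: "complex \<Rightarrow> real" and I :: "'i set"
  defines "G \<equiv> \<lambda>\<xi> w. b \<xi> + (\<Sum>i\<in>I. f i (of_real (\<tau> i \<xi>) * w) - f i 0)"
  assumes \<Omega>: "open \<Omega>" and b: "disc_into \<Omega> b" and I: "finite I"
    and f: "\<And>i. i \<in> I \<Longrightarrow> f i holomorphic_on UNIV"
    and \<tau>: "\<And>i. i \<in> I \<Longrightarrow> continuous_on UNIV (\<tau> i)" "\<And>i \<xi>. i \<in> I \<Longrightarrow> 0 \<le> \<tau> i \<xi> \<and> \<tau> i \<xi> \<le> 1"
    and G: "\<And>\<xi> w. norm \<xi> = 1 \<Longrightarrow> norm w \<le> 1 \<Longrightarrow> G \<xi> w \<in> \<Omega>"
    and \<psi>: "continuous_on UNIV \<psi>" and eps: "\<epsilon> > 0" and r: "r < 1"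
  obtains F where "disc_into \<Omega> F" "F 0 = b 0" "\<And>z. norm z \<le> r \<Longrightarrow> norm (F z - b z) < \<epsilon>"
    "(LINT \<xi>|circle_measure. \<psi> (F \<xi>)) > (LINT \<xi>|circle_measure. LINT w|circle_measure. \<psi> (G \<xi> w)) - \<epsilon>"
proof -
  note [continuous_intros] = continuous_on_compose2[OF \<psi>]
  have fc [continuous_intros]: "continuous_on A g \<Longrightarrow> i \<in> I \<Longrightarrow> continuous_on A (\<lambda>x. f i (g x))" for A :: "'x::topological_space set" and g i
    using continuous_on_compose2[OF holomorphic_on_imp_continuous_on[OF f]] by blast
  have bc [continuous_intros]: "continuous_on A g \<Longrightarrow> continuous_on A (\<lambda>x. b (g x))" for A :: "'x::topological_space set" and g
    using continuous_on_compose2[OF disc_into_cont[OF b, of UNIV]] by blast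
  have tc [continuous_intros]: "continuous_on A g \<Longrightarrow> i \<in> I \<Longrightarrow> continuous_on A (\<lambda>x. \<tau> i (g x))" for A :: "'x::topological_space set" and g i
    using continuous_on_compose2[OF \<tau>(1)] by blast
  have bhol: "b holomorphic_on UNIV" using b by (simp add: disc_into_def)
  have Gc: "continuous_on A (\<lambda>p. G (fst p) (snd p))" for A
    unfolding G_def by (intro continuous_intros) auto
  \<comment> \<open>a margin around the compact set of all values that occur\<close>
  define K where "K = (\<lambda>p. G (fst p) (snd p)) ` (sphere 0 1 \<times> cball 0 1) \<union> b ` cball 0 1"
  have K: "compact K" unfolding K_def
    by (intro compact_Un compact_continuous_image Gc compact_Times bc continuous_on_id) auto
  have K\<Omega>: "K \<subseteq> \<Omega>" using b G by (auto simp: K_def disc_into_def)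
  obtain \<delta>0 where d0: "\<delta>0 > 0" "\<And>x y. x \<in> K \<Longrightarrow> norm (y - x) < \<delta>0 \<Longrightarrow> y \<in> \<Omega>"
    using compact_open_margin[OF K \<Omega> K\<Omega>] by metis
  obtain \<delta>1 where d1: "\<delta>1 > 0" "\<And>x y. x \<in> K \<Longrightarrow> norm (y - x) < \<delta>1 \<Longrightarrow> \<bar>\<psi> y - \<psi> x\<bar> < \<epsilon>/2"
    using compact_uniform_modulus[OF K \<psi>, of "\<epsilon>/2"] eps by (metis half_gt_zero)
  define \<delta> where "\<delta> = min \<epsilon> (min \<delta>0 \<delta>1)"
  have d: "\<delta> > 0" using d0 d1 eps by (simp add: \<delta>_def)
  define \<delta>' where "\<delta>' = \<delta> / (2 * (card I + 1))"
  have d': "\<delta>' > 0" using d by (simp add: \<delta>'_def)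
  have cd': "card I * \<delta>' < \<delta>/2" using d by (simp add: \<delta>'_def field_simps)
  have sum_small: "norm (sum h I) < \<delta>/2" if "\<And>i. i \<in> I \<Longrightarrow> norm (h i) \<le> \<delta>'" for h :: "'i \<Rightarrow> complex"
  proof -
    have "norm (sum h I) \<le> (\<Sum>i\<in>I. \<delta>')" using that by (rule sum_norm_le)
    then show ?thesis using cd' by simp
  qed
  \<comment> \<open>a common modulus of continuity for the discs\<close>
  have "\<forall>i\<in>I. \<exists>\<kappa>>0. \<forall>x y. norm x \<le> 2 \<longrightarrow> norm y \<le> 2 \<longrightarrow> norm (x - y) < \<kappa> \<longrightarrow> norm (f i x - f i y) < \<delta>'"
  proof
    fix i assume i: "i \<in> I"
    have "uniformly_continuous_on (cball 0 2) (f i)"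
      by (intro compact_uniformly_continuous fc continuous_on_id i) auto
    then show "\<exists>\<kappa>>0. \<forall>x y. norm x \<le> 2 \<longrightarrow> norm y \<le> 2 \<longrightarrow> norm (x - y) < \<kappa> \<longrightarrow> norm (f i x - f i y) < \<delta>'"
      using d' unfolding uniformly_continuous_on_def dist_norm by (metis mem_cball_0)
  qed
  then obtain \<kappa>f where kf: "\<And>i. i \<in> I \<Longrightarrow> \<kappa>f i > 0"
    "\<And>i x y. i \<in> I \<Longrightarrow> norm x \<le> 2 \<Longrightarrow> norm y \<le> 2 \<Longrightarrow> norm (x - y) < \<kappa>f i \<Longrightarrow> norm (f i x - f i y) < \<delta>'"
    by metis
  have "\<forall>i\<in>I. \<exists>m q. q holomorphic_on UNIV \<and> (\<forall>\<xi>. norm \<xi> = 1 \<longrightarrow> norm (q \<xi> / \<xi>^m - of_real (\<tau> i \<xi>)) < min 1 (\<kappa>f i))"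
    using kf(1) \<tau>(1) by (intro ballI Laurent_approximation) auto
  then obtain m q where q: "\<And>i. i \<in> I \<Longrightarrow> q i holomorphic_on UNIV"
    "\<And>i \<xi>. i \<in> I \<Longrightarrow> norm \<xi> = 1 \<Longrightarrow> norm (q i \<xi> / \<xi>^m i - of_real (\<tau> i \<xi>)) < min 1 (\<kappa>f i)"
    by metis
  have qc [continuous_intros]: "continuous_on A g \<Longrightarrow> i \<in> I \<Longrightarrow> continuous_on A (\<lambda>x. q i (g x))" for A :: "'x::topological_space set" and g i
    using continuous_on_compose2[OF holomorphic_on_imp_continuous_on[OF q(1)]] by blast
  define H where "H z w = b z + (\<Sum>i\<in>I. f i (q i z / z^m i * w) - f i 0)" for z w
  have HG: "norm (H \<xi> w - G \<xi> w) < \<delta>/2" if "norm \<xi> = 1" "norm w \<le> 1" for \<xi> w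
  proof -
    have "H \<xi> w - G \<xi> w = (\<Sum>i\<in>I. f i (q i \<xi> / \<xi>^m i * w) - f i (of_real (\<tau> i \<xi>) * w))"
      by (simp add: H_def G_def sum_subtractf)
    also have "norm \<dots> < \<delta>/2"
    proof (rule sum_small)
      fix i assume i: "i \<in> I"
      define a where "a = q i \<xi> / \<xi>^m i"
      have t: "0 \<le> \<tau> i \<xi>" "\<tau> i \<xi> \<le> 1" using \<tau>(2)[OF i] by auto
      have a: "norm (a - of_real (\<tau> i \<xi>)) < 1" "norm (a - of_real (\<tau> i \<xi>)) < \<kappa>f i"
        using q(2)[OF i that(1)] by (auto simp: a_def)
      have "norm a \<le> norm (a - of_real (\<tau> i \<xi>)) + norm (of_real (\<tau> i \<xi>) :: complex)"
        by (metis diff_add_cancel norm_triangle_ineq)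
      then have "norm a \<le> 2" using a(1) t by simp
      then have 1: "norm (a * w) \<le> 2" using that(2) mult_mono[of "norm a" 2 "norm w" 1] by (simp add: norm_mult)
      have 2: "norm (of_real (\<tau> i \<xi>) * w) \<le> 2" using t that(2) mult_mono[of "\<tau> i \<xi>" 1 "norm w" 1] by (simp add: norm_mult)
      have "norm (a * w - of_real (\<tau> i \<xi>) * w) = norm (a - of_real (\<tau> i \<xi>)) * norm w"
        by (simp add: norm_mult left_diff_distrib[symmetric])
      also have "\<dots> \<le> norm (a - of_real (\<tau> i \<xi>))" using that(2) by (simp add: mult_left_le)
      finally show "norm (f i (a * w) - f i (of_real (\<tau> i \<xi>) * w)) \<le> \<delta>'" 
        using kf(2)[OF i 1 2] a(2) by simp
    qed
    finally show ?thesis .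
  qed
  \<comment> \<open>near the circle, moving \<open>z\<close> to \<open>z / norm z\<close> hardly changes the attached disc\<close>
  have "uniformly_continuous_on ((cball 0 1 - ball 0 (1/2)) \<times> cball 0 1) (\<lambda>p. H (fst p) (snd p))"
    unfolding H_def
    by (intro compact_uniformly_continuous compact_Times compact_diff continuous_intros) auto
  then obtain \<eta> where eta: "\<eta> > 0" "\<And>z z' w. norm z \<le> 1 \<Longrightarrow> norm z \<ge> 1/2 \<Longrightarrow> norm z' \<le> 1 \<Longrightarrow> norm z' \<ge> 1/2 \<Longrightarrow> norm w \<le> 1
      \<Longrightarrow> norm (z' - z) < \<eta> \<Longrightarrow> norm (H z' w - H z w) < \<delta>/2"
    using d unfolding uniformly_continuous_on_def
    by (clarsimp simp: dist_norm) (drule spec[of _ "\<delta>/2"], clarsimp simp: norm_Pair)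
  define \<rho> where "\<rho> = max (max r (1/2)) (1 - \<eta>/2)"
  have rho: "\<rho> < 1" "r \<le> \<rho>" "1/2 \<le> \<rho>" "0 < \<rho>" using r eta(1) unfolding \<rho>_def by linarith+
  have near: "norm (H z w - G (z / norm z) w) < \<delta>" if "\<rho> \<le> norm z" "norm z \<le> 1" "norm w \<le> 1" for z w
  proof -
    have nz: "norm z > 0" "norm z \<ge> 1/2" using that rho by linarith+
    then have n1: "norm (z / norm z) = 1" by (simp add: norm_divide)
    have "z - z / norm z = (z / norm z) * of_real (norm z - 1)" using nz by (simp add: right_diff_distrib)
    then have "norm (z - z / norm z) = 1 - norm z"
      using n1 that by (simp only: norm_mult norm_of_real) simp
    also have "\<dots> < \<eta>" using that eta(1) by (auto simp: \<rho>_def)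
    finally have "norm (H z w - H (z / norm z) w) < \<delta>/2"
      using eta(2)[of "z / norm z" z w] n1 nz that by simp
    then have "norm (H z w - H (z / norm z) w) + norm (H (z / norm z) w - G (z / norm z) w) < \<delta>"
      using HG[OF n1 that(3)] by simp
    then show ?thesis
      using norm_triangle_ineq[of "H z w - H (z / norm z) w" "H (z / norm z) w - G (z / norm z) w"] by simp
  qed
  \<comment> \<open>well inside the unit disc the factor \<open>z ^ N\<close> makes the correction terms small\<close>
  have "\<forall>i\<in>I. eventually (\<lambda>N. \<forall>z. norm z \<le> \<rho> \<longrightarrow> norm (q i z) * \<rho>^(N - m i) < min 1 (\<kappa>f i)) sequentially"
  proof
    fix i assume i: "i \<in> I"
    have "compact (q i ` cball 0 1)"
      by (intro compact_continuous_image qc continuous_on_id i) auto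
    then obtain B where B0: "\<forall>z\<in>cball 0 1. norm (q i z) \<le> B" using compact_imp_bounded bounded_iff by (metis image_eqI)
    then have B: "norm (q i z) \<le> \<bar>B\<bar> + 1" if "norm z \<le> \<rho>" for z
    proof -
      have "z \<in> cball 0 1" using that rho by simp
      then have "norm (q i z) \<le> B" using B0 by blast
      then show ?thesis by simp
    qed
    have "(\<lambda>k. (\<bar>B\<bar> + 1) * \<rho>^k) \<longlonglongrightarrow> (\<bar>B\<bar> + 1) * 0"
      using rho by (intro tendsto_mult LIMSEQ_power_zero tendsto_const) auto
    then have "eventually (\<lambda>k. (\<bar>B\<bar> + 1) * \<rho>^k < min 1 (\<kappa>f i)) sequentially"
      using kf(1)[OF i] by (intro order_tendstoD(2)) auto
    then have "eventually (\<lambda>N. (\<bar>B\<bar> + 1) * \<rho>^(N - m i) < min 1 (\<kappa>f i)) sequentially"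
      unfolding eventually_sequentially by (metis add_le_imp_le_diff)
    then show "eventually (\<lambda>N. \<forall>z. norm z \<le> \<rho> \<longrightarrow> norm (q i z) * \<rho>^(N - m i) < min 1 (\<kappa>f i)) sequentially"
    proof eventually_elim
      case (elim N)
      show ?case
      proof safe
        fix z :: complex assume "norm z \<le> \<rho>"
        then have "norm (q i z) * \<rho>^(N - m i) \<le> (\<bar>B\<bar> + 1) * \<rho>^(N - m i)"
          using B rho by (intro mult_right_mono) auto
        then show "norm (q i z) * \<rho>^(N - m i) < min 1 (\<kappa>f i)" using elim by linarith
      qed
    qed
  qed
  then have "eventually (\<lambda>N. \<forall>i\<in>I. \<forall>z. norm z \<le> \<rho> \<longrightarrow> norm (q i z) * \<rho>^(N - m i) < min 1 (\<kappa>f i)) sequentially"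
    using I by (simp add: eventually_ball_finite_distrib)
  moreover have "eventually (\<lambda>N. \<forall>i\<in>I. m i < N) sequentially"
    using I by (auto simp: eventually_ball_finite_distrib eventually_gt_at_top)
  ultimately have "eventually (\<lambda>N. (\<forall>i\<in>I. \<forall>z. norm z \<le> \<rho> \<longrightarrow> norm (q i z) * \<rho>^(N - m i) < min 1 (\<kappa>f i)) \<and> (\<forall>i\<in>I. m i < N)) sequentially"
    by (rule eventually_conj)
  then obtain N where N: "\<And>i z. i \<in> I \<Longrightarrow> norm z \<le> \<rho> \<Longrightarrow> norm (q i z) * \<rho>^(N - m i) < min 1 (\<kappa>f i)"
    and mN: "\<And>i. i \<in> I \<Longrightarrow> m i < N"
    using eventually_happens'[OF sequentially_bot] by blast
  define F where "F c z = b z + (\<Sum>i\<in>I. f i (c * q i z * z^(N - m i)) - f i 0)" for c z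
  have FH: "F c z = H z (c * z^N)" if "z \<noteq> 0" for c z
    unfolding F_def H_def using mN that
    by (intro arg_cong2[where f="(+)"] sum.cong refl arg_cong2[where f="(-)"] arg_cong[of _ _ "f _"])
       (auto simp: power_diff less_imp_le)
  have Fin: "norm (F c z - b z) < \<delta>/2" if "norm c = 1" "norm z \<le> \<rho>" for c z
  proof -
    have "F c z - b z = (\<Sum>i\<in>I. f i (c * q i z * z^(N - m i)) - f i 0)" by (simp add: F_def)
    also have "norm \<dots> < \<delta>/2"
    proof (rule sum_small)
      fix i assume i: "i \<in> I"
      have "norm (c * q i z * z^(N - m i)) = norm (q i z) * norm z^(N - m i)" using that by (simp add: norm_mult norm_power)
      also have "\<dots> \<le> norm (q i z) * \<rho>^(N - m i)" using that by (intro mult_left_mono power_mono) auto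
      also have "\<dots> < min 1 (\<kappa>f i)" using N[OF i that(2)] .
      finally show "norm (f i (c * q i z * z^(N - m i)) - f i 0) \<le> \<delta>'"
        using kf(2)[OF i, of "c * q i z * z^(N - m i)" 0] by simp
    qed
    finally show ?thesis .
  qed
  have Fhol: "F c holomorphic_on UNIV" for c
    unfolding F_def using q(1)
    by (intro holomorphic_intros bhol holomorphic_on_compose_gen[OF _ f, unfolded o_def]) auto
  have Fdisc: "disc_into \<Omega> (F c)" if c: "norm c = 1" for c
    unfolding disc_into_def
  proof (intro conjI Fhol image_subsetI)
    fix z :: complex assume z: "z \<in> cball 0 1"
    show "F c z \<in> \<Omega>"
    proof (cases "norm z \<le> \<rho>")
      case True
      have "b z \<in> K" using z by (auto simp: K_def)
      moreover have "\<delta>/2 < \<delta>0" using d by (auto simp: \<delta>_def)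
      ultimately show ?thesis using d0(2)[of "b z" "F c z"] Fin[OF c True] by simp
    next
      case False
      then have z0: "z \<noteq> 0" using rho by auto
      have zN: "norm (c * z^N) \<le> 1" using c z by (simp add: norm_mult norm_power power_le_one)
      have "(z / norm z, c * z^N) \<in> sphere 0 1 \<times> cball 0 1" using z0 zN by (simp add: norm_divide)
      then have "G (z / norm z) (c * z^N) \<in> K" unfolding K_def by force
      then show ?thesis unfolding FH[OF z0] using near[of z "c * z^N"] False z zN d0(2) by (simp add: \<delta>_def)
    qed
  qed
  \<comment> \<open>rotation invariance turns the mean over \<open>c\<close> at a boundary point into the mean over the disc attached there\<close>
  define M where "M = (LINT \<xi>|circle_measure. LINT w|circle_measure. \<psi> (G \<xi> w))"
  define A where "A c = (LINT \<xi>|circle_measure. \<psi> (F c \<xi>))" for c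
  have iG: "integrable (circle_measure \<Otimes>\<^sub>M circle_measure) (\<lambda>p. \<psi> (G (fst p) (snd p)))"
    unfolding G_def by (intro circle_pair_integrable continuous_intros) auto
  have iF: "integrable (circle_measure \<Otimes>\<^sub>M circle_measure) (\<lambda>p. \<psi> (F (snd p) (fst p)))"
    unfolding F_def by (intro circle_pair_integrable continuous_intros) auto
  have iGx: "integrable circle_measure (\<lambda>w. \<psi> (G \<xi> w))" for \<xi>
    unfolding G_def by (intro circle_integrable continuous_intros) auto
  have iA: "integrable circle_measure A"
    unfolding A_def using circle_pair.integrable_snd[of "\<lambda>x y. \<psi> (F y x)"] iF by (simp add: split_beta')
  have "M - \<epsilon>/2 \<le> (LINT \<xi>|circle_measure. LINT c|circle_measure. \<psi> (F c \<xi>))"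
  proof -
    have "(LINT \<xi>|circle_measure. (LINT w|circle_measure. \<psi> (G \<xi> w)) - \<epsilon>/2) \<le> (LINT \<xi>|circle_measure. LINT c|circle_measure. \<psi> (F c \<xi>))"
    proof (rule circle_mean_mono)
      have "integrable circle_measure (\<lambda>\<xi>. LINT w|circle_measure. \<psi> (G \<xi> w))"
        using circle_pair.integrable_fst[of "\<lambda>x y. \<psi> (G x y)"] iG by (simp add: split_beta')
      then show "integrable circle_measure (\<lambda>\<xi>. (LINT w|circle_measure. \<psi> (G \<xi> w)) - \<epsilon>/2)" by simp
      show "integrable circle_measure (\<lambda>\<xi>. LINT c|circle_measure. \<psi> (F c \<xi>))"
        using circle_pair.integrable_fst[of "\<lambda>x y. \<psi> (F y x)"] iF by (simp add: split_beta')
      fix \<xi> :: complex assume x: "norm \<xi> = 1"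
      then have x0: "\<xi> \<noteq> 0" by auto
      have cH: "continuous_on UNIV (\<lambda>w. \<psi> (H \<xi> w))" unfolding H_def by (intro continuous_intros) auto
      have "(LINT w|circle_measure. \<psi> (G \<xi> w) - \<epsilon>/2) \<le> (LINT w|circle_measure. \<psi> (H \<xi> w))"
      proof (rule circle_mean_mono)
        fix w :: complex assume w: "norm w = 1"
        then have "G \<xi> w \<in> K" using x unfolding K_def by force
        moreover have "norm (H \<xi> w - G \<xi> w) < \<delta>1" using HG[of \<xi> w] x w d by (auto simp: \<delta>_def)
        ultimately have "\<bar>\<psi> (H \<xi> w) - \<psi> (G \<xi> w)\<bar> < \<epsilon>/2" by (rule d1(2))
        then show "\<psi> (G \<xi> w) - \<epsilon>/2 \<le> \<psi> (H \<xi> w)" by linarith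
      qed (use iGx circle_integrable[OF cH] in auto)
      also have "\<dots> = (LINT c|circle_measure. \<psi> (H \<xi> (\<xi>^N * c)))"
        by (rule circle_rotate[symmetric]) (use x cH in \<open>auto simp: norm_power\<close>)
      also have "\<dots> = (LINT c|circle_measure. \<psi> (F c \<xi>))" by (simp add: FH[OF x0] mult.commute)
      finally show "(LINT w|circle_measure. \<psi> (G \<xi> w)) - \<epsilon>/2 \<le> (LINT c|circle_measure. \<psi> (F c \<xi>))"
        using iGx by (simp add: circle_UNIV)
    qed
    moreover have "(LINT \<xi>|circle_measure. (LINT w|circle_measure. \<psi> (G \<xi> w)) - \<epsilon>/2) = M - \<epsilon>/2"
      unfolding M_def using circle_pair.integrable_fst[of "\<lambda>x y. \<psi> (G x y)"] iG by (simp add: split_beta' circle_UNIV)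
    ultimately show ?thesis by simp
  qed
  also have "\<dots> = (LINT c|circle_measure. A c)"
    unfolding A_def using circle_pair.Fubini_integral[of "\<lambda>x y. \<psi> (F y x)"] iF by (simp add: split_beta')
  finally have MA: "M - \<epsilon>/2 \<le> (LINT c|circle_measure. A c)" .
  have "\<exists>c. norm c = 1 \<and> A c > M - \<epsilon>"
  proof (rule ccontr)
    assume "\<not> ?thesis"
    then have "(LINT c|circle_measure. A c) \<le> M - \<epsilon>" by (intro circle_mean_bound iA) force
    then show False using MA eps by simp
  qed
  then obtain c where c: "norm c = 1" "A c > M - \<epsilon>" by blast
  show ?thesis
  proof (rule that[of "F c"])
    show "F c 0 = b 0" using mN by (simp add: F_def sum.neutral zero_power)
    show "norm (F c z - b z) < \<epsilon>" if "norm z \<le> r" for z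
      using Fin[OF c(1), of z] that rho d by (auto simp: \<delta>_def)
  qed (use c Fdisc in \<open>auto simp: A_def M_def\<close>)
qed

text \<open>Translates of a disc
  serve all nearby centres, so finitely many discs suffice, each responsible for a piece \<open>V i\<close> of
  the circle. A disc centred at \<open>b \<xi>\<close> may be shrunk to a point without leaving \<open>\<Omega>\<close>; the
  weights \<open>\<tau>\<close> do this near the ends of the pieces, which makes the family continuous, and their
  effect on the mean vanishes in the limit.\<close>

lemma glue_discs:
  fixes b :: "complex \<Rightarrow> complex" and \<psi> \<gamma> :: "complex \<Rightarrow> real"
  assumes \<Omega>: "open \<Omega>" and b: "disc_into \<Omega> b"
    and \<psi>: "continuous_on UNIV \<psi>" "\<And>z. \<psi> z \<ge> 0"
    and \<gamma>: "\<gamma> \<in> borel_measurable borel" "continuous_on (sphere 0 1) \<gamma>"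
    and ex: "\<And>\<xi>. norm \<xi> = 1 \<Longrightarrow> \<exists>f. disc_into \<Omega> f \<and> f 0 = b \<xi> \<and> \<gamma> \<xi> < (LINT w|circle_measure. \<psi> (f w))"
    and eps: "\<epsilon> > 0" and r: "r < 1"
  obtains F where "disc_into \<Omega> F" "F 0 = b 0" "\<And>z. norm z \<le> r \<Longrightarrow> norm (F z - b z) < \<epsilon>"
    "(LINT \<xi>|circle_measure. \<psi> (F \<xi>)) > (LINT \<xi>|circle_measure. \<gamma> \<xi>) - \<epsilon>"
proof -
  obtain f where f: "\<And>\<xi>. norm \<xi> = 1 \<Longrightarrow> disc_into \<Omega> (f \<xi>)" "\<And>\<xi>. norm \<xi> = 1 \<Longrightarrow> f \<xi> 0 = b \<xi>"
    "\<And>\<xi>. norm \<xi> = 1 \<Longrightarrow> \<gamma> \<xi> < (LINT w|circle_measure. \<psi> (f \<xi> w))"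
    using ex by metis
  have bcont: "continuous_on UNIV b" using disc_into_cont[OF b] .
  have \<gamma>int: "integrable circle_measure \<gamma>"
    by (rule circle_integral(2)[OF \<gamma>(1)], rule continuous_on_compose2[OF \<gamma>(2)]) (auto intro!: continuous_intros)
  define good where "good \<xi> \<xi>' \<longleftrightarrow> (\<forall>w. norm w \<le> 1 \<longrightarrow> f \<xi> w + (b \<xi>' - b \<xi>) \<in> \<Omega>) \<and>
       \<gamma> \<xi>' < (LINT w|circle_measure. \<psi> (f \<xi> w + (b \<xi>' - b \<xi>)))" for \<xi> \<xi>'
  have "\<exists>\<rho>>0. \<forall>\<xi>'. norm \<xi>' = 1 \<longrightarrow> dist \<xi> \<xi>' < \<rho> \<longrightarrow> good \<xi> \<xi>'" if x: "norm \<xi> = 1" for \<xi>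
  proof -
    define e where "e = ((LINT w|circle_measure. \<psi> (f \<xi> w)) - \<gamma> \<xi>) / 3"
    have e: "e > 0" using f(3)[OF x] by (simp add: e_def)
    have ee: "(LINT w|circle_measure. \<psi> (f \<xi> w)) = \<gamma> \<xi> + 3 * e" by (simp add: e_def field_simps)
    have fc: "continuous_on UNIV (f \<xi>)" using disc_into_cont[OF f(1)[OF x]] .
    define K where "K = f \<xi> ` cball 0 1"
    have K: "compact K" "K \<subseteq> \<Omega>" unfolding K_def using f(1)[OF x]
      by (auto simp: disc_into_def intro!: compact_continuous_image continuous_on_subset[OF fc])
    obtain d0 where d0: "d0 > 0" "\<And>x y. x \<in> K \<Longrightarrow> norm (y - x) < d0 \<Longrightarrow> y \<in> \<Omega>"
      using compact_open_margin[OF K(1) \<Omega> K(2)] by metis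
    obtain d1 where d1: "d1 > 0" "\<And>x y. x \<in> K \<Longrightarrow> norm (y - x) < d1 \<Longrightarrow> \<bar>\<psi> y - \<psi> x\<bar> < e"
      using compact_uniform_modulus[OF K(1) \<psi>(1) e] by metis
    have "isCont b \<xi>" using bcont by (simp add: continuous_on_eq_continuous_at)
    then obtain s0 where s0: "s0 > 0" "\<And>x'. dist x' \<xi> < s0 \<Longrightarrow> dist (b x') (b \<xi>) < min d0 d1"
      using d0(1) d1(1) unfolding continuous_at_eps_delta by (metis min_less_iff_conj)
    obtain s1 where s1: "s1 > 0" "\<And>x'. norm x' = 1 \<Longrightarrow> dist x' \<xi> < s1 \<Longrightarrow> dist (\<gamma> x') (\<gamma> \<xi>) < e"
      using \<gamma>(2) x e unfolding continuous_on_iff by (metis mem_sphere_0)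
    show ?thesis
    proof (intro exI[of _ "min s0 s1"] conjI allI impI)
      fix \<xi>' assume x': "norm \<xi>' = 1" "dist \<xi> \<xi>' < min s0 s1"
      then have nb: "norm (b \<xi>' - b \<xi>) < d0" "norm (b \<xi>' - b \<xi>) < d1"
        using s0(2)[of \<xi>'] by (auto simp: dist_commute dist_norm)
      have g: "dist (\<gamma> \<xi>') (\<gamma> \<xi>) < e" using s1(2)[of \<xi>'] x' by (simp add: dist_commute)
      have inO: "f \<xi> w + (b \<xi>' - b \<xi>) \<in> \<Omega>" if "norm w \<le> 1" for w
      proof (rule d0(2))
        show "f \<xi> w \<in> K" using that by (simp add: K_def)
      qed (use nb in simp)
      have "(LINT w|circle_measure. \<psi> (f \<xi> w) - e) \<le> (LINT w|circle_measure. \<psi> (f \<xi> w + (b \<xi>' - b \<xi>)))"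
      proof (rule circle_mean_mono)
        show "integrable circle_measure (\<lambda>w. \<psi> (f \<xi> w) - e)"
          by (rule circle_integrable) (intro continuous_intros continuous_on_compose2[OF \<psi>(1) fc], auto)
        show "integrable circle_measure (\<lambda>w. \<psi> (f \<xi> w + (b \<xi>' - b \<xi>)))"
          by (rule circle_integrable) (rule continuous_on_compose2[OF \<psi>(1)], auto intro!: continuous_intros fc)
        fix w :: complex assume "norm w = 1"
        then have "f \<xi> w \<in> K" by (simp add: K_def)
        then have "\<bar>\<psi> (f \<xi> w + (b \<xi>' - b \<xi>)) - \<psi> (f \<xi> w)\<bar> < e" by (rule d1(2)) (use nb in simp)
        then show "\<psi> (f \<xi> w) - e \<le> \<psi> (f \<xi> w + (b \<xi>' - b \<xi>))" by linarith
      qed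
      moreover have "(LINT w|circle_measure. \<psi> (f \<xi> w) - e) = (LINT w|circle_measure. \<psi> (f \<xi> w)) - e"
        by (subst Bochner_Integration.integral_diff) 
          (auto intro!: circle_integrable continuous_on_compose2[OF \<psi>(1) fc])
      ultimately have "\<gamma> \<xi>' < (LINT w|circle_measure. \<psi> (f \<xi> w + (b \<xi>' - b \<xi>)))"
        using g e ee unfolding dist_real_def by linarith
      then show "good \<xi> \<xi>'" using inO by (simp add: good_def)
    qed (use s0 s1 in auto)
  qed
  then obtain \<rho> where rho: "\<And>\<xi>. norm \<xi> = 1 \<Longrightarrow> \<rho> \<xi> > 0"
    "\<And>\<xi> \<xi>'. norm \<xi> = 1 \<Longrightarrow> norm \<xi>' = 1 \<Longrightarrow> dist \<xi> \<xi>' < \<rho> \<xi> \<Longrightarrow> good \<xi> \<xi>'"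
    by metis
  obtain D where D: "D \<subseteq> sphere (0::complex) 1" "finite D" "sphere 0 1 \<subseteq> (\<Union>x\<in>D. ball x (\<rho> x))"
    using compactE_image[OF compact_sphere, of "sphere (0::complex) 1" "\<lambda>x. ball x (\<rho> x)" 0 1] rho(1)
    by (smt (verit, best) UN_I centre_in_ball mem_sphere_0 open_ball subsetI)
  obtain x n where x: "bij_betw x {..<n::nat} D"
    using ex_bij_betw_nat_finite[OF D(2)] by (metis atLeast0LessThan)
  have xn: "norm (x i) = 1" if "i < n" for i
    using x D(1) that unfolding bij_betw_def by auto
  define V where "V i = ball (x i) (\<rho> (x i)) - (\<Union>j<i. cball (x j) (\<rho> (x j)))" for i
  have Vo: "open (V i)" for i unfolding V_def by (intro open_Diff open_ball closed_UN) auto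
  have Vlt: False if "i < j" "z \<in> V i" "z \<in> V j" for i j z
  proof -
    have "z \<in> cball (x i) (\<rho> (x i))" using that(2) by (simp add: V_def)
    then show False using that(1,3) unfolding V_def by blast
  qed
  have Vd: "i = j" if "z \<in> V i" "z \<in> V j" for i j z
    using Vlt that by (cases i j rule: linorder_cases) blast+
  have Vne: "- V i \<noteq> {}" for i
  proof -
    have "V i \<noteq> UNIV" using bounded_subset[OF bounded_ball, of "V i" "x i" "\<rho> (x i)"] not_bounded_UNIV
      unfolding V_def by (metis Diff_subset)
    then show ?thesis by blast
  qed
  define \<tau> where "\<tau> k i \<xi> = min 1 (infdist \<xi> (- V i) * real (Suc k))" for k i \<xi>
  have tc: "continuous_on UNIV (\<tau> k i)" for k i
    unfolding \<tau>_def by (intro continuous_intros continuous_on_infdist)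
  have t01: "0 \<le> \<tau> k i \<xi> \<and> \<tau> k i \<xi> \<le> 1" for k i \<xi>
    unfolding \<tau>_def by (auto simp: infdist_nonneg)
  have t0: "\<tau> k i \<xi> = 0" if "\<xi> \<notin> V i" for k i \<xi>
    using that by (simp add: \<tau>_def)
  have t1: "eventually (\<lambda>k. \<tau> k i \<xi> = 1) sequentially" if "\<xi> \<in> V i" for i \<xi>
  proof -
    have "infdist \<xi> (- V i) > 0"
      using that Vo Vne by (metis ComplD closed_Compl in_closed_iff_infdist_zero infdist_nonneg less_eq_real_def)
    then obtain k0 where k0: "real k0 * infdist \<xi> (- V i) > 1" using reals_Archimedean3 by metis
    have "\<tau> k i \<xi> = 1" if "k \<ge> k0" for k
    proof -
      have "real k0 * infdist \<xi> (- V i) \<le> real (Suc k) * infdist \<xi> (- V i)"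
        using that by (intro mult_right_mono infdist_nonneg) auto
      then show ?thesis using k0 unfolding \<tau>_def by (simp add: mult.commute)
    qed
    then show ?thesis by (auto simp: eventually_sequentially)
  qed
  define G where "G k \<xi> w = b \<xi> + (\<Sum>i<n. f (x i) (of_real (\<tau> k i \<xi>) * w) - f (x i) 0)" for k \<xi> w
  have Gin: "G k \<xi> w = f (x i) (of_real (\<tau> k i \<xi>) * w) + (b \<xi> - b (x i))" if "\<xi> \<in> V i" "i < n" for k i \<xi> w
  proof -
    have "(\<Sum>j<n. f (x j) (of_real (\<tau> k j \<xi>) * w) - f (x j) 0)
        = (\<Sum>j<n. if j = i then f (x i) (of_real (\<tau> k i \<xi>) * w) - f (x i) 0 else 0)"
    proof (rule sum.cong)
      fix j assume "j \<in> {..<n}"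
      show "f (x j) (of_real (\<tau> k j \<xi>) * w) - f (x j) 0 = (if j = i then f (x i) (of_real (\<tau> k i \<xi>) * w) - f (x i) 0 else 0)"
      proof (cases "j = i")
        case False
        then have "\<tau> k j \<xi> = 0" using t0 Vd[OF that(1)] by metis
        then show ?thesis using False by simp
      qed simp
    qed simp
    also have "\<dots> = f (x i) (of_real (\<tau> k i \<xi>) * w) - f (x i) 0" using that(2) by simp
    finally show ?thesis using f(2)[OF xn[OF that(2)]] by (simp add: G_def)
  qed
  have Gout: "G k \<xi> w = b \<xi>" if "\<And>i. i < n \<Longrightarrow> \<xi> \<notin> V i" for k \<xi> w
    using t0 that by (simp add: G_def)
  have Vgood: "good (x i) \<xi>" if "norm \<xi> = 1" "\<xi> \<in> V i" "i < n" for \<xi> i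
    using rho(2)[OF xn[OF that(3)] that(1)] that(2) by (auto simp: V_def)
  have G\<Omega>: "G k \<xi> w \<in> \<Omega>" if "norm \<xi> = 1" "norm w \<le> 1" for k \<xi> w
  proof (cases "\<exists>i<n. \<xi> \<in> V i")
    case True
    then obtain i where i: "i < n" "\<xi> \<in> V i" by blast
    have "norm (of_real (\<tau> k i \<xi>) * w) \<le> 1"
      using t01[of k i \<xi>] that(2) by (simp add: norm_mult mult_le_one)
    then show ?thesis using Vgood[OF that(1) i(2,1)] unfolding Gin[OF i(2,1)] good_def by blast
  next
    case False
    then have "G k \<xi> w = b \<xi>" using Gout by blast
    then show ?thesis using b that by (auto simp: disc_into_def)
  qed
  define \<Theta> where "\<Theta> k \<xi> = (LINT w|circle_measure. \<psi> (G k \<xi> w))" for k \<xi>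
  have fhol: "f (x i) holomorphic_on UNIV" if "i \<in> {..<n}" for i
    using f(1)[OF xn] that by (simp add: disc_into_def)
  have fcont: "continuous_on A g \<Longrightarrow> i \<in> {..<n} \<Longrightarrow> continuous_on A (\<lambda>p. f (x i) (g p))" 
    for A :: "(complex \<times> complex) set" and g i
    using continuous_on_compose2[OF holomorphic_on_imp_continuous_on[OF fhol]] by blast
  have "continuous_on UNIV (\<lambda>p. \<psi> (G k (fst p) (snd p)))" for k
    unfolding G_def
    by (intro continuous_on_compose2[OF \<psi>(1)] continuous_intros fcont continuous_on_compose2[OF bcont] continuous_on_compose2[OF tc]) auto
  then have iG: "integrable (circle_measure \<Otimes>\<^sub>M circle_measure) (\<lambda>p. \<psi> (G k (fst p) (snd p)))" for k
    by (rule circle_pair_integrable)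
  have i\<Theta>: "integrable circle_measure (\<Theta> k)" for k
    unfolding \<Theta>_def using circle_pair.integrable_fst[of "\<lambda>x y. \<psi> (G k x y)"] iG[of k] by (simp add: split_beta')
  have \<Theta>0: "\<Theta> k \<xi> \<ge> 0" for k \<xi> unfolding \<Theta>_def using \<psi>(2) by (intro Bochner_Integration.integral_nonneg) auto
  \<comment> \<open>off the finitely many end points of the pieces the weight is eventually 1, and the full disc has mean above \<open>\<gamma>\<close>\<close>
  have "AE \<xi> in circle_measure. \<forall>i\<in>{..<n}. dist (x i) \<xi> \<noteq> \<rho> (x i)"
    by (rule AE_finite_allI) (auto intro: circle_AE_not_sphere xn)
  then have lim: "AE \<xi> in circle_measure. (\<lambda>k. min (\<Theta> k \<xi>) (\<gamma> \<xi>)) \<longlonglongrightarrow> \<gamma> \<xi>"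
    using AE_circle
  proof eventually_elim
    case (elim \<xi>)
    have "\<exists>i<n. dist (x i) \<xi> < \<rho> (x i)"
    proof -
      obtain y where y: "y \<in> D" "dist y \<xi> < \<rho> y" using D(3) elim by auto
      then obtain i where "i < n" "y = x i" using x by (auto simp: bij_betw_def)
      then show ?thesis using y by blast
    qed
    then obtain i where i: "i < n" "dist (x i) \<xi> < \<rho> (x i)" and mini: "\<And>j. j < i \<Longrightarrow> \<not> (j < n \<and> dist (x j) \<xi> < \<rho> (x j))"
      using exists_least_iff[of "\<lambda>i. i < n \<and> dist (x i) \<xi> < \<rho> (x i)"] by blast
    have V: "\<xi> \<in> V i" unfolding V_def using i mini elim by force
    have "eventually (\<lambda>k. min (\<Theta> k \<xi>) (\<gamma> \<xi>) = \<gamma> \<xi>) sequentially"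
      using t1[OF V]
    proof eventually_elim
      case (elim k)
      have "\<gamma> \<xi> < \<Theta> k \<xi>" using Vgood[OF _ V i(1)] \<open>norm \<xi> = 1\<close> unfolding \<Theta>_def Gin[OF V i(1)] good_def elim by simp
      then show ?case by simp
    qed
    then show ?case by (rule tendsto_eventually)
  qed
  have "(\<lambda>k. LINT \<xi>|circle_measure. min (\<Theta> k \<xi>) (\<gamma> \<xi>)) \<longlonglongrightarrow> (LINT \<xi>|circle_measure. \<gamma> \<xi>)"
  proof (rule integral_dominated_convergence[where w="\<lambda>\<xi>. \<bar>\<gamma> \<xi>\<bar>"])
    show "AE \<xi> in circle_measure. norm (min (\<Theta> k \<xi>) (\<gamma> \<xi>)) \<le> \<bar>\<gamma> \<xi>\<bar>" for k
    proof (rule AE_I2)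
      fix \<xi> show "norm (min (\<Theta> k \<xi>) (\<gamma> \<xi>)) \<le> \<bar>\<gamma> \<xi>\<bar>"
        using \<Theta>0[of k \<xi>] by (auto simp: min_def abs_if)
    qed
  qed (use lim \<gamma>int i\<Theta> in \<open>auto intro!: integrable_norm borel_measurable_min dest: borel_measurable_integrable\<close>)
  then have "eventually (\<lambda>k. (LINT \<xi>|circle_measure. min (\<Theta> k \<xi>) (\<gamma> \<xi>)) > (LINT \<xi>|circle_measure. \<gamma> \<xi>) - \<epsilon>/2) sequentially"
    using eps by (intro order_tendstoD(1)) auto
  then obtain k where "(LINT \<xi>|circle_measure. min (\<Theta> k \<xi>) (\<gamma> \<xi>)) > (LINT \<xi>|circle_measure. \<gamma> \<xi>) - \<epsilon>/2"
    by (auto simp: eventually_sequentially)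
  also have "(LINT \<xi>|circle_measure. min (\<Theta> k \<xi>) (\<gamma> \<xi>)) \<le> (LINT \<xi>|circle_measure. \<Theta> k \<xi>)"
    using i\<Theta> \<gamma>int by (intro integral_mono integrable_min) auto
  finally have k: "(LINT \<xi>|circle_measure. \<Theta> k \<xi>) > (LINT \<xi>|circle_measure. \<gamma> \<xi>) - \<epsilon>/2" .
  have e2: "\<epsilon>/2 > 0" using eps by simp
  show ?thesis
  proof (rule glue_discs_approx[of \<Omega> b "{..<n}" "\<lambda>i. f (x i)" "\<tau> k" \<psi> "\<epsilon>/2" r, OF \<Omega> b _ fhol tc t01 _ \<psi>(1) e2 r])
    fix F assume F: "disc_into \<Omega> F" "F 0 = b 0" "\<And>z. norm z \<le> r \<Longrightarrow> norm (F z - b z) < \<epsilon>/2"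
     "(LINT \<xi>|circle_measure. LINT w|circle_measure. \<psi> (b \<xi> + (\<Sum>i<n. f (x i) (of_real (\<tau> k i \<xi>) * w) - f (x i) 0))) - \<epsilon>/2 < (LINT \<xi>|circle_measure. \<psi> (F \<xi>))"
    have "norm (F z - b z) < \<epsilon>" if "norm z \<le> r" for z using F(3)[OF that] eps by simp
    moreover have "(LINT \<xi>|circle_measure. \<psi> (F \<xi>)) > (LINT \<xi>|circle_measure. \<gamma> \<xi>) - \<epsilon>"
      using F(4) k unfolding \<Theta>_def G_def by linarith
    ultimately show ?thesis using F(1,2) that by blast
  qed (use G\<Omega> in \<open>auto simp: G_def\<close>)
qed

section \<open>A curve that fills a disc\<close>

text \<open>Schoenberg's even function of period 2, which is 0 near the even integers and 1 near the odd
  ones. Applied to \<open>3 ^ j * t\<close> it reads off a ternary digit of a point \<open>t\<close> of the Cantor set.\<close>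

definition schoenberg_step :: "real \<Rightarrow> real" where
  "schoenberg_step t = max 0 (min 1 (3 * infdist t (range (\<lambda>k::int. 2 * real_of_int k)) - 1))"

lemma schoenberg_step_cont: "continuous_on A schoenberg_step"
  unfolding schoenberg_step_def by (intro continuous_intros continuous_on_infdist)

lemma schoenberg_step_range: "0 \<le> schoenberg_step t" "schoenberg_step t \<le> 1"
  unfolding schoenberg_step_def by auto

lemma schoenberg_step_digit:
  assumes c: "c = 0 \<or> c = 1" and s: "0 \<le> s" "s \<le> 1/3"
  shows "schoenberg_step (2 * real_of_int k + 2 * c / 3 + s) = c"
proof -
  define t where "t = 2 * real_of_int k + 2 * c / 3 + s"
  let ?E = "range (\<lambda>k::int. 2 * real_of_int k)"
  have d: "infdist t ?E \<le> 2 * c / 3 + s"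
    using infdist_le[of "2 * real_of_int k" ?E t] c s by (auto simp: t_def dist_real_def)
  show ?thesis
  proof (cases "c = 0")
    case True
    then show ?thesis using d s unfolding schoenberg_step_def t_def[symmetric] by simp
  next
    case False
    then have c1: "c = 1" using c by simp
    have "2/3 \<le> dist t y" if yE: "y \<in> ?E" for y
    proof -
      obtain j :: int where y: "y = 2 * real_of_int j" using yE by auto
      show ?thesis
      proof (cases "j \<le> k")
        case True
        then have "real_of_int j \<le> real_of_int k" by simp
        then show ?thesis using s unfolding y t_def c1 dist_real_def by linarith
      next
        case False
        then have "k + 1 \<le> j" by simp
        then have "real_of_int k + 1 \<le> real_of_int j" by linarith
        then show ?thesis using s unfolding y t_def c1 dist_real_def by linarith
      qed
    qed
    then have "2/3 \<le> (INF y\<in>?E. dist t y)" by (intro cINF_greatest) auto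
    then have "2/3 \<le> infdist t ?E" by (simp add: infdist_def)
    then have "schoenberg_step t = 1" unfolding schoenberg_step_def by simp
    then show ?thesis by (simp only: t_def c1)
  qed
qed

lemma schoenberg_step_ternary:
  fixes c :: "nat \<Rightarrow> real"
  assumes c: "\<And>i. c i = 0 \<or> c i = 1"
  shows "schoenberg_step (3^j * (\<Sum>i. 2 * c i / 3^Suc i)) = c j"
proof -
  have c01: "0 \<le> c i" "c i \<le> 1" for i using c[of i] by auto
  have geo: "(\<lambda>i. 2 / 3^Suc i) sums (1::real)"
    using sums_mult[OF geometric_sums[of "1/3::real"], of "2/3"] by (simp add: power_divide)
  have sm: "summable (\<lambda>i. 2 * c i / 3^Suc i)"
    by (rule summable_comparison_test'[OF sums_summable[OF geo], of 0]) (use c01 in \<open>auto simp: field_simps\<close>)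
  have tail: "0 \<le> (\<Sum>i. 2 * c (i + Suc j) / 3^Suc i)" "(\<Sum>i. 2 * c (i + Suc j) / 3^Suc i) \<le> 1"
  proof -
    have sm': "summable (\<lambda>i. 2 * c (i + Suc j) / 3^Suc i)"
      by (rule summable_comparison_test'[OF sums_summable[OF geo], of 0]) (use c01 in \<open>auto simp: field_simps\<close>)
    show "0 \<le> (\<Sum>i. 2 * c (i + Suc j) / 3^Suc i)" using c01 by (intro suminf_nonneg sm') auto
    have "(\<Sum>i. 2 * c (i + Suc j) / 3^Suc i) \<le> (\<Sum>i. 2 / 3^Suc i)"
      by (rule suminf_le[OF _ sm' sums_summable[OF geo]]) (use c01 in \<open>auto simp: field_simps\<close>)
    then show "(\<Sum>i. 2 * c (i + Suc j) / 3^Suc i) \<le> 1" using sums_unique[OF geo] by simp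
  qed
  have "\<exists>k::int. 3^j * (\<Sum>i<j. 2 * c i / 3^Suc i) = 2 * real_of_int k"
  proof (induction j)
    case (Suc j)
    then obtain k :: int where k: "3^j * (\<Sum>i<j. 2 * c i / 3^Suc i) = 2 * real_of_int k" by blast
    have "3^Suc j * (\<Sum>i<Suc j. 2 * c i / 3^Suc i) = 3 * (3^j * (\<Sum>i<j. 2 * c i / 3^Suc i)) + 2 * c j"
      by (simp add: distrib_left)
    also have "\<dots> = 2 * real_of_int (3 * k + (if c j = 0 then 0 else 1))"
      using c[of j] unfolding k by auto
    finally show ?case by blast
  qed simp
  then obtain k :: int where k: "3^j * (\<Sum>i<j. 2 * c i / 3^Suc i) = 2 * real_of_int k" by blast
  have "(\<Sum>i. 2 * c i / 3^Suc i) = (\<Sum>i. 2 * c (i + Suc j) / 3^Suc (i + Suc j)) + (\<Sum>i<Suc j. 2 * c i / 3^Suc i)"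
    by (rule suminf_split_initial_segment[OF sm])
  also have "(\<Sum>i. 2 * c (i + Suc j) / 3^Suc (i + Suc j)) = (\<Sum>i. (2 * c (i + Suc j) / 3^Suc i) / 3^Suc j)"
    by (simp add: power_add)
  also have "\<dots> = (\<Sum>i. 2 * c (i + Suc j) / 3^Suc i) / 3^Suc j"
    by (rule suminf_divide)
      (rule summable_comparison_test'[OF sums_summable[OF geo], of 0], use c01 in \<open>auto simp: field_simps\<close>)
  finally have "3^j * (\<Sum>i. 2 * c i / 3^Suc i) = 3^j * (\<Sum>i<j. 2 * c i / 3^Suc i) + 2 * c j / 3 + (\<Sum>i. 2 * c (i + Suc j) / 3^Suc i) / 3"
    by (simp add: distrib_left)
  then show ?thesis using schoenberg_step_digit[OF c, of "(\<Sum>i. 2 * c (i + Suc j) / 3^Suc i) / 3" k j] tail k by simp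
qed

lemma binary_expansion:
  fixes x :: real
  assumes "0 \<le> x" "x < 1"
  obtains c :: "nat \<Rightarrow> real" where "\<And>i. c i = 0 \<or> c i = 1" "(\<lambda>i. c i / 2^Suc i) sums x"
proof -
  define c :: "nat \<Rightarrow> real" where "c i = of_int (\<lfloor>2^Suc i * x\<rfloor> - 2 * \<lfloor>2^i * x\<rfloor>)" for i
  have c: "c i = 0 \<or> c i = (1::real)" for i
  proof -
    have "\<lfloor>2 * y\<rfloor> - 2 * \<lfloor>y\<rfloor> \<in> {0,1}" for y :: real by (simp, linarith)
    from this[of "2^i * x"] show ?thesis by (auto simp: c_def mult.assoc)
  qed
  have s: "(\<Sum>i<n. c i / 2^Suc i) = of_int \<lfloor>2^n * x\<rfloor> / 2^n" for n
  proof (induction n)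
    case 0
    then show ?case using assms by (simp add: floor_eq_iff)
  next
    case (Suc n)
    then show ?case by (simp add: c_def field_simps)
  qed
  have "(\<lambda>n. of_int \<lfloor>2^n * x\<rfloor> / 2^n) \<longlonglongrightarrow> x"
  proof (rule tendsto_sandwich)
    show "eventually (\<lambda>n. x - (1/2)^n \<le> of_int \<lfloor>2^n * x\<rfloor> / 2^n) sequentially"
    proof (intro always_eventually allI)
      fix n have "2^n * x - 1 \<le> of_int \<lfloor>2^n * x\<rfloor>" by linarith
      then have "(2^n * x - 1) / 2^n \<le> of_int \<lfloor>2^n * x\<rfloor> / 2^n" by (intro divide_right_mono) auto
      then show "x - (1/2)^n \<le> of_int \<lfloor>2^n * x\<rfloor> / 2^n" by (simp add: diff_divide_distrib power_divide)
    qed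
    show "eventually (\<lambda>n. of_int \<lfloor>2^n * x\<rfloor> / 2^n \<le> x) sequentially"
    proof (intro always_eventually allI)
      fix n have "of_int \<lfloor>2^n * x\<rfloor> \<le> 2^n * x" by linarith
      then show "of_int \<lfloor>2^n * x\<rfloor> / 2^n \<le> x" by (simp add: field_simps)
    qed
    have "(\<lambda>n. x - (1/2)^n) \<longlonglongrightarrow> x - 0" by (intro tendsto_intros LIMSEQ_power_zero) auto
    then show "(\<lambda>n. x - (1/2)^n) \<longlonglongrightarrow> x" by simp
  qed simp
  then have "(\<lambda>i. c i / 2^Suc i) sums x" unfolding sums_def s .
  with c show ?thesis using that by blast
qed

text \<open>Schoenberg's curve: the even and the odd ternary digits of \<open>t\<close> supply the binary digits of
  the two coordinates. Through it, measures on a compact plane set can be lifted to an interval,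
  where Helly's selection theorem is available.\<close>

lemma square_filling_curve:
  obtains h :: "real \<Rightarrow> complex" where "continuous_on UNIV h" "\<And>t. norm (h t) \<le> 2"
    "\<And>x y. 0 \<le> x \<Longrightarrow> x < 1 \<Longrightarrow> 0 \<le> y \<Longrightarrow> y < 1 \<Longrightarrow> \<exists>t\<in>{0..1}. h t = Complex x y"
proof -
  define g where "g k t = Complex (schoenberg_step (3^(2*k) * t)) (schoenberg_step (3^(2*k+1) * t)) / 2^Suc k" for k t
  define h where "h t = (\<Sum>k. g k t)" for t
  have gn: "norm (g k t) \<le> 2 / 2^Suc k" for k t
  proof -
    have "norm (Complex (schoenberg_step (3^(2*k) * t)) (schoenberg_step (3^(2*k+1) * t))) \<le> 1 + 1"
      using cmod_le[of "Complex (schoenberg_step (3^(2*k) * t)) (schoenberg_step (3^(2*k+1) * t))"]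
        schoenberg_step_range[of "3^(2*k) * t"] schoenberg_step_range[of "3^(2*k+1) * t"] by simp
    then have "norm (Complex (schoenberg_step (3^(2*k) * t)) (schoenberg_step (3^(2*k+1) * t))) / 2^Suc k \<le> 2 / 2^Suc k"
      by (intro divide_right_mono) auto
    then show ?thesis unfolding g_def by (simp only: norm_divide norm_power norm_numeral)
  qed
  have geo: "(\<lambda>k. 2 / 2^Suc k) sums (2::real)"
    using sums_mult[OF geometric_sums[of "1/2::real"], of 1] by (simp add: power_divide)
  have u: "uniform_limit UNIV (\<lambda>n t. \<Sum>k<n. g k t) h sequentially"
    unfolding h_def by (rule Weierstrass_m_test[OF gn sums_summable[OF geo]])
  have gc: "continuous_on UNIV (g k)" for k
    unfolding g_def Complex_eq
    by (intro continuous_intros continuous_on_compose2[OF schoenberg_step_cont[of UNIV]]) auto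
  have "continuous_on UNIV h"
    by (rule uniform_limit_theorem[OF _ u]) (auto intro!: always_eventually continuous_on_sum gc)
  moreover have "norm (h t) \<le> 2" for t
  proof -
    have ns: "summable (\<lambda>k. norm (g k t))"
      by (rule summable_comparison_test'[OF sums_summable[OF geo], of 0]) (use gn in auto)
    have "norm (h t) \<le> (\<Sum>k. norm (g k t))" unfolding h_def by (rule summable_norm[OF ns])
    also have "\<dots> \<le> (\<Sum>k. 2 / 2^Suc k)" by (rule suminf_le[OF gn ns sums_summable[OF geo]])
    finally show ?thesis using sums_unique[OF geo] by simp
  qed
  moreover have "\<exists>t\<in>{0..1}. h t = Complex x y" if xy: "0 \<le> x" "x < 1" "0 \<le> y" "y < 1" for x y
  proof -
    obtain a where a: "\<And>i. a i = 0 \<or> a i = (1::real)" "(\<lambda>i. a i / 2^Suc i) sums x"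
      using binary_expansion[OF xy(1,2)] by blast
    obtain b where b: "\<And>i. b i = 0 \<or> b i = (1::real)" "(\<lambda>i. b i / 2^Suc i) sums y"
      using binary_expansion[OF xy(3,4)] by blast
    define c where "c i = (if even i then a (i div 2) else b (i div 2))" for i
    have c: "c i = 0 \<or> c i = 1" for i using a(1) b(1) by (simp add: c_def)
    define t where "t = (\<Sum>i. 2 * c i / 3^Suc i)"
    have "g k t = Complex (a k) (b k) / 2^Suc k" for k
      unfolding g_def t_def schoenberg_step_ternary[OF c] by (simp add: c_def)
    then have g: "g k t = of_real (a k / 2^Suc k) + \<i> * of_real (b k / 2^Suc k)" for k
      by (simp add: Complex_eq add_divide_distrib)
    have "(\<lambda>k. of_real (a k / 2^Suc k) + \<i> * of_real (b k / 2^Suc k)) sums (of_real x + \<i> * of_real y)"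
      by (intro sums_add sums_mult sums_of_real a b)
    then have "h t = Complex x y" unfolding h_def g by (simp add: sums_unique[symmetric] Complex_eq)
    moreover have "t \<in> {0..1}"
    proof -
      have geo3: "(\<lambda>i. 2 / 3^Suc i) sums (1::real)"
        using sums_mult[OF geometric_sums[of "1/3::real"], of "2/3"] by (simp add: power_divide)
      have c01: "0 \<le> c i" "c i \<le> 1" for i using c[of i] by auto
      have sm: "summable (\<lambda>i. 2 * c i / 3^Suc i)"
        by (rule summable_comparison_test'[OF sums_summable[OF geo3], of 0]) (use c01 in \<open>auto simp: field_simps\<close>)
      have "t \<le> (\<Sum>i. 2 / 3^Suc i)" unfolding t_def
        by (rule suminf_le[OF _ sm sums_summable[OF geo3]]) (use c01 in \<open>auto simp: field_simps\<close>)
      moreover have "0 \<le> t" unfolding t_def using c01 by (intro suminf_nonneg sm) auto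
      ultimately show ?thesis using sums_unique[OF geo3] by simp
    qed
    ultimately show ?thesis by blast
  qed
  ultimately show ?thesis using that by blast
qed

lemma disc_filling_curve:
  fixes R :: real
  assumes R: "R > 0"
  obtains h :: "real \<Rightarrow> complex" and B where "continuous_on UNIV h" "\<And>t. norm (h t) \<le> B" "cball 0 R \<subseteq> h ` {0..1}"
proof -
  obtain h :: "real \<Rightarrow> complex" where h: "continuous_on UNIV h" "\<And>t. norm (h t) \<le> 2"
    "\<And>x y. 0 \<le> x \<Longrightarrow> x < 1 \<Longrightarrow> 0 \<le> y \<Longrightarrow> y < 1 \<Longrightarrow> \<exists>t\<in>{0..1}. h t = Complex x y"
    using square_filling_curve by blast
  define g where "g t = of_real (4*R) * (h t - Complex (1/2) (1/2))" for t
  have "continuous_on UNIV g" unfolding g_def by (intro continuous_intros h)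
  moreover have "norm (g t) \<le> 4 * R * (2 + norm (Complex (1/2) (1/2)))" for t
  proof -
    have "norm (h t - Complex (1/2) (1/2)) \<le> 2 + norm (Complex (1/2) (1/2))"
      using norm_triangle_ineq4[of "h t" "Complex (1/2) (1/2)"] h(2)[of t] by linarith
    then show ?thesis using R unfolding g_def by (simp add: norm_mult)
  qed
  moreover have "cball 0 R \<subseteq> g ` {0..1}"
  proof
    fix z :: complex assume "z \<in> cball 0 R"
    then have z: "\<bar>Re z\<bar> \<le> R" "\<bar>Im z\<bar> \<le> R" using abs_Re_le_cmod[of z] abs_Im_le_cmod[of z] by auto
    then have "\<bar>Re z / (4*R)\<bar> \<le> 1/4" "\<bar>Im z / (4*R)\<bar> \<le> 1/4" using R by (auto simp: abs_divide field_simps)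
    then have "0 \<le> Re z / (4*R) + 1/2" "Re z / (4*R) + 1/2 < 1" "0 \<le> Im z / (4*R) + 1/2" "Im z / (4*R) + 1/2 < 1"
      unfolding abs_le_iff by linarith+
    from h(3)[OF this] obtain t where t: "t \<in> {0..1}" "h t = Complex (Re z / (4*R) + 1/2) (Im z / (4*R) + 1/2)" by blast
    from t(2) have "g t = z" using R by (simp add: g_def complex_eq_iff)
    then show "z \<in> g ` {0..1}" using t by blast
  qed
  ultimately show ?thesis using that by blast
qed

section \<open>Potentials on compact sets of capacity zero\<close>

lemma e2ennreal_neg_log: "x \<ge> 0 \<Longrightarrow> e2ennreal (- log_ext x) = (if x = 0 then \<infinity> else ennreal (- ln x))"
proof (cases "x = 0")
  case False
  have "- ereal (ln x) = ereal (- ln x)" by simp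
  then show ?thesis using False unfolding log_ext_def by (simp only: if_False e2ennreal_ereal)
qed (simp add: log_ext_def)

lemma closed_measure_support: "closed (measure_support \<mu>)"
proof -
  have "- measure_support \<mu> = \<Union>{U. open U \<and> \<not> emeasure \<mu> U > 0}"
    by (auto simp: measure_support_def)
  then show ?thesis unfolding closed_def by (metis (mono_tags, lifting) mem_Collect_eq open_Union)
qed

lemma e2ennreal_minus_diff_le: "e2ennreal (- (enn2ereal P - enn2ereal N)) \<le> N"
proof -
  have "- (enn2ereal P - enn2ereal N) \<le> enn2ereal N"
  proof (cases P)
    case (real p)
    then show ?thesis
      by (cases N) (auto simp: enn2ereal_ennreal)
  qed (cases N; auto simp: enn2ereal_ennreal)
  then show ?thesis using e2ennreal_mono[of "- (enn2ereal P - enn2ereal N)" "enn2ereal N"] by simp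
qed

lemma exp_ext_pos: "x \<noteq> -\<infinity> \<Longrightarrow> exp_ext x > 0"
  unfolding exp_ext_def by (cases x) auto

lemma energy_finiteI:
  assumes fin: "(\<integral>\<^sup>+z. \<integral>\<^sup>+w. e2ennreal (- log_ext (norm (z - w))) \<partial>\<mu> \<partial>\<mu>) < \<infinity>"
  shows "energy \<mu> \<noteq> -\<infinity>"
proof -
  define f where "f z = integral_ext \<mu> (\<lambda>w. log_ext (norm (z - w)))" for z
  have "(\<integral>\<^sup>+z. e2ennreal (- f z) \<partial>\<mu>) \<le> (\<integral>\<^sup>+z. \<integral>\<^sup>+w. e2ennreal (- log_ext (norm (z - w))) \<partial>\<mu> \<partial>\<mu>)"
    unfolding f_def integral_ext_def by (intro nn_integral_mono e2ennreal_minus_diff_le)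
  then have "(\<integral>\<^sup>+z. e2ennreal (- f z) \<partial>\<mu>) < \<infinity>" using fin by (rule le_less_trans)
  then have "enn2ereal (\<integral>\<^sup>+z. e2ennreal (- f z) \<partial>\<mu>) \<noteq> \<infinity>"
    by (metis enn2ereal_eq_top_iff infinity_ennreal_def infinity_ereal_def less_irrefl top_ereal_def top_ennreal.rep_eq)
  moreover have "enn2ereal (\<integral>\<^sup>+z. e2ennreal (f z) \<partial>\<mu>) \<ge> 0" by simp
  ultimately show ?thesis
    unfolding energy_def f_def[symmetric] integral_ext_def[of \<mu> f]
    by (cases "enn2ereal (\<integral>\<^sup>+z. e2ennreal (f z) \<partial>\<mu>)"; cases "enn2ereal (\<integral>\<^sup>+z. e2ennreal (- f z) \<partial>\<mu>)") auto
qed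

text \<open>Empirical measures of the sequence have, for every truncation of the logarithmic kernel, energy
  at least \<open>- M\<close> up to a diagonal term of size \<open>T / N\<close>. A weak limit, obtained on an interval by
  Helly's theorem and realised by almost surely convergent variables by Skorohod's theorem, inherits
  the bound for each truncation, hence has finite energy.\<close>

lemma energy_limit_of_empirical_measures:
  fixes a :: "nat \<Rightarrow> complex"
  assumes K: "compact K" and a: "\<And>n. a n \<in> K" "\<And>j n. j < n \<Longrightarrow> a n \<noteq> a j"
    and ln: "\<And>n. (\<Sum>j<n. ln (norm (a n - a j))) \<ge> - M * real n"
  obtains \<nu> where "prob_space \<nu>" "sets \<nu> = sets borel" "measure_support \<nu> \<subseteq> K"
    "(\<integral>\<^sup>+z. \<integral>\<^sup>+w. e2ennreal (- log_ext (norm (z - w))) \<partial>\<nu> \<partial>\<nu>) < \<infinity>"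
proof -
  obtain R where R: "R > 0" "K \<subseteq> ball 0 R"
    using bounded_subset_ballD[OF compact_imp_bounded[OF K], of 0] by blast
  obtain h :: "real \<Rightarrow> complex" and B where h: "continuous_on UNIV h" "\<And>t. norm (h t) \<le> B" and hR: "cball 0 R \<subseteq> h ` {0..1}"
    using disc_filling_curve[OF R(1)] by blast
  have h3: "K \<subseteq> h ` {0..1}" using R(2) hR ball_subset_cball[of "0::complex" R] by blast
  define t where "t n = (SOME s. s \<in> {0..1} \<and> h s = a n)" for n
  have "t n \<in> {0..1} \<and> h (t n) = a n" for n
  proof -
    have "a n \<in> h ` {0..1}" using a(1)[of n] h3 by blast
    then have "\<exists>s. s \<in> {0..1} \<and> h s = a n" by force
    then show ?thesis unfolding t_def by (rule someI_ex)
  qed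
  then have t: "\<And>n. t n \<in> {0..1}" "\<And>n. h (t n) = a n" by auto
  define \<mu> where "\<mu> N = distr (measure_pmf (pmf_of_set {..N})) borel t" for N :: nat
  have \<mu>_int: "(LINT s|\<mu> N. \<phi> s) = (\<Sum>i\<le>N. \<phi> (t i)) / real (Suc N)" if [measurable]: "\<phi> \<in> borel_measurable borel" for \<phi> :: "real \<Rightarrow> real" and N
    unfolding \<mu>_def by (subst integral_distr) (auto simp: integral_pmf_of_set)
  have rd: "real_distribution (\<mu> N)" for N
    unfolding \<mu>_def real_distribution_def real_distribution_axioms_def
    by (auto intro!: prob_space.prob_space_distr measure_pmf.prob_space_axioms)
  have m1: "measure (\<mu> N) {-1<..1} = 1" for N
  proof -
    have "t -` {-1<..1} = UNIV" using t(1) by (force simp: less_le_trans[of "-1::real" 0])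
    then show ?thesis unfolding \<mu>_def by (subst measure_distr) auto
  qed
  have "tight \<mu>" unfolding tight_def using rd
  proof (intro conjI allI impI)
    fix \<epsilon> :: real assume "\<epsilon> > 0"
    then have "(-1::real) < 1 \<and> (\<forall>n. measure (\<mu> n) {-1<..1} > 1 - \<epsilon>)" using m1 by simp
    then show "\<exists>a b. a < b \<and> (\<forall>n. measure (\<mu> n) {a<..b} > 1 - \<epsilon>)" by blast
  qed auto
  from tight_imp_convergent_subsubsequence[OF this strict_mono_id]
  obtain r L where r: "strict_mono r" and L: "real_distribution L" "weak_conv_m (\<mu> \<circ> id \<circ> r) L" by blast
  have rd': "real_distribution ((\<mu> \<circ> id \<circ> r) n)" for n using rd by simp
  obtain \<Omega> :: "real measure" and Y Z where \<Omega>: "prob_space \<Omega>" and Y[measurable]: "\<And>n. Y n \<in> measurable \<Omega> borel"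
    and dY: "\<And>n. distr \<Omega> borel (Y n) = \<mu> (r n)" and Z': "Z \<in> measurable \<Omega> lborel"
    and YZ: "\<And>x. x \<in> space \<Omega> \<Longrightarrow> (\<lambda>n. Y n x) \<longlonglongrightarrow> Z x"
    using Skorohod[OF rd' L] by (simp only: o_apply id_apply) blast
  have Z[measurable]: "Z \<in> borel_measurable \<Omega>" using Z' by simp
  interpret \<Omega>: prob_space \<Omega> by fact
  have hb[measurable]: "h \<in> borel_measurable borel" using h(1) by (rule borel_measurable_continuous_onI)
  define \<nu> where "\<nu> = distr \<Omega> borel (\<lambda>x. h (Z x))"
  have prob: "prob_space \<nu>" unfolding \<nu>_def by (rule \<Omega>.prob_space_distr) measurable
  interpret \<nu>: prob_space \<nu> by fact
  have sets: "sets \<nu> = sets borel" by (simp add: \<nu>_def)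
  have hlim: "(\<lambda>n. h (Y n x)) \<longlonglongrightarrow> h (Z x)" if "x \<in> space \<Omega>" for x
    using h(1) YZ[OF that] by (metis continuous_on_eq_continuous_at isCont_tendsto_compose open_UNIV UNIV_I)
  \<comment> \<open>the approximating variables take their values in the closed set \<open>K\<close>, hence so does the limit\<close>
  have Kb: "{s. h s \<in> K} \<in> sets borel"
    using borel_closed[OF closed_vimage[OF compact_imp_closed[OF K] h(1)]] by (simp add: vimage_def)
  have "AE x in \<Omega>. \<forall>n. h (Y n x) \<in> K"
    unfolding AE_all_countable
  proof
    fix n
    have "AE s in \<mu> (r n). h s \<in> K"
      unfolding \<mu>_def using t(2) a(1) Kb by (subst AE_distr_iff) (auto intro!: AE_pmfI)
    then show "AE x in \<Omega>. h (Y n x) \<in> K"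
      unfolding dY[symmetric] using Kb by (subst (asm) AE_distr_iff) auto
  qed
  then have "AE x in \<Omega>. h (Z x) \<in> K"
    using AE_space by eventually_elim (metis closed_sequentially compact_imp_closed[OF K] hlim)
  then have "AE z in \<nu>. z \<in> K"
    unfolding \<nu>_def using compact_imp_closed[OF K] by (subst AE_distr_iff) auto
  then have null: "emeasure \<nu> (- K) = 0"
    using compact_imp_closed[OF K] sets by (subst (asm) AE_iff_measurable[of "- K"]) (auto simp: sets_eq_imp_space_eq[OF sets])
  have supp: "measure_support \<nu> \<subseteq> K"
  proof
    fix z assume z: "z \<in> measure_support \<nu>"
    show "z \<in> K"
    proof (rule ccontr)
      assume "z \<notin> K"
      then have "emeasure \<nu> (- K) > 0" using z compact_imp_closed[OF K] unfolding measure_support_def by blast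
      then show False using null by simp
    qed
  qed
  \<comment> \<open>cutting the kernel \<open>- ln (norm (z - w))\<close> off at height \<open>T\<close> makes it continuous\<close>
  define k where "k T z w = - ln (max (norm (z - w)) (exp (- T)))" for T :: real and z w :: complex
  define C where "C = ln (2 * \<bar>B\<bar> + 1)"
  have km [measurable]: "(\<lambda>x. k T (f x) (g x)) \<in> borel_measurable N" if [measurable]: "f \<in> borel_measurable N" "g \<in> borel_measurable N" for T N and f g :: "'x \<Rightarrow> complex"
    unfolding k_def by measurable
  have kT: "k T z w \<le> T" for T z w
  proof -
    have "ln (exp (-T)) \<le> ln (max (norm (z - w)) (exp (- T)))" by (subst ln_le_cancel_iff) (auto simp: less_max_iff_disj)
    then show ?thesis unfolding k_def by simp
  qed
  have kC: "- C \<le> k T (h x) (h y)" if "T \<ge> 0" for T x y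
  proof -
    have "norm (h x - h y) \<le> 2 * \<bar>B\<bar> + 1"
      using norm_triangle_ineq4[of "h x" "h y"] h(2)[of x] h(2)[of y] by linarith
    moreover have "exp (-T) \<le> 1" using that by simp
    then have "exp (-T) \<le> 2 * \<bar>B\<bar> + 1" by linarith
    ultimately have "ln (max (norm (h x - h y)) (exp (- T))) \<le> C"
      unfolding C_def by (subst ln_le_cancel_iff) (auto simp: less_max_iff_disj)
    then show ?thesis unfolding k_def by simp
  qed
  have kb: "norm (k T (h x) (h y)) \<le> T + \<bar>C\<bar>" if "T \<ge> 0" for T x y
    using kT[of T "h x" "h y"] kC[OF that, of x y] that by (simp add: abs_le_iff) linarith
  have double: "(\<Sum>i\<le>N. \<Sum>j\<le>N. k T (a i) (a j)) \<le> real (Suc N) * T + M * real N * real (Suc N)" for T N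
  proof (induction N)
    case 0
    show ?case using kT[of T "a 0" "a 0"] by simp
  next
    case (Suc N)
    have sym: "k T z w = k T w z" for z w by (simp add: k_def norm_minus_commute)
    have "k T (a (Suc N)) (a j) \<le> - ln (norm (a (Suc N) - a j))" if "j \<le> N" for j
    proof -
      have "0 < norm (a (Suc N) - a j)" using a(2)[of j "Suc N"] that by simp
      then show ?thesis unfolding k_def by (simp add: less_max_iff_disj)
    qed
    then have "(\<Sum>j\<le>N. k T (a (Suc N)) (a j)) \<le> (\<Sum>j\<le>N. - ln (norm (a (Suc N) - a j)))"
      by (intro sum_mono) auto
    also have "\<dots> \<le> M * real (Suc N)" using ln[of "Suc N"] by (simp add: sum_negf lessThan_Suc_atMost)
    finally have 1: "(\<Sum>j\<le>N. k T (a (Suc N)) (a j)) \<le> M * real (Suc N)" .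
    have "(\<Sum>i\<le>Suc N. \<Sum>j\<le>Suc N. k T (a i) (a j))
       = (\<Sum>i\<le>N. \<Sum>j\<le>N. k T (a i) (a j)) + (\<Sum>i\<le>N. k T (a i) (a (Suc N))) + (\<Sum>j\<le>N. k T (a (Suc N)) (a j)) + k T (a (Suc N)) (a (Suc N))"
      by (simp add: sum.distrib)
    also have "(\<Sum>i\<le>N. k T (a i) (a (Suc N))) = (\<Sum>j\<le>N. k T (a (Suc N)) (a j))" by (simp add: sym)
    finally show ?case using Suc.IH 1 kT[of T "a (Suc N)" "a (Suc N)"] by (simp add: algebra_simps)
  qed
  define J where "J n T = (LINT x|\<Omega>. LINT y|\<Omega>. k T (h (Y n x)) (h (Y n y)))" for n T
  have J: "J n T \<le> T / real (Suc (r n)) + \<bar>M\<bar>" for n T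
  proof -
    let ?N = "r n"
    have av: "(LINT x|\<Omega>. \<phi> (Y n x)) = (\<Sum>i\<le>?N. \<phi> (t i)) / real (Suc ?N)" if [measurable]: "\<phi> \<in> borel_measurable borel" for \<phi> :: "real \<Rightarrow> real"
      using \<mu>_int[OF that, of ?N] unfolding dY[symmetric] by (subst (asm) integral_distr) auto
    have "J n T = (LINT x|\<Omega>. (\<Sum>j\<le>?N. k T (h (Y n x)) (h (t j))) / real (Suc ?N))"
      unfolding J_def by (subst av) auto
    also have "\<dots> = (\<Sum>i\<le>?N. (\<Sum>j\<le>?N. k T (h (t i)) (h (t j))) / real (Suc ?N)) / real (Suc ?N)"
      by (rule av[of "\<lambda>s. (\<Sum>j\<le>?N. k T (h s) (h (t j))) / real (Suc ?N)"]) measurable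
    also have "\<dots> = (\<Sum>i\<le>?N. \<Sum>j\<le>?N. k T (a i) (a j)) / (real (Suc ?N))^2"
      by (simp add: t(2) sum_divide_distrib[symmetric] power2_eq_square)
    also have "\<dots> \<le> (real (Suc ?N) * T + M * real ?N * real (Suc ?N)) / (real (Suc ?N))^2"
      by (intro divide_right_mono double) auto
    also have "\<dots> = T / real (Suc ?N) + M * (real ?N / real (Suc ?N))"
      by (simp add: power2_eq_square add_divide_distrib del: of_nat_Suc)
    also have "M * (real ?N / real (Suc ?N)) \<le> \<bar>M\<bar> * 1"
      by (rule order.trans[OF mult_right_mono[OF abs_ge_self]], simp, rule mult_left_mono) auto
    finally show ?thesis by simp
  qed
  define I where "I T = (LINT x|\<Omega>. LINT y|\<Omega>. k T (h (Z x)) (h (Z y)))" for T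
  have klim: "(\<lambda>n. k T (h (Y n x)) (h (Y n y))) \<longlonglongrightarrow> k T (h (Z x)) (h (Z y))" if "x \<in> space \<Omega>" "y \<in> space \<Omega>" for T x y
    unfolding k_def by (intro tendsto_intros hlim that) (auto simp: max_def)
  have Jlim: "(\<lambda>n. J n T) \<longlonglongrightarrow> I T" if T: "T \<ge> 0" for T
    unfolding J_def I_def
  proof (rule integral_dominated_convergence[where w="\<lambda>_. T + \<bar>C\<bar>"])
    show "AE x in \<Omega>. (\<lambda>n. LINT y|\<Omega>. k T (h (Y n x)) (h (Y n y))) \<longlonglongrightarrow> (LINT y|\<Omega>. k T (h (Z x)) (h (Z y)))"
    proof (rule AE_I2)
      fix x assume x: "x \<in> space \<Omega>"
      show "(\<lambda>n. LINT y|\<Omega>. k T (h (Y n x)) (h (Y n y))) \<longlonglongrightarrow> (LINT y|\<Omega>. k T (h (Z x)) (h (Z y)))"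
      proof (rule integral_dominated_convergence[where w="\<lambda>_. T + \<bar>C\<bar>"])
        show "AE y in \<Omega>. (\<lambda>n. k T (h (Y n x)) (h (Y n y))) \<longlonglongrightarrow> k T (h (Z x)) (h (Z y))"
          by (rule AE_I2, rule klim[OF x])
        show "AE y in \<Omega>. norm (k T (h (Y n x)) (h (Y n y))) \<le> T + \<bar>C\<bar>" for n
          by (rule AE_I2, rule kb[OF T])
      qed auto
    qed
    show "AE x in \<Omega>. norm (LINT y|\<Omega>. k T (h (Y n x)) (h (Y n y))) \<le> T + \<bar>C\<bar>" for n
    proof (rule AE_I2)
      fix x
      have "integrable \<Omega> (\<lambda>y. k T (h (Y n x)) (h (Y n y)))"
        by (rule \<Omega>.integrable_const_bound[of _ "T + \<bar>C\<bar>"]) (use kb[OF T] in auto)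
      then have "norm (LINT y|\<Omega>. k T (h (Y n x)) (h (Y n y))) \<le> (LINT y|\<Omega>. T + \<bar>C\<bar>)"
        by (intro order.trans[OF integral_norm_bound] integral_mono integrable_norm) (use kb[OF T] in auto)
      then show "norm (LINT y|\<Omega>. k T (h (Y n x)) (h (Y n y))) \<le> T + \<bar>C\<bar>" by (simp add: \<Omega>.prob_space)
    qed
  qed auto
  have I: "I T \<le> \<bar>M\<bar>" if T: "T \<ge> 0" for T
  proof (rule LIMSEQ_le[OF Jlim[OF T]])
    have "(\<lambda>n. 1 / real (Suc n)) \<longlonglongrightarrow> 0" by (rule LIMSEQ_Suc) (rule lim_1_over_n)
    then have "(\<lambda>n. 1 / real (Suc (r n))) \<longlonglongrightarrow> 0" using LIMSEQ_subseq_LIMSEQ[OF _ r] by (simp add: o_def)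
    then have "(\<lambda>n. T * (1 / real (Suc (r n))) + \<bar>M\<bar>) \<longlonglongrightarrow> T * 0 + \<bar>M\<bar>" by (intro tendsto_intros)
    then show "(\<lambda>n. T / real (Suc (r n)) + \<bar>M\<bar>) \<longlonglongrightarrow> \<bar>M\<bar>" by simp
    show "\<exists>N. \<forall>n\<ge>N. J n T \<le> T / real (Suc (r n)) + \<bar>M\<bar>" using J by blast
  qed
  have bound: "(\<integral>\<^sup>+x. \<integral>\<^sup>+y. ennreal (k T (h (Z x)) (h (Z y))) \<partial>\<Omega> \<partial>\<Omega>) \<le> ennreal (\<bar>M\<bar> + C)" if T: "T \<ge> 0" for T
  proof -
    have i1: "integrable \<Omega> (\<lambda>y. k T (h (Z x)) (h (Z y)))" for x
      by (rule \<Omega>.integrable_const_bound[of _ "T + \<bar>C\<bar>"]) (use kb[OF T] in auto)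
    have int: "integrable \<Omega> (\<lambda>y. k T (h (Z x)) (h (Z y)) + C)" for x
      using i1[of x] by simp
    have nn: "0 \<le> k T (h (Z x)) (h (Z y)) + C" for x y using kC[OF T, of "Z x" "Z y"] by simp
    have le: "(LINT y|\<Omega>. k T (h (Z x)) (h (Z y)) + C) \<le> T + C" for x
    proof -
      have "(LINT y|\<Omega>. k T (h (Z x)) (h (Z y)) + C) \<le> (LINT y|\<Omega>. T + C)"
        by (intro integral_mono int) (use kT in auto)
      then show ?thesis by (simp add: \<Omega>.prob_space)
    qed
    have nn2: "0 \<le> (LINT y|\<Omega>. k T (h (Z x)) (h (Z y)) + C)" for x
      by (intro Bochner_Integration.integral_nonneg nn)
    have int2: "integrable \<Omega> (\<lambda>x. LINT y|\<Omega>. k T (h (Z x)) (h (Z y)) + C)"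
      by (rule \<Omega>.integrable_const_bound[of _ "T + C"]) (use le nn2 in auto)
    have "(\<integral>\<^sup>+x. \<integral>\<^sup>+y. ennreal (k T (h (Z x)) (h (Z y))) \<partial>\<Omega> \<partial>\<Omega>) \<le> (\<integral>\<^sup>+x. \<integral>\<^sup>+y. ennreal (k T (h (Z x)) (h (Z y)) + C) \<partial>\<Omega> \<partial>\<Omega>)"
      by (intro nn_integral_mono ennreal_leI) (simp add: C_def)
    also have "\<dots> = (\<integral>\<^sup>+x. ennreal (LINT y|\<Omega>. k T (h (Z x)) (h (Z y)) + C) \<partial>\<Omega>)"
      by (intro nn_integral_cong nn_integral_eq_integral int AE_I2 nn)
    also have "\<dots> = ennreal (LINT x|\<Omega>. LINT y|\<Omega>. k T (h (Z x)) (h (Z y)) + C)"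
      by (intro nn_integral_eq_integral int2 AE_I2 nn2)
    also have "(LINT x|\<Omega>. LINT y|\<Omega>. k T (h (Z x)) (h (Z y)) + C) = I T + C"
    proof -
      have e: "(LINT y|\<Omega>. k T (h (Z x)) (h (Z y)) + C) = (LINT y|\<Omega>. k T (h (Z x)) (h (Z y))) + C" for x
        using i1[of x] by (simp add: \<Omega>.prob_space)
      have "integrable \<Omega> (\<lambda>x. (LINT y|\<Omega>. k T (h (Z x)) (h (Z y))) + C)" using int2 unfolding e .
      then have "integrable \<Omega> (\<lambda>x. (LINT y|\<Omega>. k T (h (Z x)) (h (Z y))) + C - C)"
        by (intro Bochner_Integration.integrable_diff) auto
      then have "integrable \<Omega> (\<lambda>x. (LINT y|\<Omega>. k T (h (Z x)) (h (Z y))))" by simp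
      then show ?thesis unfolding e I_def by (simp add: \<Omega>.prob_space)
    qed
    finally show ?thesis using I[OF T] by (meson add_right_mono ennreal_leI order_trans)
  qed
  have sup: "e2ennreal (- log_ext (norm (z - w))) = (SUP T::nat. ennreal (k (real T) z w))" for z w
  proof (cases "z = w")
    case True
    then have "k T z w = T" for T by (simp add: k_def max_def)
    then have S: "(SUP T::nat. ennreal (k (real T) z w)) = \<infinity>"
      by (simp only: ennreal_of_nat_eq_real_of_nat[symmetric] ennreal_SUP_of_nat_eq_top infinity_ennreal_def)
    have "e2ennreal (- log_ext (norm (z - w))) = \<infinity>" using True e2ennreal_neg_log[of "norm (z - w)"] by simp
    then show ?thesis by (simp only: S)
  next
    case False
    then have p: "norm (z - w) > 0" by simp
    obtain T0 :: nat where T0: "- ln (norm (z - w)) \<le> real T0" using real_arch_simple by blast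
    have le: "k T z w \<le> - ln (norm (z - w))" for T
      unfolding k_def using p by (simp add: less_max_iff_disj)
    have "exp (- real T0) \<le> norm (z - w)"
    proof -
      have "- real T0 \<le> ln (norm (z - w))" using T0 by linarith
      then have "exp (- real T0) \<le> exp (ln (norm (z - w)))" by (simp only: exp_le_cancel_iff)
      then show ?thesis by (simp only: exp_ln[OF p])
    qed
    then have "k (real T0) z w = - ln (norm (z - w))" unfolding k_def by (simp add: max_absorb1)
    then have "(SUP T::nat. ennreal (k (real T) z w)) = ennreal (- ln (norm (z - w)))"
      by (intro antisym SUP_least ennreal_leI le) (metis SUP_upper UNIV_I)
    then show ?thesis using False by (simp add: e2ennreal_neg_log)
  qed
  have inc: "incseq (\<lambda>T::nat. ennreal (k (real T) z w))" for z w
  proof (intro incseq_SucI ennreal_leI)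
    fix T
    have "max (norm (z - w)) (exp (- real (Suc T))) \<le> max (norm (z - w)) (exp (- real T))" by (intro max.mono) auto
    moreover have "0 < max (norm (z - w)) (exp (- real (Suc T)))" "0 < max (norm (z - w)) (exp (- real T))"
      by (auto simp only: less_max_iff_disj exp_gt_zero)
    ultimately have "ln (max (norm (z - w)) (exp (- real (Suc T)))) \<le> ln (max (norm (z - w)) (exp (- real T)))"
      using ln_le_cancel_iff by blast
    then show "k (real T) z w \<le> k (real (Suc T)) z w" unfolding k_def by linarith
  qed
  have "(\<integral>\<^sup>+z. \<integral>\<^sup>+w. e2ennreal (- log_ext (norm (z - w))) \<partial>\<nu> \<partial>\<nu>)
      = (SUP T::nat. \<integral>\<^sup>+z. \<integral>\<^sup>+w. ennreal (k (real T) z w) \<partial>\<nu> \<partial>\<nu>)"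
  proof -
    have [measurable_cong]: "sets \<nu> = sets borel" by fact
    have "(\<integral>\<^sup>+w. e2ennreal (- log_ext (norm (z - w))) \<partial>\<nu>) = (SUP T::nat. \<integral>\<^sup>+w. ennreal (k (real T) z w) \<partial>\<nu>)" for z
      unfolding sup by (rule nn_integral_monotone_convergence_SUP) (use inc in \<open>auto simp: incseq_def le_fun_def\<close>)
    then show ?thesis
      by (simp only:, intro nn_integral_monotone_convergence_SUP)
        (use inc in \<open>auto simp: incseq_def le_fun_def intro!: nn_integral_mono\<close>)
  qed
  also have "\<dots> = (SUP T::nat. \<integral>\<^sup>+x. \<integral>\<^sup>+y. ennreal (k (real T) (h (Z x)) (h (Z y))) \<partial>\<Omega> \<partial>\<Omega>)"
  proof -
    have "(\<integral>\<^sup>+w. ennreal (k T z w) \<partial>\<nu>) = (\<integral>\<^sup>+y. ennreal (k T z (h (Z y))) \<partial>\<Omega>)" for T z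
      unfolding \<nu>_def by (subst nn_integral_distr) auto
    then show ?thesis unfolding \<nu>_def by (subst nn_integral_distr) auto
  qed
  also have "\<dots> \<le> ennreal (\<bar>M\<bar> + C)" by (intro SUP_least bound) simp
  also have "\<dots> < \<infinity>" by simp
  finally show ?thesis using that[OF prob sets supp] by blast
qed

text \<open>If no average of logarithms of distances to points of \<open>K\<close> were below \<open>- M\<close> on all of
  \<open>K\<close>, one could choose points of \<open>K\<close> one after the other, each with a large average of logarithms
  of distances to its predecessors. Their empirical measures would then produce a measure of
  finite energy on \<open>K\<close>.\<close>

lemma capacity_zero_small_potential:
  assumes cap: "log_capacity E = 0" and K: "compact K" "K \<subseteq> E" "K \<noteq> {}"
  obtains n and a :: "nat \<Rightarrow> complex" where "n > 0" "\<And>j. j < n \<Longrightarrow> a j \<in> K"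
    "\<And>z. z \<in> K \<Longrightarrow> (\<exists>j<n. z = a j) \<or> (\<Sum>j<n. ln (norm (z - a j))) \<le> - M * real n"
proof (rule ccontr)
  note witness = that
  assume "\<not> thesis"
  have ex: "\<exists>z\<in>K. (\<forall>j<n. z \<noteq> a j) \<and> (\<Sum>j<n. ln (norm (z - a j))) > - M * real n"
    if "n > 0" "\<And>j. j < n \<Longrightarrow> a j \<in> K" for n and a :: "nat \<Rightarrow> complex"
  proof (rule ccontr)
    assume "\<not> ?thesis"
    then have "(\<exists>j<n. z = a j) \<or> (\<Sum>j<n. ln (norm (z - a j))) \<le> - M * real n" if "z \<in> K" for z
      using that by (meson not_le)
    from witness[OF that this] show False using \<open>\<not> thesis\<close> by blast
  qed
  define P where "P f n z \<longleftrightarrow> z \<in> K \<and> (\<forall>j<n. z \<noteq> f j) \<and> (\<Sum>j<n. ln (norm (z - f j))) \<ge> - M * real n"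
    for f :: "nat \<Rightarrow> complex" and n z
  have "\<exists>f. \<forall>n. P f n (f n)"
  proof (rule dependent_wellorder_choice)
    fix r n and f g :: "nat \<Rightarrow> complex" assume "\<And>m. m < n \<Longrightarrow> f m = g m"
    then show "P f n r = P g n r" unfolding P_def by simp
  next
    fix n and f :: "nat \<Rightarrow> complex" assume prev: "\<And>m. m < n \<Longrightarrow> P f m (f m)"
    show "\<exists>r. P f n r"
    proof (cases "n = 0")
      case True
      then show ?thesis using K(3) by (auto simp: P_def)
    next
      case False
      then show ?thesis using ex[of n f] prev unfolding P_def by (meson less_imp_le bot_nat_0.not_eq_extremum)
    qed
  qed
  then obtain a where a: "\<And>n. P a n (a n)" by blast
  obtain \<nu> where \<nu>: "prob_space \<nu>" "sets \<nu> = sets borel" "measure_support \<nu> \<subseteq> K"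
    "(\<integral>\<^sup>+z. \<integral>\<^sup>+w. e2ennreal (- log_ext (norm (z - w))) \<partial>\<nu> \<partial>\<nu>) < \<infinity>"
    using energy_limit_of_empirical_measures[OF K(1), of a M] a unfolding P_def by blast
  have "compact (measure_support \<nu>)"
    using closed_measure_support \<nu>(3) K(1) by (metis compact_Int_closed inf.absorb_iff2)
  then have "exp_ext (energy \<nu>) \<le> log_capacity E"
    unfolding log_capacity_def using \<nu> K(2) by (intro SUP_upper) auto
  moreover have "exp_ext (energy \<nu>) > 0" using energy_finiteI[OF \<nu>(4)] exp_ext_pos by blast
  ultimately show False using cap by simp
qed

section \<open>Discs that reach far, for a complement of capacity zero\<close>

lemma disc_into_const: "z \<in> \<Omega> \<Longrightarrow> disc_into \<Omega> (\<lambda>_. z)"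
  by (auto simp: disc_into_def)

lemma circle_log_mean:
  assumes r: "0 \<le> r" "r < R" and a: "a \<notin> ball c R"
  shows "integrable circle_measure (\<lambda>\<xi>. ln (norm (c + of_real r * \<xi> - a)))"
    and "(LINT \<xi>|circle_measure. ln (norm (c + of_real r * \<xi> - a))) = ln (norm (c - a))"
proof -
  have ne: "c + of_real r * cis t \<noteq> a" for t
    using a r by (auto simp: dist_norm norm_mult)
  have m: "(\<lambda>\<xi>. ln (norm (c + of_real r * \<xi> - a))) \<in> borel_measurable borel" by measurable
  have cn: "continuous_on {0..2*pi} (\<lambda>t. ln (norm (c + of_real r * cis t - a)))"
    using ne by (intro continuous_intros) auto
  show "integrable circle_measure (\<lambda>\<xi>. ln (norm (c + of_real r * \<xi> - a)))"
    by (rule circle_integral(2)[OF m cn])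
  have "((\<lambda>t. ln (norm (c + of_real r * cis t - a))) has_integral (2 * pi * ln (norm (c - a)))) {0..2*pi}"
    by (rule circle_log_mean_value[of "\<lambda>z. z - a" c R, OF _ r]) (use a in \<open>auto intro!: holomorphic_intros\<close>)
  from integral_unique[OF this] show "(LINT \<xi>|circle_measure. ln (norm (c + of_real r * \<xi> - a))) = ln (norm (c - a))"
    by (subst circle_integral(1)[OF m cn]) simp
qed

lemma circle_norm_square_mean:
  "(LINT \<xi>|circle_measure. (norm (c + of_real r * \<xi>))^2) = (norm c)^2 + r^2" (is ?eq)
proof -
  have cn: "continuous_on UNIV (\<lambda>\<xi>. Re (cnj c * \<xi>))" by (intro continuous_intros)
  have z: "(LINT \<xi>|circle_measure. Re (cnj c * \<xi>)) = 0"
  proof -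
    have "((\<lambda>t. cnj c * (0 + of_real 1 * cis t)) has_integral 2 * pi * (cnj c * 0)) {0..2*pi}"
      by (rule circle_mean_value[where R=2]) (auto intro!: holomorphic_intros)
    from has_integral_linear[OF this bounded_linear_Re]
    have "((\<lambda>t. Re (cnj c * cis t)) has_integral 0) {0..2*pi}" by (simp add: o_def)
    then show ?thesis
      by (subst circle_integral(1)) (auto intro!: borel_measurable_contI cn continuous_intros simp: integral_unique)
  qed
  have "(LINT \<xi>|circle_measure. (norm (c + of_real r * \<xi>))^2) = (LINT \<xi>|circle_measure. ((norm c)^2 + r^2) + 2 * r * Re (cnj c * \<xi>))"
  proof (rule integral_cong_AE)
    show "AE \<xi> in circle_measure. (norm (c + of_real r * \<xi>))^2 = ((norm c)^2 + r^2) + 2 * r * Re (cnj c * \<xi>)"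
      using AE_circle
    proof eventually_elim
      case (elim \<xi>)
      then have "(Re \<xi>)^2 + (Im \<xi>)^2 = 1" using cmod_power2[of \<xi>] by simp
      then have "r^2 * ((Re \<xi>)^2 + (Im \<xi>)^2) = r^2" by simp
      then show ?case by (simp only: cmod_power2) (simp add: power2_eq_square algebra_simps)
    qed
  qed measurable
  also have "\<dots> = (norm c)^2 + r^2"
    by (subst Bochner_Integration.integral_add)
      (auto intro!: circle_integrable continuous_intros simp del: Re_complex_of_real times_complex.simps simp: z)
  finally show ?thesis .
qed

text \<open>Let \<open>u z\<close> be the supremum of the boundary means of \<open>\<Phi> z = min 1 (\<bar>z\<bar> / R)\<close> over all
  discs in \<open>\<Omega>\<close> centred at \<open>z\<close>. Gluing discs to a small round disc shows that \<open>u\<close> satisfies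
  the super-mean value inequality. Compare \<open>1 - u\<close> with \<open>H\<close>, a normalised sum of
  \<open>- ln \<bar>z - a j\<bar>\<close>: it is harmonic away from the points \<open>a j\<close>, the part \<open>A\<close> of the disc of
  radius \<open>R\<close> where it is below 1 lies in \<open>\<Omega>\<close>, and it is as small as desired at \<open>z0\<close> because the complement has capacity zero. The term with \<open>\<eta>\<close> makes
  the difference \<open>v\<close> strictly subharmonic, so that it cannot be almost maximal at the centre of
  a disc in \<open>A\<close> of fixed radius.\<close>

lemma disc_reaching_far_aux:
  fixes R :: real
  assumes \<Omega>: "open \<Omega>" and cap: "log_capacity (- \<Omega>) = 0" and z0: "z0 \<in> \<Omega>" "norm z0 \<le> R"
    and e0: "e0 \<notin> \<Omega>" "norm e0 \<le> R" and R: "R > 0"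
  shows "\<exists>f. disc_into \<Omega> f \<and> f 0 = z0 \<and> (LINT w|circle_measure. min 1 (norm (f w) / R)) > 1/2"
proof (rule ccontr)
  assume no: "\<not> ?thesis"
  define \<Phi> where "\<Phi> z = min 1 (norm z / R)" for z :: complex
  have \<Phi>c: "continuous_on UNIV \<Phi>" unfolding \<Phi>_def by (intro continuous_intros) (use R in auto)
  have \<Phi>01: "0 \<le> \<Phi> z" "\<Phi> z \<le> 1" for z using R by (auto simp: \<Phi>_def)
  define D where "D z = {LINT w|circle_measure. \<Phi> (f w) | f. disc_into \<Omega> f \<and> f 0 = z}" for z
  define u where "u z = Sup (D z)" for z
  have intf: "integrable circle_measure (\<lambda>w. \<Phi> (f w))" if "disc_into \<Omega> f" for f
    by (intro circle_integrable continuous_on_compose2[OF \<Phi>c disc_into_cont[OF that]]) auto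
  have D01: "0 \<le> x \<and> x \<le> 1" if "x \<in> D z" for x z
  proof -
    obtain f where f: "disc_into \<Omega> f" "x = (LINT w|circle_measure. \<Phi> (f w))" using \<open>x \<in> D z\<close> by (auto simp: D_def)
    have "x \<le> 1" unfolding f(2) by (rule circle_mean_bound[OF intf[OF f(1)] \<Phi>01(2)])
    moreover have "0 \<le> x" unfolding f(2) by (intro Bochner_Integration.integral_nonneg \<Phi>01)
    ultimately show ?thesis by simp
  qed
  have bdd: "bdd_above (D z)" for z using D01 by (auto simp: bdd_above_def)
  have \<Phi>D: "\<Phi> z \<in> D z" if "z \<in> \<Omega>" for z
    unfolding D_def using disc_into_const[OF that] by (intro CollectI exI[of _ "\<lambda>_. z"]) simp
  have u\<Phi>: "\<Phi> z \<le> u z" if "z \<in> \<Omega>" for z unfolding u_def by (rule cSup_upper[OF \<Phi>D[OF that] bdd])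
  have u0: "0 \<le> u z" if "z \<in> \<Omega>" for z using u\<Phi>[OF that] \<Phi>01(1)[of z] by linarith
  have uz0: "u z0 \<le> 1/2"
    unfolding u_def using no \<Phi>D[OF z0(1)] by (intro cSup_least) (auto simp: D_def \<Phi>_def not_less)
  \<comment> \<open>a potential that is very negative on the part of the complement in the disc of radius \<open>R\<close>\<close>
  define K where "K = - \<Omega> \<inter> cball 0 R"
  have K: "compact K" "K \<subseteq> - \<Omega>" "K \<noteq> {}"
    using \<Omega> e0 unfolding K_def by (auto intro!: closed_Int_compact)
  obtain d' where d': "d' > 0" "ball z0 d' \<subseteq> \<Omega>" using \<Omega> z0(1) open_contains_ball by metis
  define d where "d = min d' 1"
  have d: "d > 0" "d \<le> 1" "ball z0 d \<subseteq> \<Omega>" using d' by (auto simp: d_def)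
  define L where "L = ln (2 * R + 1)"
  have L: "L \<ge> 0" using R by (simp add: L_def)
  have lnd: "ln d \<le> 0" using d by simp
  \<comment> \<open>large enough for \<open>H z0 \<le> 1/8\<close>\<close>
  define M where "M = 8 * (L - ln d) + 1"
  have M: "M > - ln d" "M > 0" "8 * (L - ln d) \<le> L + M" "L + M > 0" using L lnd by (auto simp: M_def)
  obtain n and a :: "nat \<Rightarrow> complex" where n: "n > 0" and aK: "\<And>j. j < n \<Longrightarrow> a j \<in> K"
    and small: "\<And>z. z \<in> K \<Longrightarrow> (\<exists>j<n. z = a j) \<or> (\<Sum>j<n. ln (norm (z - a j))) \<le> - M * real n"
    using capacity_zero_small_potential[OF cap K] by metis
  define q where "q z = (\<Prod>j<n. norm (z - a j))" for z
  define H where "H z = (L - (\<Sum>j<n. ln (norm (z - a j))) / n) / (L + M)" for z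
  have lnq: "ln (q z) = (\<Sum>j<n. ln (norm (z - a j)))" if "q z > 0" for z
  proof -
    have "norm (z - a j) \<noteq> 0" if j: "j < n" for j
    proof
      assume "norm (z - a j) = 0"
      then have "q z = 0" unfolding q_def using j by (intro prod_zero) auto
      then show False using \<open>q z > 0\<close> by simp
    qed
    then show ?thesis unfolding q_def by (subst ln_prod) auto
  qed
  define A where "A = {z. norm z < R \<and> q z > exp (- M * n)}"
  have Ao: "open A" unfolding A_def q_def
    by (intro open_Collect_conj open_Collect_less continuous_intros)
  have qpos: "q z > 0" if "z \<in> A" for z using that by (auto simp: A_def intro: less_trans[OF exp_gt_zero])
  have Ane: "a j \<noteq> z" if "z \<in> A" "j < n" for z j
  proof
    assume "a j = z"
    then have "q z = 0" unfolding q_def using that(2) by (intro prod_zero) auto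
    then show False using qpos[OF that(1)] by simp
  qed
  have A\<Omega>: "A \<subseteq> \<Omega>"
  proof
    fix z assume z: "z \<in> A"
    show "z \<in> \<Omega>"
    proof (rule ccontr)
      assume "z \<notin> \<Omega>"
      then have "z \<in> K" using z by (simp add: K_def A_def)
      then have "ln (q z) \<le> - M * n" using small[of z] Ane[OF z] lnq[OF qpos[OF z]] by auto
      then have "q z \<le> exp (- M * n)" using qpos[OF z] by (metis exp_le_cancel_iff exp_ln)
      then show False using z by (simp add: A_def)
    qed
  qed
  have H0: "0 \<le> H z" if "z \<in> A" for z
  proof -
    have "(\<Sum>j<n. ln (norm (z - a j))) \<le> (\<Sum>j<n. L)"
    proof (rule sum_mono)
      fix j assume j: "j \<in> {..<n}"
      have "norm (a j) \<le> R" using aK[of j] j by (simp add: K_def)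
      then have "norm (z - a j) \<le> 2 * R + 1" using that norm_triangle_ineq4[of z "a j"] by (simp add: A_def)
      then show "ln (norm (z - a j)) \<le> L" unfolding L_def using Ane[OF that, of j] j R
        by (subst ln_le_cancel_iff) auto
    qed
    then have "(\<Sum>j<n. ln (norm (z - a j))) / n \<le> L" using n by (simp add: field_simps)
    then show ?thesis unfolding H_def using M by simp
  qed
  \<comment> \<open>the perturbation changes \<open>v\<close> by at most 1/8 on the disc of radius \<open>R\<close>\<close>
  define \<eta> where "\<eta> = 1 / (8 * R^2)"
  have eta: "\<eta> > 0" "\<eta> * R^2 = 1/8" using R by (auto simp: \<eta>_def)
  define v where "v z = 1 - u z - H z + \<eta> * ((norm z)^2 - R^2)" for z
  have etale: "\<eta> * ((norm z)^2 - R^2) \<le> 0" if "z \<in> A" for z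
  proof -
    have "(norm z)^2 \<le> R^2" using that by (intro power_mono) (auto simp: A_def)
    then show ?thesis using eta by (simp add: mult_nonneg_nonpos)
  qed
  have v1: "v z \<le> 1" if "z \<in> A" for z
  proof -
    have "0 \<le> u z" using u0[of z] that A\<Omega> by blast
    then show ?thesis using etale[OF that] H0[OF that] unfolding v_def by linarith
  qed
  have z0R: "norm z0 < R"
  proof (rule ccontr)
    assume "\<not> ?thesis"
    then have "\<Phi> z0 = 1" using R by (simp add: \<Phi>_def)
    then show False using u\<Phi>[OF z0(1)] uz0 by simp
  qed
  have lnd_le: "ln d \<le> ln (norm (z0 - a j))" if "j < n" for j
  proof -
    have "a j \<notin> ball z0 d" using d(3) aK[OF that] K(2) by blast
    then have "d \<le> norm (z0 - a j)" by (simp add: dist_norm)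
    then show ?thesis using d by (subst ln_le_cancel_iff) auto
  qed
  have sum0: "real n * ln d \<le> (\<Sum>j<n. ln (norm (z0 - a j)))"
    using sum_mono[of "{..<n}" "\<lambda>_. ln d" "\<lambda>j. ln (norm (z0 - a j))"] lnd_le by simp
  have z0A: "z0 \<in> A"
  proof -
    have "a j \<noteq> z0" if "j < n" for j using aK[OF that] K(2) z0(1) by auto
    then have q0: "q z0 > 0" unfolding q_def by (intro prod_pos) auto
    have "real n * (- M) < real n * ln d" using M(1) n by (intro mult_strict_left_mono) auto
    then have "- M * n < real n * ln d" by (simp add: mult.commute)
    then have "- M * n < ln (q z0)" using sum0 lnq[OF q0] by linarith
    then have "exp (- M * n) < q z0" using q0 by (metis exp_less_cancel_iff exp_ln)
    then show ?thesis using z0R by (simp add: A_def)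
  qed
  have vz0: "v z0 \<ge> 1/4"
  proof -
    have "ln d \<le> (\<Sum>j<n. ln (norm (z0 - a j))) / n" using sum0 n by (simp add: field_simps)
    then have "H z0 \<le> (L - ln d) / (L + M)" unfolding H_def using M by (intro divide_right_mono) auto
    also have "\<dots> \<le> 1/8" using M by (simp add: field_simps)
    finally have "H z0 \<le> 1/8" .
    moreover have "\<eta> * (norm z0)^2 \<ge> 0" using eta by simp
    ultimately show ?thesis using uz0 eta(2) unfolding v_def by (simp add: right_diff_distrib)
  qed
  define S where "S = Sup (v ` A)"
  have Sbdd: "bdd_above (v ` A)" using v1 by (auto simp: bdd_above_def)
  have vS: "v z \<le> S" if "z \<in> A" for z unfolding S_def using that by (intro cSup_upper Sbdd) auto
  have S: "S \<ge> 1/4" using vS[OF z0A] vz0 by simp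
  \<comment> \<open>the points with \<open>v > 1/8\<close> lie in the compact subset \<open>A'\<close> of \<open>A\<close>, so one radius serves them all\<close>
  define A' where "A' = {z. norm z \<le> 7/8 * R \<and> exp (n * (L - 7/8 * (L + M))) \<le> q z}"
  have "closed A'" unfolding A'_def q_def
    by (intro closed_Collect_conj closed_Collect_le continuous_intros)
  moreover have "A' \<subseteq> cball 0 (7/8 * R)" by (auto simp: A'_def)
  ultimately have A'c: "compact A'" by (meson bounded_cball bounded_subset compact_eq_bounded_closed)
  have "A' \<subseteq> A"
  proof
    fix z assume z: "z \<in> A'"
    have "- M < L - 7/8 * (L + M)" using M(4) distrib_left[of "7/8" L M] by linarith
    then have "n * - M < n * (L - 7/8 * (L + M))" using n by (intro mult_strict_left_mono) auto
    then have "exp (- M * n) < exp (n * (L - 7/8 * (L + M)))" by (simp add: mult.commute)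
    moreover have zz: "exp (n * (L - 7/8 * (L + M))) \<le> q z" "norm z \<le> 7/8 * R" using z by (simp_all only: A'_def mem_Collect_eq)
    ultimately have "exp (- M * n) < q z" using order.strict_trans2 by blast
    moreover have "norm z < R" using zz(2) R by linarith
    ultimately show "z \<in> A" by (simp add: A_def)
  qed
  then obtain \<rho>0 where rho0: "\<rho>0 > 0" "\<And>x y. x \<in> A' \<Longrightarrow> norm (y - x) < \<rho>0 \<Longrightarrow> y \<in> A"
    using compact_open_margin[OF A'c Ao] by metis
  define \<rho> where "\<rho> = \<rho>0 / 2"
  have rho: "0 < \<rho>" "\<rho> < \<rho>0" using rho0 by (auto simp: \<rho>_def)
  have er: "\<eta> * \<rho>^2 > 0" using eta rho by simp
  have "S - min (1/8) (\<eta> * \<rho>^2 / 2) < S" using er by simp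
  moreover have ne: "v ` A \<noteq> {}" using z0A by blast
  ultimately obtain zs where zs: "zs \<in> A" "S - min (1/8) (\<eta> * \<rho>^2 / 2) < v zs"
    using less_cSup_iff[OF ne Sbdd, folded S_def] by blast
  have v8: "v zs > 1/8" using zs(2) S by linarith
  have zsA': "zs \<in> A'"
  proof -
    have uz: "u zs < 7/8" using v8 H0[OF zs(1)] etale[OF zs(1)] unfolding v_def by linarith
    then have "\<Phi> zs < 7/8" using u\<Phi>[of zs] zs(1) A\<Omega> by force
    then have "norm zs < 7/8 * R" using R by (simp add: \<Phi>_def min_def field_simps split: if_splits)
    moreover have u0zs: "0 \<le> u zs" using u0[of zs] zs(1) A\<Omega> by blast
    have "H zs < 7/8" using v8 u0zs etale[OF zs(1)] unfolding v_def by linarith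
    then have "L - ln (q zs) / n < 7/8 * (L + M)" unfolding H_def lnq[OF qpos[OF zs(1)]] using M by (simp add: field_simps)
    then have "n * (L - 7/8 * (L + M)) < ln (q zs)" using n by (simp add: field_simps)
    then have "exp (n * (L - 7/8 * (L + M))) < q zs" using qpos[OF zs(1)] by (metis exp_less_cancel_iff exp_ln)
    ultimately show ?thesis by (simp add: A'_def)
  qed
  have ballA: "ball zs \<rho>0 \<subseteq> A" using rho0(2)[OF zsA'] by (auto simp: dist_norm norm_minus_commute)
  define b where "b z = zs + of_real \<rho> * z" for z
  have bA: "b z \<in> A" if "norm z \<le> 1" for z
  proof -
    have "\<rho> * norm z \<le> \<rho>" using that rho by simp
    then have "\<rho> * norm z < \<rho>0" using rho by linarith
    then show ?thesis using rho(1) rho0(2)[OF zsA', of "b z"] by (simp add: b_def norm_mult)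
  qed
  have bd: "disc_into \<Omega> b" unfolding disc_into_def using bA A\<Omega>
    by (auto simp: b_def[abs_def] intro!: holomorphic_intros)
  define g where "g z = 1 - S - H z + \<eta> * ((norm z)^2 - R^2)" for z
  define \<gamma> where "\<gamma> \<xi> = g (b \<xi>) - \<eta> * \<rho>^2 / 4" for \<xi>
  have gm: "\<gamma> \<in> borel_measurable borel" unfolding \<gamma>_def g_def H_def b_def by measurable
  have gc: "continuous_on (sphere 0 1) \<gamma>"
  proof -
    have "b \<xi> \<noteq> a j" if "\<xi> \<in> sphere 0 1" "j < n" for \<xi> j using Ane[OF bA, of \<xi> j] that by auto
    then show ?thesis unfolding \<gamma>_def g_def H_def b_def using M n by (intro continuous_intros) auto
  qed
  have ex: "\<exists>f. disc_into \<Omega> f \<and> f 0 = b \<xi> \<and> \<gamma> \<xi> < (LINT w|circle_measure. \<Phi> (f w))" if "norm \<xi> = 1" for \<xi>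
  proof -
    have bx: "b \<xi> \<in> A" using bA that by simp
    have "\<gamma> \<xi> < u (b \<xi>)" using vS[OF bx] er unfolding \<gamma>_def g_def v_def by linarith
    moreover have "D (b \<xi>) \<noteq> {}" using \<Phi>D[of "b \<xi>"] bx A\<Omega> by blast
    ultimately obtain x where "x \<in> D (b \<xi>)" "\<gamma> \<xi> < x"
      unfolding u_def using less_cSup_iff[OF _ bdd] by blast
    then show ?thesis by (auto simp: D_def)
  qed
  have e4: "\<eta> * \<rho>^2 / 4 > 0" using er by simp
  obtain F where F: "disc_into \<Omega> F" "F 0 = b 0"
    "(LINT \<xi>|circle_measure. \<Phi> (F \<xi>)) > (LINT \<xi>|circle_measure. \<gamma> \<xi>) - \<eta> * \<rho>^2 / 4"
    using glue_discs[OF \<Omega> bd \<Phi>c \<Phi>01(1) gm gc ex e4 zero_less_one] by blast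
  have "(LINT \<xi>|circle_measure. \<Phi> (F \<xi>)) \<le> u zs"
    unfolding u_def using F by (intro cSup_upper bdd) (auto simp: D_def b_def)
  moreover have "(LINT \<xi>|circle_measure. \<gamma> \<xi>) = g zs + \<eta> * \<rho>^2 - \<eta> * \<rho>^2 / 4"
  proof -
    have aj: "a j \<notin> ball zs \<rho>0" if "j < n" for j using ballA Ane that by blast
    have li: "integrable circle_measure (\<lambda>\<xi>. ln (norm (b \<xi> - a j)))"
      "(LINT \<xi>|circle_measure. ln (norm (b \<xi> - a j))) = ln (norm (zs - a j))" if "j < n" for j
      unfolding b_def using circle_log_mean[OF _ rho(2) aj[OF that]] rho by auto
    have ni: "integrable circle_measure (\<lambda>\<xi>. (norm (b \<xi>))^2)"
      unfolding b_def by (intro circle_integrable continuous_intros)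
    have s: "(LINT \<xi>|circle_measure. (\<Sum>j<n. ln (norm (b \<xi> - a j)))) = (\<Sum>j<n. ln (norm (zs - a j)))"
      by (subst Bochner_Integration.integral_sum) (auto simp: li)
    have si: "integrable circle_measure (\<lambda>\<xi>. (\<Sum>j<n. ln (norm (b \<xi> - a j))))"
      by (intro Bochner_Integration.integrable_sum li) auto
    have nm: "(LINT \<xi>|circle_measure. (norm (b \<xi>))^2) = (norm zs)^2 + \<rho>^2"
      unfolding b_def by (rule circle_norm_square_mean)
    have Hs: "H z = L / (L + M) - (1 / (n * (L + M))) * (\<Sum>j<n. ln (norm (z - a j)))" for z
      unfolding H_def diff_divide_distrib by simp
    have "\<gamma> \<xi> = (1 - S - L / (L + M) - \<eta> * R^2 - \<eta> * \<rho>^2 / 4) + (1 / (n * (L + M))) * (\<Sum>j<n. ln (norm (b \<xi> - a j))) + \<eta> * (norm (b \<xi>))^2" for \<xi>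
      unfolding \<gamma>_def g_def Hs right_diff_distrib by simp
    then have "(LINT \<xi>|circle_measure. \<gamma> \<xi>) = (1 - S - L / (L + M) - \<eta> * R^2 - \<eta> * \<rho>^2 / 4) + (1 / (n * (L + M))) * (\<Sum>j<n. ln (norm (zs - a j))) + \<eta> * ((norm zs)^2 + \<rho>^2)"
      using si ni by (simp add: s nm)
    also have "\<dots> = g zs + \<eta> * \<rho>^2 - \<eta> * \<rho>^2 / 4"
      unfolding g_def Hs by (simp only: right_diff_distrib distrib_left)
    finally show ?thesis .
  qed
  moreover have "g zs = u zs + v zs - S" unfolding g_def v_def by simp
  ultimately show False using F(3) zs(2) by linarith
qed

lemma disc_reaching_far:
  fixes R :: real
  assumes \<Omega>: "open \<Omega>" "\<Omega> \<noteq> UNIV" and cap: "log_capacity (- \<Omega>) = 0" and z0: "z0 \<in> \<Omega>" and R: "R > 0"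
  shows "\<exists>f. disc_into \<Omega> f \<and> f 0 = z0 \<and> (LINT w|circle_measure. min 1 (norm (f w) / R)) > 1/2"
proof -
  obtain e0 where e0: "e0 \<notin> \<Omega>" using \<Omega>(2) by blast
  define R' where "R' = max R (max (norm z0) (norm e0))"
  have R': "R' > 0" "R' \<ge> R" "norm z0 \<le> R'" "norm e0 \<le> R'" using R by (auto simp: R'_def)
  obtain f where f: "disc_into \<Omega> f" "f 0 = z0" "(LINT w|circle_measure. min 1 (norm (f w) / R')) > 1/2"
    using disc_reaching_far_aux[OF \<Omega>(1) cap z0 R'(3) e0 R'(4) R'(1)] by blast
  have fc: "continuous_on UNIV f" using disc_into_cont[OF f(1)] .
  have "(LINT w|circle_measure. min 1 (norm (f w) / R')) \<le> (LINT w|circle_measure. min 1 (norm (f w) / R))"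
  proof (rule circle_mean_mono)
    fix w show "min 1 (norm (f w) / R') \<le> min 1 (norm (f w) / R)"
      using R R' by (intro min.mono divide_left_mono) auto
  qed (use R R' in \<open>auto intro!: circle_integrable continuous_intros fc\<close>)
  then show ?thesis using f by force
qed

section \<open>A map outside a given Hardy space\<close>

lemma powr_norm_cont: "p > 0 \<Longrightarrow> continuous_on A (\<lambda>z::complex. norm z powr p)"
  by (intro continuous_on_powr' continuous_intros) auto

text \<open>For \<open>p \<le> 1\<close> the power \<open>\<bar>z\<bar> powr p\<close> dominates \<open>R powr p * min 1 (\<bar>z\<bar> / R)\<close>, and
  \<open>R\<close> is at our disposal.\<close>

lemma disc_with_large_power_mean:
  fixes p C :: real
  assumes \<Omega>: "open \<Omega>" "\<Omega> \<noteq> UNIV" and cap: "log_capacity (- \<Omega>) = 0" and z0: "z0 \<in> \<Omega>" and p: "0 < p" "p \<le> 1"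
  shows "\<exists>f. disc_into \<Omega> f \<and> f 0 = z0 \<and> C < (LINT w|circle_measure. norm (f w) powr p)"
proof -
  define R where "R = (2 * (\<bar>C\<bar> + 1)) powr (1/p)"
  have R: "R > 0" "R powr p = 2 * (\<bar>C\<bar> + 1)" using p by (auto simp: R_def powr_powr)
  obtain f where f: "disc_into \<Omega> f" "f 0 = z0" "(LINT w|circle_measure. min 1 (norm (f w) / R)) > 1/2"
    using disc_reaching_far[OF \<Omega> cap z0 R(1)] by blast
  have fc: "continuous_on UNIV f" using disc_into_cont[OF f(1)] .
  have i: "integrable circle_measure (\<lambda>w. min 1 (norm (f w) / R))"
    using R by (intro circle_integrable continuous_intros fc) auto
  have ip: "integrable circle_measure (\<lambda>w. norm (f w) powr p)"
    by (intro circle_integrable continuous_on_compose2[OF powr_norm_cont[OF p(1)] fc]) auto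
  have le: "R powr p * min 1 (x / R) \<le> x powr p" if x: "x \<ge> 0" for x
  proof (cases "x \<ge> R")
    case True
    then have "R powr p \<le> x powr p" using R p by (intro powr_mono2) auto
    moreover have "min 1 (x / R) = 1" using True R by simp
    ultimately show ?thesis by simp
  next
    case False
    have "x / R \<le> (x / R) powr p"
    proof (cases "x = 0")
      case False
      have "(x / R) powr 1 \<le> (x / R) powr p" using \<open>\<not> x \<ge> R\<close> False x R p by (intro powr_mono') auto
      then show ?thesis using x R by simp
    qed simp
    then have "R powr p * (x / R) \<le> R powr p * (x / R) powr p" by (intro mult_left_mono) auto
    also have "\<dots> = x powr p" using x R by (simp add: powr_divide)
    finally show ?thesis using False R by (simp add: min_def)
  qed
  have "C < R powr p * (1/2)" unfolding R(2) by simp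
  also have "\<dots> \<le> R powr p * (LINT w|circle_measure. min 1 (norm (f w) / R))"
    using f(3) by (intro mult_left_mono) auto
  also have "\<dots> = (LINT w|circle_measure. R powr p * min 1 (norm (f w) / R))" by simp
  also have "\<dots> \<le> (LINT w|circle_measure. norm (f w) powr p)"
    by (intro circle_mean_mono ip le integrable_mult_right i) auto
  finally show ?thesis using f by blast
qed

text \<open>One step of the construction of a map outside the Hardy space. The radius \<open>s'\<close> and the
  tolerance \<open>e'\<close> record how much the new disc may still be perturbed without leaving \<open>\<Omega>\<close> or
  losing its large mean.\<close>

lemma enlarge_power_mean:
  fixes p e s :: real and k :: nat
  assumes \<Omega>: "open \<Omega>" "\<Omega> \<noteq> UNIV" and cap: "log_capacity (- \<Omega>) = 0" and p: "0 < p" "p \<le> 1"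
    and b: "disc_into \<Omega> b" and s: "s < 1" and e: "e > 0"
  shows "\<exists>F s' e'. disc_into \<Omega> F \<and> s \<le> s' \<and> s' < 1 \<and> 1 - 1 / (real k + 1) \<le> s' \<and> 0 < e' \<and> e' \<le> e / 2 \<and> e' \<le> 1
     \<and> (\<forall>z w. norm z \<le> 1 \<longrightarrow> norm (w - F z) \<le> 2 * e' \<longrightarrow> w \<in> \<Omega> \<and> \<bar>norm w powr p - norm (F z) powr p\<bar> < 1)
     \<and> real k < (LINT \<xi>|circle_measure. norm (F (of_real s' * \<xi>)) powr p)
     \<and> (\<forall>z. norm z \<le> s \<longrightarrow> norm (F z - b z) < e)"
proof -
  define \<psi> where "\<psi> z = norm z powr p" for z :: complex
  have \<psi>c: "continuous_on UNIV \<psi>" unfolding \<psi>_def using p by (intro powr_norm_cont)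
  have \<psi>0: "0 \<le> \<psi> z" for z by (simp add: \<psi>_def)
  have ex: "\<exists>f. disc_into \<Omega> f \<and> f 0 = b \<xi> \<and> real k + 1 < (LINT w|circle_measure. \<psi> (f w))" if "norm \<xi> = 1" for \<xi>
  proof -
    have "b \<xi> \<in> \<Omega>" using b that by (auto simp: disc_into_def)
    from disc_with_large_power_mean[OF \<Omega> cap this p] show ?thesis unfolding \<psi>_def by blast
  qed
  have e0: "min e (1/2) > 0" using e by simp
  obtain F where F: "disc_into \<Omega> F" "\<And>z. norm z \<le> s \<Longrightarrow> norm (F z - b z) < min e (1/2)"
    "(LINT \<xi>|circle_measure. \<psi> (F \<xi>)) > (LINT \<xi>|circle_measure. real k + 1) - min e (1/2)"
    using glue_discs[OF \<Omega>(1) b \<psi>c \<psi>0 borel_measurable_const continuous_on_const ex e0 s] by blast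
  have Fm: "(LINT \<xi>|circle_measure. \<psi> (F \<xi>)) > real k + 1/2" using F(3) by (simp add: min_def split: if_splits)
  have Fc: "continuous_on UNIV F" using disc_into_cont[OF F(1)] .
  define K where "K = F ` cball 0 1"
  have K: "compact K" "K \<subseteq> \<Omega>" unfolding K_def using F(1)
    by (auto simp: disc_into_def intro!: compact_continuous_image continuous_on_subset[OF Fc])
  obtain d0 where d0: "d0 > 0" "\<And>x y. x \<in> K \<Longrightarrow> norm (y - x) < d0 \<Longrightarrow> y \<in> \<Omega>"
    using compact_open_margin[OF K(1) \<Omega>(1) K(2)] by metis
  obtain d1 where d1: "d1 > 0" "\<And>x y. x \<in> K \<Longrightarrow> norm (y - x) < d1 \<Longrightarrow> \<bar>\<psi> y - \<psi> x\<bar> < 1/4"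
    using compact_uniform_modulus[OF K(1) \<psi>c, of "1/4"] by (metis zero_less_divide_1_iff zero_less_numeral)
  define e' where "e' = min (min (e/2) 1) (min d0 d1 / 4)"
  have e': "0 < e'" "e' \<le> e/2" "e' \<le> 1" "2 * e' < d0" "2 * e' < d1"
    using e d0(1) d1(1) by (auto simp: e'_def min_def)
  have "uniformly_continuous_on (cball 0 1) F"
    by (intro compact_uniformly_continuous continuous_on_subset[OF Fc]) auto
  then obtain d2 where d2: "d2 > 0" "\<And>x y. norm x \<le> 1 \<Longrightarrow> norm y \<le> 1 \<Longrightarrow> norm (y - x) < d2 \<Longrightarrow> norm (F y - F x) < d1"
    using d1(1) unfolding uniformly_continuous_on_def dist_norm by (metis mem_cball_0)
  define s' where "s' = max (max s (1/2)) (max (1 - 1 / (real k + 1)) (1 - d2 / 2))"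
  have s': "s \<le> s'" "s' < 1" "0 \<le> s'" "1 - 1 / (real k + 1) \<le> s'" "1 - s' < d2"
    using s d2(1) unfolding s'_def by (auto simp: less_max_iff_disj le_max_iff_disj)
  have near: "\<bar>\<psi> (F (of_real s' * \<xi>)) - \<psi> (F \<xi>)\<bar> < 1/4" if x: "norm \<xi> = 1" for \<xi>
  proof (rule d1(2))
    show "F \<xi> \<in> K" using x by (simp add: K_def)
    have "of_real s' * \<xi> - \<xi> = of_real (s' - 1) * \<xi>" by (simp add: algebra_simps)
    then have "norm (of_real s' * \<xi> - \<xi>) = 1 - s'" using x s' by (simp only: norm_mult norm_of_real) simp
    then show "norm (F (of_real s' * \<xi>) - F \<xi>) < d1"
      using x s' by (intro d2(2)) (auto simp: norm_mult)
  qed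
  have iF: "integrable circle_measure (\<lambda>\<xi>. \<psi> (F \<xi>))"
    by (intro circle_integrable continuous_on_compose2[OF \<psi>c Fc]) auto
  have iF': "integrable circle_measure (\<lambda>\<xi>. \<psi> (F (of_real s' * \<xi>)))"
    by (intro circle_integrable continuous_on_compose2[OF \<psi>c] continuous_on_compose2[OF Fc] continuous_intros) auto
  have "(LINT \<xi>|circle_measure. \<psi> (F \<xi>) - 1/4) \<le> (LINT \<xi>|circle_measure. \<psi> (F (of_real s' * \<xi>)))"
  proof (rule circle_mean_mono)
    fix \<xi> :: complex assume "norm \<xi> = 1"
    from near[OF this] show "\<psi> (F \<xi>) - 1/4 \<le> \<psi> (F (of_real s' * \<xi>))" by linarith
  qed (use iF iF' in auto)
  then have m: "real k < (LINT \<xi>|circle_measure. \<psi> (F (of_real s' * \<xi>)))" using Fm iF by simp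
  have marg: "w \<in> \<Omega> \<and> \<bar>\<psi> w - \<psi> (F z)\<bar> < 1" if "norm z \<le> 1" "norm (w - F z) \<le> 2 * e'" for z w
  proof -
    have "F z \<in> K" using that by (simp add: K_def)
    then show ?thesis using d0(2)[of "F z" w] d1(2)[of "F z" w] that e' by auto
  qed
  have close: "norm (F z - b z) < e" if "norm z \<le> s" for z using F(2)[OF that] by simp
  show ?thesis
  proof (intro exI conjI allI impI)
    show "real k < (LINT \<xi>|circle_measure. norm (F (of_real s' * \<xi>)) powr p)" using m unfolding \<psi>_def .
    fix z w :: complex assume "norm z \<le> 1" "norm (w - F z) \<le> 2 * e'"
    from marg[OF this] show "w \<in> \<Omega>" "\<bar>norm w powr p - norm (F z) powr p\<bar> < 1" by (auto simp: \<psi>_def)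
  qed (use F(1) s' e' close in auto)
qed

text \<open>The tolerances are at least halved in every step, so the discs converge locally uniformly, and
  the limit differs from the \<open>k\<close>-th disc by at most twice its tolerance on the \<open>k\<close>-th circle.
  A perturbation of that size changes the \<open>p\<close>-th power of the modulus by less than 1, so the mean
  of the limit over that circle is at least \<open>k - 1\<close>.\<close>

lemma exists_disc_outside_hardy_space:
  fixes p :: real
  assumes \<Omega>: "open \<Omega>" "\<Omega> \<noteq> UNIV" "\<Omega> \<noteq> {}" and cap: "log_capacity (- \<Omega>) = 0" and p: "0 < p" "p \<le> 1"
  shows "\<exists>f. f holomorphic_on ball 0 1 \<and> f ` ball 0 1 \<subseteq> \<Omega> \<and> f \<notin> hardy_space p"
proof -
  define P where "P k x \<longleftrightarrow> (case x of (F, s, e) \<Rightarrow> disc_into \<Omega> F \<and> s < 1 \<and> 1 - 1 / (real k + 1) \<le> s \<and> 0 < e \<and> e \<le> 1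
     \<and> (\<forall>z w. norm z \<le> 1 \<longrightarrow> norm (w - F z) \<le> 2 * e \<longrightarrow> w \<in> \<Omega> \<and> \<bar>norm w powr p - norm (F z) powr p\<bar> < 1)
     \<and> real k < (LINT \<xi>|circle_measure. norm (F (of_real s * \<xi>)) powr p))"
    for k :: nat and x :: "(complex \<Rightarrow> complex) \<times> real \<times> real"
  define Q where "Q x y \<longleftrightarrow> (case x of (F, s, e) \<Rightarrow> case y of (F', s', e') \<Rightarrow>
     s \<le> s' \<and> e' \<le> e / 2 \<and> (\<forall>z. norm z \<le> s \<longrightarrow> norm (F' z - F z) < e))"
    for x y :: "(complex \<Rightarrow> complex) \<times> real \<times> real"
  have "\<exists>X. \<forall>k. P k (X k) \<and> Q (X k) (X (Suc k))"
  proof (rule dependent_nat_choice)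
    obtain z0 where "z0 \<in> \<Omega>" using \<Omega>(3) by blast
    from enlarge_power_mean[OF \<Omega>(1,2) cap p disc_into_const[OF this], of 0 1 0]
    obtain F s e where "disc_into \<Omega> F" "s < 1" "1 - 1 / (real 0 + 1) \<le> s" "0 < e" "e \<le> 1"
      "\<forall>z w. norm z \<le> 1 \<longrightarrow> norm (w - F z) \<le> 2 * e \<longrightarrow> w \<in> \<Omega> \<and> \<bar>norm w powr p - norm (F z) powr p\<bar> < 1"
      "real 0 < (LINT \<xi>|circle_measure. norm (F (of_real s * \<xi>)) powr p)" by auto
    then have "P 0 (F, s, e)" unfolding P_def by simp
    then show "\<exists>x. P 0 x" by blast
  next
    fix x k assume x: "P k x"
    obtain F s e where xe: "x = (F, s, e)" by (cases x)
    have "disc_into \<Omega> F" "s < 1" "e > 0" using x unfolding P_def xe by auto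
    from enlarge_power_mean[OF \<Omega>(1,2) cap p this, of "Suc k"]
    obtain F' s' e' where F': "disc_into \<Omega> F'" "s \<le> s'" "s' < 1" "1 - 1 / (real (Suc k) + 1) \<le> s'" "0 < e'" "e' \<le> e / 2" "e' \<le> 1"
      "\<forall>z w. norm z \<le> 1 \<longrightarrow> norm (w - F' z) \<le> 2 * e' \<longrightarrow> w \<in> \<Omega> \<and> \<bar>norm w powr p - norm (F' z) powr p\<bar> < 1"
      "real (Suc k) < (LINT \<xi>|circle_measure. norm (F' (of_real s' * \<xi>)) powr p)"
      "\<forall>z. norm z \<le> s \<longrightarrow> norm (F' z - F z) < e" by blast
    then have "P (Suc k) (F', s', e')" unfolding P_def by simp
    moreover have "Q x (F', s', e')" unfolding Q_def xe using F' by simp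
    ultimately show "\<exists>y. P (Suc k) y \<and> Q x y" by blast
  qed
  then obtain X where X: "\<And>k. P k (X k)" "\<And>k. Q (X k) (X (Suc k))" by blast
  define F where "F k = fst (X k)" for k
  define s where "s k = fst (snd (X k))" for k
  define e where "e k = snd (snd (X k))" for k
  have Xe: "X k = (F k, s k, e k)" for k by (simp add: F_def s_def e_def)
  have Pk: "disc_into \<Omega> (F k)" "s k < 1" "1 - 1 / (real k + 1) \<le> s k" "0 < e k" "e k \<le> 1"
     "real k < (LINT \<xi>|circle_measure. norm (F k (of_real (s k) * \<xi>)) powr p)" for k
    using X(1)[of k] unfolding P_def Xe by auto
  have marg: "w \<in> \<Omega> \<and> \<bar>norm w powr p - norm (F k z) powr p\<bar> < 1" if "norm z \<le> 1" "norm (w - F k z) \<le> 2 * e k" for k z w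
    using X(1)[of k] that unfolding P_def Xe by blast
  have Qk: "s k \<le> s (Suc k)" "e (Suc k) \<le> e k / 2" "\<And>z. norm z \<le> s k \<Longrightarrow> norm (F (Suc k) z - F k z) < e k" for k
    using X(2)[of k] unfolding Q_def Xe by auto
  have smono: "s k \<le> s j" if "k \<le> j" for k j using that Qk(1) by (rule lift_Suc_mono_le[rotated])
  have s0: "0 \<le> s k" for k using Pk(3)[of k] by (smt (verit) divide_le_eq_1_pos of_nat_0_le_iff)
  have diff: "norm (F j z - F k z) \<le> 2 * e k - 2 * e j" if "k \<le> j" "norm z \<le> s k" for j k z
    using that(1)
  proof (induction j rule: dec_induct)
    case (step j)
    have "norm z \<le> s j" using smono[OF step.hyps(1)] that(2) by simp
    then have "norm (F (Suc j) z - F j z) < e j" by (rule Qk(3))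
    moreover have "norm (F (Suc j) z - F k z) \<le> norm (F (Suc j) z - F j z) + norm (F j z - F k z)"
      by (metis diff_add_cancel add_diff_eq norm_triangle_ineq)
    ultimately show ?case using step.IH Qk(2)[of j] by linarith
  qed simp
  have e2: "e k \<le> (1/2)^k" for k
  proof (induction k)
    case (Suc k)
    then show ?case using Qk(2)[of k] by simp
  qed (use Pk(5)[of 0] in simp)
  have enn: "0 \<le> e k" for k using Pk(4)[of k] by simp
  have elim0: "(\<lambda>k. 2 * e k) \<longlonglongrightarrow> 0"
  proof (rule tendsto_sandwich[where f="\<lambda>_. 0" and h="\<lambda>k. 2 * (1/2)^k"])
    show "(\<lambda>k. 2 * (1/2::real)^k) \<longlonglongrightarrow> 0"
      by (rule tendsto_mult_right_zero) (simp add: LIMSEQ_power_zero)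
    show "eventually (\<lambda>k. 0 \<le> 2 * e k) sequentially" using enn by (intro always_eventually allI) simp
  qed (use e2 in auto)
  define f where "f z = lim (\<lambda>k. F k z)" for z
  have conv: "(\<lambda>j. F j z) \<longlonglongrightarrow> f z" if z: "norm z \<le> s k" for z k
  proof -
    have "Cauchy (\<lambda>j. F j z)"
    proof (rule metric_CauchyI)
      fix \<epsilon> :: real assume "\<epsilon> > 0"
      then have "eventually (\<lambda>j. 2 * e j < \<epsilon> / 2) sequentially" using order_tendstoD(2)[OF elim0, of "\<epsilon> / 2"] by simp
      then obtain N where N: "\<And>j. j \<ge> N \<Longrightarrow> 2 * e j < \<epsilon> / 2" unfolding eventually_sequentially by blast
      let ?N = "max N k"
      have zN: "norm z \<le> s ?N" using z smono[of k ?N] by simp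
      have b: "norm (F j z - F ?N z) < \<epsilon> / 2" if "j \<ge> ?N" for j
        using diff[OF that zN] N[of ?N] Pk(4)[of j] by simp
      have "dist (F i z) (F j z) < \<epsilon>" if "i \<ge> ?N" "j \<ge> ?N" for i j
        using dist_triangle_half_l[of "F i z" "F ?N z" \<epsilon> "F j z"] b[OF that(1)] b[OF that(2)] by (simp add: dist_norm)
      then show "\<exists>M. \<forall>m\<ge>M. \<forall>n\<ge>M. dist (F m z) (F n z) < \<epsilon>" by blast
    qed
    then show ?thesis unfolding f_def using Cauchy_convergent convergent_LIMSEQ_iff by blast
  qed
  have close: "norm (f z - F k z) \<le> 2 * e k" if z: "norm z \<le> s k" for z k
  proof (rule LIMSEQ_le_const2)
    show "(\<lambda>j. norm (F j z - F k z)) \<longlonglongrightarrow> norm (f z - F k z)"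
      by (intro tendsto_intros conv[OF z])
    show "\<exists>N. \<forall>n\<ge>N. norm (F n z - F k z) \<le> 2 * e k"
      using diff[OF _ z] Pk(4) by (smt (verit))
  qed
  have exh: "\<exists>k. t < s k" if t: "t < 1" for t :: real
  proof -
    obtain k where "inverse (real (Suc k)) < 1 - t" using reals_Archimedean[of "1 - t"] t by auto
    then have "t < 1 - 1 / (real k + 1)" by (simp add: inverse_eq_divide add.commute)
    then show ?thesis using Pk(3)[of k] by (intro exI[of _ k]) linarith
  qed
  have "f holomorphic_on ball 0 1"
  proof (rule holomorphic_uniform_sequence[where f=F])
    show "F k holomorphic_on ball 0 1" for k
      using Pk(1)[of k] holomorphic_on_subset unfolding disc_into_def by blast
    fix z :: complex assume "z \<in> ball 0 1"
    then obtain k where k: "norm z < s k" using exh by auto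
    define d where "d = s k - norm z"
    have d: "d > 0" using k by (simp add: d_def)
    have sub: "norm w \<le> s k" if "w \<in> cball z d" for w
      using that norm_triangle_ineq2[of w z] by (simp add: d_def dist_norm norm_minus_commute)
    have "norm w < 1" if "w \<in> cball z d" for w using sub[OF that] Pk(2)[of k] by linarith
    then have "cball z d \<subseteq> ball 0 1" by auto
    moreover have "uniform_limit (cball z d) F f sequentially"
    proof (rule uniform_limitI)
      fix \<epsilon> :: real assume "\<epsilon> > 0"
      then have "eventually (\<lambda>j. 2 * e j < \<epsilon>) sequentially" by (rule order_tendstoD(2)[OF elim0])
      then show "eventually (\<lambda>j. \<forall>w\<in>cball z d. dist (F j w) (f w) < \<epsilon>) sequentially"
        using eventually_ge_at_top[of k]
      proof eventually_elim
        case (elim j)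
        show ?case
        proof
          fix w assume "w \<in> cball z d"
          then have "norm w \<le> s j" using sub smono[OF elim(2)] by force
          from close[OF this] show "dist (F j w) (f w) < \<epsilon>" using elim(1) by (simp add: dist_norm norm_minus_commute)
        qed
      qed
    qed
    ultimately show "\<exists>d>0. cball z d \<subseteq> ball 0 1 \<and> uniform_limit (cball z d) F f sequentially" using d by blast
  qed simp
  moreover have "f ` ball 0 1 \<subseteq> \<Omega>"
  proof
    fix y assume "y \<in> f ` ball 0 1"
    then obtain z where z: "y = f z" "norm z < 1" by auto
    then obtain k where "norm z < s k" using exh by auto
    then show "y \<in> \<Omega>" using marg[of z "f z" k] close[of z k] z by simp
  qed
  moreover have "f \<notin> hardy_space p"
  proof
    assume "f \<in> hardy_space p"
    then have fin: "(SUP r\<in>{0<..<1}. \<integral>\<^sup>+ \<xi>. ennreal (norm (f (complex_of_real r * \<xi>)) powr p) \<partial>circle_measure) < \<infinity>" (is "?S < \<infinity>")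
      by (simp add: hardy_space_def)
    then obtain c where c: "?S = ennreal c" "c \<ge> 0" by (cases ?S) auto
    obtain k0 :: nat where k0: "c + 1 < real k0" using reals_Archimedean2 by blast
    define k where "k = Suc k0"
    have sk: "s k \<in> {0<..<1}" 
    proof -
      have "1 / (real k + 1) < 1" by (simp add: k_def)
      then have "0 < s k" using Pk(3)[of k] by linarith
      then show ?thesis using Pk(2)[of k] by simp
    qed
    define \<phi> where "\<phi> \<xi> = norm (F k (of_real (s k) * \<xi>)) powr p" for \<xi>
    have "continuous_on UNIV \<phi>" unfolding \<phi>_def
      by (intro continuous_on_compose2[OF powr_norm_cont[OF p(1)]] continuous_on_compose2[OF disc_into_cont[OF Pk(1)]] continuous_intros) auto
    then have i: "integrable circle_measure \<phi>" by (rule circle_integrable)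
    have "real k < (LINT \<xi>|circle_measure. \<phi> \<xi>)" using Pk(6)[of k] unfolding \<phi>_def .
    moreover have "(LINT \<xi>|circle_measure. \<phi> \<xi> - 1) = (LINT \<xi>|circle_measure. \<phi> \<xi>) - 1" using i by simp
    ultimately have "c < (LINT \<xi>|circle_measure. \<phi> \<xi> - 1)" using k0 unfolding k_def by linarith
    also have "\<dots> \<le> (LINT \<xi>|circle_measure. max 0 (\<phi> \<xi> - 1))" by (intro integral_mono) (use i in auto)
    finally have "ennreal c < ennreal (LINT \<xi>|circle_measure. max 0 (\<phi> \<xi> - 1))" using c by (simp add: ennreal_less_iff)
    also have "\<dots> = (\<integral>\<^sup>+ \<xi>. ennreal (max 0 (\<phi> \<xi> - 1)) \<partial>circle_measure)"
      by (rule nn_integral_eq_integral[symmetric]) (use i in auto)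
    also have "\<dots> \<le> (\<integral>\<^sup>+ \<xi>. ennreal (norm (f (complex_of_real (s k) * \<xi>)) powr p) \<partial>circle_measure)"
    proof (rule nn_integral_mono_AE)
      show "AE \<xi> in circle_measure. ennreal (max 0 (\<phi> \<xi> - 1)) \<le> ennreal (norm (f (complex_of_real (s k) * \<xi>)) powr p)"
        using AE_circle
      proof eventually_elim
        case (elim \<xi>)
        have n: "norm (of_real (s k) * \<xi>) \<le> s k" using s0 elim by (simp add: norm_mult)
        then have n1: "norm (of_real (s k) * \<xi>) \<le> 1" using Pk(2)[of k] by linarith
        have "\<bar>norm (f (of_real (s k) * \<xi>)) powr p - \<phi> \<xi>\<bar> < 1"
          unfolding \<phi>_def using marg[OF n1 close[OF n]] by blast
        moreover have "0 \<le> norm (f (of_real (s k) * \<xi>)) powr p" by simp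
        ultimately have "max 0 (\<phi> \<xi> - 1) \<le> norm (f (of_real (s k) * \<xi>)) powr p" by linarith
        then show ?case by (rule ennreal_leI)
      qed
    qed
    also have "\<dots> \<le> ?S" by (rule SUP_upper[OF sk])
    finally show False using c by simp
  qed
  ultimately show ?thesis by blast
qed

lemma hardy_space_mono:
  assumes f: "f \<in> hardy_space q" and pq: "0 < p" "p \<le> q"
  shows "f \<in> hardy_space p"
proof -
  have hol: "f holomorphic_on ball 0 1" using f by (simp add: hardy_space_def)
  have fin: "(SUP r\<in>{0<..<1}. \<integral>\<^sup>+ \<xi>. ennreal (norm (f (complex_of_real r * \<xi>)) powr q) \<partial>circle_measure) < \<infinity>" (is "?S < \<infinity>")
    using f by (simp add: hardy_space_def)
  have "(\<integral>\<^sup>+ \<xi>. ennreal (norm (f (complex_of_real r * \<xi>)) powr p) \<partial>circle_measure) \<le> 1 + ?S" if r: "r \<in> {0<..<1}" for r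
  proof -
    have r': "0 \<le> r" "r < 1" using r by auto
    obtain g where g: "continuous_on UNIV g" "\<And>\<xi>. norm \<xi> = 1 \<Longrightarrow> g \<xi> = f (of_real r * \<xi>)" "\<And>\<xi>. g \<xi> \<in> f ` cball 0 r"
      using radial_extension[OF hol r'] by blast
    have [measurable]: "g \<in> borel_measurable borel" using g(1) by (rule borel_measurable_contI)
    have "(\<integral>\<^sup>+ \<xi>. ennreal (norm (f (complex_of_real r * \<xi>)) powr p) \<partial>circle_measure)
        \<le> (\<integral>\<^sup>+ \<xi>. 1 + ennreal (norm (g \<xi>) powr q) \<partial>circle_measure)"
    proof (rule nn_integral_mono_AE)
      show "AE \<xi> in circle_measure. ennreal (norm (f (complex_of_real r * \<xi>)) powr p) \<le> 1 + ennreal (norm (g \<xi>) powr q)"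
        using AE_circle
      proof eventually_elim
        case (elim \<xi>)
        define x where "x = norm (f (of_real r * \<xi>))"
        have "x powr p \<le> 1 + x powr q"
        proof (cases "x \<le> 1")
          case True
          have "x powr p \<le> 1 powr p" using True pq by (intro powr_mono2) (auto simp: x_def)
          then show ?thesis using powr_ge_zero[of x q] by (simp del: powr_ge_zero)
        next
          case False
          then have "x powr p \<le> x powr q" using pq by (intro powr_mono) auto
          then show ?thesis by simp
        qed
        then have "ennreal (x powr p) \<le> ennreal (1 + x powr q)" by (rule ennreal_leI)
        then show ?case using g(2)[OF elim] by (simp add: x_def ennreal_plus)
      qed
    qed
    also have "\<dots> = 1 + (\<integral>\<^sup>+ \<xi>. ennreal (norm (g \<xi>) powr q) \<partial>circle_measure)"
      by (subst nn_integral_add) (auto simp: circle.emeasure_space_1[simplified])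
    also have "(\<integral>\<^sup>+ \<xi>. ennreal (norm (g \<xi>) powr q) \<partial>circle_measure) = (\<integral>\<^sup>+ \<xi>. ennreal (norm (f (complex_of_real r * \<xi>)) powr q) \<partial>circle_measure)"
      by (rule nn_integral_cong_AE, rule AE_mp[OF AE_circle], rule AE_I2) (use g(2) in auto)
    also have "\<dots> \<le> ?S" by (rule SUP_upper[OF r])
    finally show ?thesis by (simp add: add_left_mono)
  qed
  then have "(SUP r\<in>{0<..<1}. \<integral>\<^sup>+ \<xi>. ennreal (norm (f (complex_of_real r * \<xi>)) powr p) \<partial>circle_measure) \<le> 1 + ?S"
    by (intro SUP_least)
  also have "\<dots> < \<infinity>" using fin by simp
  finally show ?thesis using hol by (simp add: hardy_space_def)
qed

lemma hardy_number_zero_of_capacity_zero: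
  assumes \<Omega>: "open \<Omega>" "\<Omega> \<noteq> UNIV" "\<Omega> \<noteq> {}" and cap: "log_capacity (- \<Omega>) = 0"
  shows "hardy_number \<Omega> = 0"
proof (rule ccontr)
  assume "hardy_number \<Omega> \<noteq> 0"
  then have "0 < hardy_number \<Omega>" by (rule zero_less_iff_neq_zero[THEN iffD2])
  then obtain x where x: "0 < x" "x < hardy_number \<Omega>" using dense by blast
  obtain c where xc: "x = ennreal c"
  proof (cases x)
    case top
    then show ?thesis using x(2) by simp
  qed (rule that)
  have c: "0 < ennreal c" "ennreal c < hardy_number \<Omega>" using x unfolding xc .
  define p where "p = min c 1"
  have p: "0 < p" "p \<le> 1" "p \<le> c" using c(1) by (auto simp: p_def ennreal_less_zero_iff)
  obtain f where f: "f holomorphic_on ball 0 1" "f ` ball 0 1 \<subseteq> \<Omega>" "f \<notin> hardy_space p"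
    using exists_disc_outside_hardy_space[OF \<Omega> cap p(1,2)] by blast
  have "hardy_number_fun f \<le> ennreal p"
    unfolding hardy_number_fun_def
  proof (rule Sup_least)
    fix x assume "x \<in> {0} \<union> {ennreal p |p. 0 < p \<and> f \<in> hardy_space p}"
    then consider "x = 0" | q where "x = ennreal q" "0 < q" "f \<in> hardy_space q" by blast
    then show "x \<le> ennreal p"
    proof cases
      case 2
      then have "q \<le> p" using hardy_space_mono[of f q p] f(3) p(1) by (metis linear)
      then show ?thesis using 2 by (simp add: ennreal_leI)
    qed simp
  qed
  moreover have "hardy_number \<Omega> \<le> hardy_number_fun f"
    unfolding hardy_number_def using f by (intro Inf_lower) blast
  ultimately have "hardy_number \<Omega> \<le> ennreal c" using p(3) by (meson ennreal_leI order_trans)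
  then show False using c(2) by simp
qed

section \<open>Bounded potentials from positive capacity\<close>

text \<open>The complement of the support is a union of null sets from a countable base.\<close>

lemma AE_in_measure_support:
  fixes \<mu> :: "'a::{second_countable_topology} measure"
  assumes sets: "sets \<mu> = sets borel"
  shows "AE x in \<mu>. x \<in> measure_support \<mu>"
proof -
  obtain B :: "'a set set" where B: "countable B" "topological_basis B"
    using ex_countable_basis by blast
  define N where "N = {U \<in> B. emeasure \<mu> U = 0}"
  have "AE x in \<mu>. \<forall>U\<in>N. x \<notin> U"
  proof (rule AE_ball_countable')
    show "countable N" using B(1) unfolding N_def by simp
    fix U assume U: "U \<in> N"
    then have "open U" using topological_basis_open[OF B(2)] unfolding N_def by blast
    then have "U \<in> null_sets \<mu>" using U sets by (auto simp: N_def null_sets_def)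
    then show "AE x in \<mu>. x \<notin> U" by (rule AE_not_in)
  qed
  then show ?thesis
  proof eventually_elim
    case (elim x)
    show ?case unfolding measure_support_def
    proof (safe)
      fix U assume U: "open U" "x \<in> U"
      then obtain V where V: "V \<in> B" "x \<in> V" "V \<subseteq> U" using topological_basisE[OF B(2)] by metis
      then have "emeasure \<mu> V \<noteq> 0" using elim by (auto simp: N_def)
      moreover have "emeasure \<mu> V \<le> emeasure \<mu> U" using V U sets by (intro emeasure_mono) auto
      ultimately show "0 < emeasure \<mu> U" by (metis less_le_trans zero_less_iff_neq_zero)
    qed
  qed
qed

lemma log_ext_borel [measurable]: "log_ext \<in> borel_measurable borel"
  unfolding log_ext_def[abs_def] by measurable

text \<open>Otherwise the negative part of the potential would be infinite almost everywhere, while the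
  positive part is bounded on the compact support, and the energy would be \<open>- \<infinity>\<close>.\<close>

lemma finite_energy_imp_bounded_potential_somewhere:
  assumes \<mu>: "prob_space \<mu>" "sets \<mu> = sets borel" "compact (measure_support \<mu>)" and en: "energy \<mu> \<noteq> -\<infinity>"
  shows "\<exists>m::nat. emeasure \<mu> {z \<in> measure_support \<mu>. (\<integral>\<^sup>+w. e2ennreal (- log_ext (norm (z - w))) \<partial>\<mu>) \<le> of_nat m} > 0"
proof (rule ccontr)
  assume no: "\<not> ?thesis"
  interpret prob_space \<mu> by fact
  have [measurable_cong]: "sets \<mu> = sets borel" by fact
  define N where "N z = (\<integral>\<^sup>+w. e2ennreal (- log_ext (norm (z - w))) \<partial>\<mu>)" for z
  define P where "P z = (\<integral>\<^sup>+w. e2ennreal (log_ext (norm (z - w))) \<partial>\<mu>)" for z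
  have [measurable]: "N \<in> borel_measurable borel" unfolding N_def[abs_def] by measurable
  have ms [measurable]: "measure_support \<mu> \<in> sets borel" using closed_measure_support by (rule borel_closed)
  obtain L where L: "\<And>w. w \<in> measure_support \<mu> \<Longrightarrow> norm w \<le> L"
    using compact_imp_bounded[OF \<mu>(3)] unfolding bounded_iff by blast
  have AEs: "AE w in \<mu>. w \<in> measure_support \<mu>" by (rule AE_in_measure_support[OF \<mu>(2)])
  have P: "P z < \<infinity>" if z: "z \<in> measure_support \<mu>" for z
  proof -
    have "P z \<le> (\<integral>\<^sup>+w. ennreal (ln (2 * \<bar>L\<bar> + 1)) \<partial>\<mu>)"
      unfolding P_def
    proof (rule nn_integral_mono_AE)
      show "AE w in \<mu>. e2ennreal (log_ext (norm (z - w))) \<le> ennreal (ln (2 * \<bar>L\<bar> + 1))"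
        using AEs
      proof eventually_elim
        case (elim w)
        have "norm (z - w) \<le> 2 * \<bar>L\<bar> + 1" using norm_triangle_ineq4[of z w] L[OF z] L[OF elim] by linarith
        then have "log_ext (norm (z - w)) \<le> ereal (ln (2 * \<bar>L\<bar> + 1))"
          by (auto simp: log_ext_def)
        from e2ennreal_mono[OF this] show ?case by simp
      qed
    qed
    also have "\<dots> < \<infinity>" by (simp add: emeasure_space_1)
    finally show ?thesis .
  qed
  have "AE z in \<mu>. \<not> (z \<in> measure_support \<mu> \<and> N z \<le> of_nat m)" for m
  proof (rule AE_I')
    show "{z \<in> measure_support \<mu>. N z \<le> of_nat m} \<in> null_sets \<mu>"
      using no unfolding N_def[symmetric] by (auto simp: null_sets_def not_less)
  qed auto
  then have "AE z in \<mu>. \<forall>m. \<not> (z \<in> measure_support \<mu> \<and> N z \<le> of_nat m)" unfolding AE_all_countable by blast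
  then have Ninf: "AE z in \<mu>. N z = \<infinity> \<and> P z < \<infinity>"
    using AEs
  proof eventually_elim
    case (elim z)
    have "N z = \<infinity>"
    proof (rule ccontr)
      assume "N z \<noteq> \<infinity>"
      then obtain x where x: "N z = ennreal x" "x \<ge> 0" by (cases "N z") auto
      obtain m :: nat where "x \<le> real m" using real_arch_simple by blast
      then have "N z \<le> of_nat m" using x by (simp add: ennreal_leI ennreal_of_nat_eq_real_of_nat)
      then show False using elim by blast
    qed
    then show ?case using P elim by blast
  qed
  define f where "f z = integral_ext \<mu> (\<lambda>w. log_ext (norm (z - w)))" for z
  have f: "AE z in \<mu>. f z = -\<infinity>"
    using Ninf
  proof eventually_elim
    case (elim z)
    then obtain x where "P z = ennreal x" "x \<ge> 0" by (cases "P z") auto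
    then show ?case using elim unfolding f_def integral_ext_def N_def[symmetric] P_def[symmetric] by (simp add: enn2ereal_ennreal)
  qed
  have "(\<integral>\<^sup>+z. e2ennreal (f z) \<partial>\<mu>) = (\<integral>\<^sup>+z. 0 \<partial>\<mu>)"
    by (rule nn_integral_cong_AE) (use f in \<open>auto elim!: eventually_mono simp: e2ennreal_neg\<close>)
  moreover have "(\<integral>\<^sup>+z. e2ennreal (- f z) \<partial>\<mu>) = (\<integral>\<^sup>+z. \<infinity> \<partial>\<mu>)"
    by (rule nn_integral_cong_AE) (use f in \<open>auto elim!: eventually_mono\<close>)
  ultimately have "energy \<mu> = -\<infinity>"
    unfolding energy_def f_def[symmetric] integral_ext_def[of \<mu> f]
    by (simp add: emeasure_space_1 ennreal_top_mult zero_ennreal.rep_eq)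
  then show False using en by simp
qed

text \<open>Restrict a measure of finite energy to the set \<open>F\<close> where its potential is bounded. For \<open>z\<close>
  outside \<open>E\<close> choose \<open>z'\<close> in \<open>F\<close> that is nearest up to a factor 2; then
  \<open>\<bar>z' - w\<bar> \<le> 3 * \<bar>z - w\<bar>\<close> for all \<open>w\<close> in \<open>F\<close>, so the bound at \<open>z'\<close> passes to \<open>z\<close>.\<close>

lemma positive_capacity_bounded_potential:
  assumes cap: "log_capacity E > 0" and E: "closed E"
  obtains \<nu> :: "complex measure" and L M :: real where "prob_space \<nu>" "sets \<nu> = sets borel"
    "AE w in \<nu>. w \<in> E \<and> norm w \<le> L" "M \<ge> 0" "L \<ge> 0"
    "\<And>z. z \<notin> E \<Longrightarrow> (\<integral>\<^sup>+w. ennreal (- ln (norm (z - w))) \<partial>\<nu>) \<le> ennreal M"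
proof -
  obtain \<mu> where \<mu>: "prob_space \<mu>" "sets \<mu> = sets borel" "compact (measure_support \<mu>)" "measure_support \<mu> \<subseteq> E"
    and en: "exp_ext (energy \<mu>) > 0"
    using cap unfolding log_capacity_def less_SUP_iff by blast
  interpret \<mu>: prob_space \<mu> by fact
  have [measurable_cong]: "sets \<mu> = sets borel" by fact
  have "energy \<mu> \<noteq> -\<infinity>" using en by (auto simp: exp_ext_def)
  from finite_energy_imp_bounded_potential_somewhere[OF \<mu>(1-3) this]
  obtain m :: nat where m: "emeasure \<mu> {z \<in> measure_support \<mu>. (\<integral>\<^sup>+w. e2ennreal (- log_ext (norm (z - w))) \<partial>\<mu>) \<le> of_nat m} > 0" by blast
  define N where "N z = (\<integral>\<^sup>+w. e2ennreal (- log_ext (norm (z - w))) \<partial>\<mu>)" for z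
  have [measurable]: "N \<in> borel_measurable borel" unfolding N_def[abs_def] by measurable
  define F where "F = {z \<in> measure_support \<mu>. N z \<le> of_nat m}"
  have [measurable]: "measure_support \<mu> \<in> sets borel" using closed_measure_support by (rule borel_closed)
  have F[measurable]: "F \<in> sets borel" unfolding F_def by measurable
  have Fpos: "emeasure \<mu> F > 0" using m unfolding F_def N_def .
  have Ffin: "emeasure \<mu> F < \<infinity>" using \<mu>.emeasure_finite[of F] by (metis infinity_ennreal_def top.not_eq_extremum)
  define \<nu> where "\<nu> = uniform_measure \<mu> F"
  have prob: "prob_space \<nu>" unfolding \<nu>_def using Fpos Ffin by (intro prob_space_uniform_measure) auto
  have sets: "sets \<nu> = sets borel" unfolding \<nu>_def using \<mu>(2) by simp
  obtain L where L: "\<And>w. w \<in> measure_support \<mu> \<Longrightarrow> norm w \<le> L"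
    using compact_imp_bounded[OF \<mu>(3)] unfolding bounded_iff by blast
  have AEF: "AE w in \<nu>. w \<in> F" unfolding \<nu>_def by (rule AE_uniform_measureI) auto
  define M1 where "M1 = of_nat m / emeasure \<mu> F"
  have "M1 \<noteq> \<infinity>" unfolding M1_def using Fpos by (auto simp: ennreal_divide_eq_top_iff)
  then have M1: "M1 < \<infinity>" by (simp add: top.not_eq_extremum)
  have NF: "(\<integral>\<^sup>+w. e2ennreal (- log_ext (norm (z - w))) \<partial>\<nu>) \<le> M1" if z: "z \<in> F" for z
  proof -
    have "(\<integral>\<^sup>+w. e2ennreal (- log_ext (norm (z - w))) \<partial>\<nu>) = (\<integral>\<^sup>+w. e2ennreal (- log_ext (norm (z - w))) * indicator F w \<partial>\<mu>) / emeasure \<mu> F"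
      unfolding \<nu>_def by (rule nn_integral_uniform_measure) auto
    also have "\<dots> \<le> N z / emeasure \<mu> F"
      unfolding N_def by (intro divide_right_mono_ennreal nn_integral_mono) (auto simp: indicator_def)
    also have "\<dots> \<le> M1" unfolding M1_def using z by (intro divide_right_mono_ennreal) (simp add: F_def)
    finally show ?thesis .
  qed
  have Fne: "F \<noteq> {}" using Fpos by auto
  have bound: "(\<integral>\<^sup>+w. ennreal (- ln (norm (z - w))) \<partial>\<nu>) \<le> ennreal (ln 3) + M1" if z: "z \<notin> E" for z
  proof -
    have "z \<notin> closure F"
      using closure_minimal[of F E] E \<mu>(4) z by (auto simp: F_def)
    then have pos: "infdist z F > 0" using Fne in_closure_iff_infdist_zero infdist_nonneg by (metis less_eq_real_def)
    obtain z' where z': "z' \<in> F" "dist z z' < 2 * infdist z F"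
    proof -
      have "(INF y\<in>F. dist z y) < 2 * infdist z F" using pos Fne by (simp add: infdist_def)
      then show ?thesis using that cINF_less_iff[of F "dist z"] Fne by (auto intro!: bdd_belowI[of _ 0])
    qed
    have "(\<integral>\<^sup>+w. ennreal (- ln (norm (z - w))) \<partial>\<nu>) \<le> (\<integral>\<^sup>+w. ennreal (ln 3) + e2ennreal (- log_ext (norm (z' - w))) \<partial>\<nu>)"
    proof (rule nn_integral_mono_AE)
      show "AE w in \<nu>. ennreal (- ln (norm (z - w))) \<le> ennreal (ln 3) + e2ennreal (- log_ext (norm (z' - w)))"
        using AEF
      proof eventually_elim
        case (elim w)
        show ?case
        proof (cases "z' = w")
          case True
          then show ?thesis by (simp add: e2ennreal_neg_log)
        next
          case False
          have d: "infdist z F \<le> dist z w" by (rule infdist_le[OF elim])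
          have "dist z' w \<le> dist z z' + dist z w" by (metis dist_commute dist_triangle)
          then have "norm (z' - w) \<le> 3 * norm (z - w)" using d z'(2) by (simp add: dist_norm)
          moreover have p: "norm (z - w) > 0" using d pos unfolding dist_norm by linarith
          ultimately have "ln (norm (z' - w)) \<le> ln (3 * norm (z - w))" using False by (subst ln_le_cancel_iff) auto
          then have "- ln (norm (z - w)) \<le> ln 3 + - ln (norm (z' - w))" using p by (simp add: ln_mult)
          also have "\<dots> \<le> ln 3 + max 0 (- ln (norm (z' - w)))" by simp
          finally have "ennreal (- ln (norm (z - w))) \<le> ennreal (ln 3 + max 0 (- ln (norm (z' - w))))" by (rule ennreal_leI)
          also have "\<dots> = ennreal (ln 3) + ennreal (- ln (norm (z' - w)))"
            by (subst ennreal_plus) (auto simp: max_def ennreal_neg)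
          finally show ?thesis using False by (simp add: e2ennreal_neg_log)
        qed
      qed
    qed
    also have "\<dots> = ennreal (ln 3) + (\<integral>\<^sup>+w. e2ennreal (- log_ext (norm (z' - w))) \<partial>\<nu>)"
    proof -
      have [measurable_cong]: "sets \<nu> = sets borel" by fact
      show ?thesis by (subst nn_integral_add) (auto simp: prob_space.emeasure_space_1[OF prob])
    qed
    also have "\<dots> \<le> ennreal (ln 3) + M1" by (intro add_left_mono NF z')
    finally show ?thesis .
  qed
  obtain M where M: "ennreal (ln 3) + M1 = ennreal M" "M \<ge> 0"
    using M1 by (cases "ennreal (ln 3) + M1") auto
  have "AE w in \<nu>. w \<in> E \<and> norm w \<le> \<bar>L\<bar>"
    using AEF by eventually_elim (use \<mu>(4) L in \<open>force simp: F_def\<close>)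
  then show ?thesis using that[OF prob sets _ M(2) abs_ge_zero, of L] bound unfolding M(1) by blast
qed

section \<open>The potential of a half-line\<close>

lemma increment_le_of_deriv_le:
  fixes f :: "real \<Rightarrow> real"
  assumes ab: "a \<le> b" and cont: "continuous_on {a..b} f"
    and der: "\<And>x. a < x \<Longrightarrow> x < b \<Longrightarrow> x \<noteq> c \<Longrightarrow> \<exists>f'. (f has_real_derivative f') (at x) \<and> f' \<le> D"
  shows "f b - f a \<le> D * (b - a)"
proof -
  have mvt: "f y - f x \<le> D * (y - x)" if xy: "a \<le> x" "x \<le> y" "y \<le> b" and c: "\<not> (x < c \<and> c < y)" for x y
  proof (cases "x = y")
    case False
    then have lt: "x < y" using xy by simp
    obtain l z where z: "x < z" "z < y" "(f has_real_derivative l) (at z)" "f y - f x = (y - x) * l"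
    proof -
      have "continuous_on {x..y} f" using xy by (intro continuous_on_subset[OF cont]) auto
      moreover have "f differentiable (at z)" if "x < z" "z < y" for z
        using der[of z] that xy c by (auto simp: real_differentiable_def)
      ultimately show ?thesis using MVT[OF lt] that by metis
    qed
    obtain f' where "(f has_real_derivative f') (at z)" "f' \<le> D" using der[of z] z xy c by auto
    then have "l \<le> D" using DERIV_unique z(3) by blast
    then have "(y - x) * l \<le> (y - x) * D" using lt by (intro mult_left_mono) auto
    then show ?thesis using z(4) by (simp add: mult.commute)
  qed simp
  show ?thesis
  proof (cases "a < c \<and> c < b")
    case True
    then have "f c - f a \<le> D * (c - a)" "f b - f c \<le> D * (b - c)" by (auto intro!: mvt)
    then show ?thesis by (simp add: algebra_simps)
  qed (use mvt[of a b] ab in auto)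
qed

text \<open>An antiderivative of \<open>ln \<bar>y\<bar> + 1\<close>, continuous across the origin.\<close>

definition xlnx :: "real \<Rightarrow> real" where "xlnx y = y * ln \<bar>y\<bar>"

lemma xlnx_cont: "continuous_on A xlnx"
proof -
  have "isCont xlnx x" for x
  proof (cases "x = 0")
    case True
    have "((\<lambda>y::real. y * ln \<bar>y\<bar>) \<longlongrightarrow> 0) (at 0)"
    proof (rule Lim_null_comparison[where g="\<lambda>y. 2 * sqrt \<bar>y\<bar> + \<bar>y\<bar> * \<bar>y\<bar>"])
      have le: "\<bar>y * ln \<bar>y\<bar>\<bar> \<le> 2 * sqrt \<bar>y\<bar> + \<bar>y\<bar> * \<bar>y\<bar>" if "y \<noteq> 0" for y :: real
      proof -
        define s where "s = sqrt \<bar>y\<bar>"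
        have s: "s > 0" "\<bar>y\<bar> = s^2" using that by (auto simp: s_def)
        have "ln s \<le> s" "- ln s \<le> 1 / s" using ln_le_minus_one[OF s(1)] ln_le_minus_one[of "1/s"] s(1) by (auto simp: ln_div)
        moreover have "ln \<bar>y\<bar> = 2 * ln s" unfolding s(2) using s(1) by (simp add: ln_realpow)
        ultimately have "\<bar>ln \<bar>y\<bar>\<bar> \<le> 2 * (1 / s) + \<bar>y\<bar>"
        proof -
          have "\<bar>ln \<bar>y\<bar>\<bar> \<le> max (2 * (1/s)) (ln \<bar>y\<bar>)" using \<open>- ln s \<le> 1 / s\<close> \<open>ln \<bar>y\<bar> = 2 * ln s\<close> by (auto simp: abs_if)
          moreover have "ln \<bar>y\<bar> \<le> \<bar>y\<bar>" using ln_le_minus_one[of "\<bar>y\<bar>"] that by simp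
          moreover have "2 * (1/s) \<ge> 0" using s by simp
          ultimately show ?thesis by linarith
        qed
        then have "\<bar>y\<bar> * \<bar>ln \<bar>y\<bar>\<bar> \<le> \<bar>y\<bar> * (2 * (1 / s) + \<bar>y\<bar>)" by (intro mult_left_mono) auto
        also have "\<dots> = 2 * s + \<bar>y\<bar> * \<bar>y\<bar>" using s by (simp add: distrib_left power2_eq_square)
        finally show ?thesis by (simp add: abs_mult s_def)
      qed
      show "eventually (\<lambda>y::real. norm (y * ln \<bar>y\<bar>) \<le> 2 * sqrt \<bar>y\<bar> + \<bar>y\<bar> * \<bar>y\<bar>) (at 0)"
        by (rule eventually_at_filter[THEN iffD2], rule always_eventually) (use le in auto)
      have "((\<lambda>y::real. 2 * sqrt \<bar>y\<bar> + \<bar>y\<bar> * \<bar>y\<bar>) \<longlongrightarrow> 2 * sqrt \<bar>0\<bar> + \<bar>0\<bar> * \<bar>0\<bar>) (at 0)"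
        by (intro tendsto_intros)
      then show "((\<lambda>y::real. 2 * sqrt \<bar>y\<bar> + \<bar>y\<bar> * \<bar>y\<bar>) \<longlongrightarrow> 0) (at 0)" by simp
    qed
    then show ?thesis using True by (simp add: isCont_def xlnx_def[abs_def])
  next
    case False
    then show ?thesis unfolding xlnx_def[abs_def] by (intro continuous_intros) auto
  qed
  then show ?thesis by (simp add: continuous_at_imp_continuous_on)
qed

lemma xlnx_deriv: "y \<noteq> 0 \<Longrightarrow> (xlnx has_real_derivative (ln \<bar>y\<bar> + 1)) (at y)"
proof -
  assume y: "y \<noteq> 0"
  then have y2: "0 < y * y" using not_real_square_gt_zero by blast
  have "((\<lambda>y. y * (ln (y^2) / 2)) has_real_derivative (ln \<bar>y\<bar> + 1)) (at y)"
    using y y2 ln_realpow[of "\<bar>y\<bar>" 2] by (auto intro!: derivative_eq_intros simp: field_simps power2_eq_square)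
  moreover have "y * (ln (y^2) / 2) = xlnx y" for y
    using ln_realpow[of "\<bar>y\<bar>" 2] by (cases "y = 0") (auto simp: xlnx_def)
  ultimately show ?thesis by simp
qed

text \<open>With \<open>\<rho> = sqrt R\<close> and the substitution \<open>t = x\<^sup>2\<close>, this is the integral of
  \<open>ln \<bar>R / t - 1\<bar> / sqrt t\<close> from 0 to \<open>x\<^sup>2\<close>, that is, the potential at \<open>- R\<close> of the density
  \<open>t powr (-1/2)\<close> on the segment from \<open>- x\<^sup>2\<close> to 0, normalised to vanish at the origin.\<close>

definition slit_primitive :: "real \<Rightarrow> real \<Rightarrow> real" where
  "slit_primitive \<rho> x = 2 * (xlnx (\<rho> + x) + xlnx (x - \<rho>) - 2 * xlnx x)"

lemma slit_primitive_cont: "continuous_on A (slit_primitive \<rho>)"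
  unfolding slit_primitive_def
  by (intro continuous_intros continuous_on_compose2[OF xlnx_cont[of UNIV]]) auto

lemma slit_primitive_deriv:
  assumes "x > 0" "\<rho> \<ge> 0" "x \<noteq> \<rho>"
  shows "(slit_primitive \<rho> has_real_derivative 2 * (ln \<bar>\<rho>^2 - x^2\<bar> - 2 * ln x)) (at x)"
proof -
  have "((\<lambda>x. xlnx (\<rho> + x)) has_real_derivative (ln \<bar>\<rho> + x\<bar> + 1) * (0 + 1)) (at x)"
    by (rule DERIV_chain2[OF xlnx_deriv DERIV_add[OF DERIV_const DERIV_ident]]) (use assms in simp)
  moreover have "((\<lambda>x. xlnx (x - \<rho>)) has_real_derivative (ln \<bar>x - \<rho>\<bar> + 1) * (1 - 0)) (at x)"
    by (rule DERIV_chain2[OF xlnx_deriv DERIV_diff[OF DERIV_ident DERIV_const]]) (use assms in simp)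
  moreover have "(xlnx has_real_derivative (ln \<bar>x\<bar> + 1)) (at x)" using assms by (intro xlnx_deriv) auto
  ultimately have "((\<lambda>x. 2 * (xlnx (\<rho> + x) + xlnx (x - \<rho>) - 2 * xlnx x)) has_real_derivative
     2 * ((ln \<bar>\<rho> + x\<bar> + 1) * (0 + 1) + (ln \<bar>x - \<rho>\<bar> + 1) * (1 - 0) - 2 * (ln \<bar>x\<bar> + 1))) (at x)"
    by (rule DERIV_cmult[OF DERIV_diff[OF DERIV_add DERIV_cmult]])
  moreover have "ln \<bar>\<rho>^2 - x^2\<bar> = ln \<bar>\<rho> + x\<bar> + ln \<bar>x - \<rho>\<bar>"
  proof -
    have "\<bar>\<rho>^2 - x^2\<bar> = \<bar>\<rho> + x\<bar> * \<bar>x - \<rho>\<bar>"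
      unfolding abs_mult[symmetric] by (subst abs_minus_cancel[symmetric]) (simp add: power2_eq_square algebra_simps)
    then show ?thesis using assms by (simp add: ln_mult)
  qed
  ultimately show ?thesis using assms(1) unfolding slit_primitive_def[abs_def] by (simp add: algebra_simps)
qed

text \<open>The potential of the truncated half-line is nowhere negative. For \<open>\<rho> < x\<close> this is
  convexity of \<open>y * ln y\<close>; for \<open>\<rho> \<ge> x\<close> it is monotonicity of the logarithm.\<close>

lemma slit_primitive_nonneg:
  assumes x: "x > 0" and r: "\<rho> \<ge> 0"
  shows "slit_primitive \<rho> x \<ge> 0"
proof (cases "\<rho> < x")
  case True
  have lnge: "ln (1 + u) \<ge> u / (1 + u)" if "u > -1" for u :: real
  proof -
    have "ln (1 / (1 + u)) \<le> 1 / (1 + u) - 1" by (rule ln_le_minus_one) (use that in simp)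
    then show ?thesis using that by (simp add: ln_div field_simps)
  qed
  have 1: "(x + \<rho>) * ln (1 + \<rho>/x) \<ge> \<rho>"
  proof -
    have "(x + \<rho>) * ((\<rho>/x) / (1 + \<rho>/x)) \<le> (x + \<rho>) * ln (1 + \<rho>/x)"
      using x r by (intro mult_left_mono lnge) (auto intro: less_le_trans[of _ 0])
    moreover have "(x + \<rho>) * ((\<rho>/x) / (1 + \<rho>/x)) = \<rho>" using x r by (simp add: field_simps)
    ultimately show ?thesis by simp
  qed
  have 2: "(x - \<rho>) * ln (1 + (- \<rho>/x)) \<ge> - \<rho>"
  proof -
    have "(x - \<rho>) * ((- \<rho>/x) / (1 + (- \<rho>/x))) \<le> (x - \<rho>) * ln (1 + (- \<rho>/x))"
      using x r True by (intro mult_left_mono lnge) (auto simp: field_simps)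
    moreover have "(x - \<rho>) * ((- \<rho>/x) / (1 + (- \<rho>/x))) = - \<rho>" using x r True by (simp add: field_simps)
    ultimately show ?thesis by simp
  qed
  have "1 + \<rho>/x = (x + \<rho>) / x" "1 + (- \<rho>/x) = (x - \<rho>) / x" using x by (auto simp: field_simps)
  then have "ln (1 + \<rho>/x) = ln (x + \<rho>) - ln x" "ln (1 + (- \<rho>/x)) = ln (x - \<rho>) - ln x"
    using x r True by (auto simp: ln_div)
  then have "(x + \<rho>) * (ln (x + \<rho>) - ln x) + (x - \<rho>) * (ln (x - \<rho>) - ln x) \<ge> 0" using 1 2 by simp
  then show ?thesis using x r True unfolding slit_primitive_def xlnx_def by (simp add: algebra_simps)
next
  case False
  show ?thesis
  proof (cases "\<rho> = x")
    case True
    have "ln x \<le> ln (x + x)" using x by (subst ln_le_cancel_iff) auto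
    then have "2 * x * ln x \<le> 2 * x * ln (x + x)" using x by (intro mult_left_mono) auto
    then show ?thesis using True x unfolding slit_primitive_def xlnx_def by (simp add: algebra_simps)
  next
    case False
    then have lt: "x < \<rho>" using \<open>\<not> \<rho> < x\<close> by simp
    have "ln (\<rho> - x) \<le> ln (\<rho> + x)" "ln x \<le> ln (\<rho> + x)" using x lt by (auto intro!: ln_le_cancel_iff[THEN iffD2])
    then have "(\<rho> - x) * ln (\<rho> - x) \<le> (\<rho> - x) * ln (\<rho> + x)" "2 * x * ln x \<le> 2 * x * ln (\<rho> + x)"
      using x lt by (auto intro!: mult_left_mono)
    moreover have "\<bar>x - \<rho>\<bar> = \<rho> - x" "\<bar>\<rho> + x\<bar> = \<rho> + x" "\<bar>x\<bar> = x" using x lt by auto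
    ultimately show ?thesis unfolding slit_primitive_def xlnx_def by (simp add: algebra_simps)
  qed
qed

text \<open>The bound grows like \<open>2 * ln R\<close> for \<open>\<rho> = sqrt R\<close>, which is exactly what the first
  translate of the measure contributes.\<close>

lemma slit_primitive_one:
  assumes r: "\<rho> \<ge> 0"
  shows "slit_primitive \<rho> 1 \<le> 4 + 4 * ln (\<rho> + 1)"
proof (cases "\<rho> \<le> 1")
  case True
  have "(1 - \<rho>) * ln (1 - \<rho>) \<le> 0"
    using True r by (cases "\<rho> = 1") (auto intro!: mult_nonneg_nonpos)
  moreover have "(\<rho> + 1) * ln (\<rho> + 1) \<le> 2 * ln (\<rho> + 1)" using True r by (intro mult_right_mono) auto
  ultimately show ?thesis using True r unfolding slit_primitive_def xlnx_def by (simp add: algebra_simps)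
next
  case False
  then have r1: "\<rho> > 1" by simp
  have "ln (\<rho> + 1) - ln (\<rho> - 1) \<le> 2 / (\<rho> - 1)"
  proof -
    have "ln ((\<rho> + 1) / (\<rho> - 1)) \<le> (\<rho> + 1) / (\<rho> - 1) - 1" using r1 by (intro ln_le_minus_one) auto
    also have "\<dots> = 2 / (\<rho> - 1)" using r1 by (simp add: field_simps)
    finally show ?thesis using r1 by (simp add: ln_div)
  qed
  then have "(\<rho> - 1) * (ln (\<rho> + 1) - ln (\<rho> - 1)) \<le> 2" using r1 by (simp add: field_simps)
  moreover have "\<bar>1 - \<rho>\<bar> = \<rho> - 1" using r1 by simp
  ultimately show ?thesis using r1 unfolding slit_primitive_def xlnx_def by (simp add: algebra_simps)
qed

text \<open>The derivative with respect to \<open>x\<close> is at most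
  \<open>2 * (ln (\<bar>R - n\<bar> + 1) - ln n)\<close> on the interval, away from the one point \<open>sqrt R\<close>.\<close>

lemma slit_primitive_increment:
  assumes n: "n \<ge> (1::nat)" and R: "R \<ge> 0"
  shows "slit_primitive (sqrt R) (sqrt (real (Suc n))) - slit_primitive (sqrt R) (sqrt (real n))
     \<le> 2 * (sqrt (real (Suc n)) - sqrt (real n)) * (ln (\<bar>R - real n\<bar> + 1) - ln (real n))"
proof -
  define D where "D = 2 * (ln (\<bar>R - real n\<bar> + 1) - ln (real n))"
  have "slit_primitive (sqrt R) (sqrt (real (Suc n))) - slit_primitive (sqrt R) (sqrt (real n))
     \<le> D * (sqrt (real (Suc n)) - sqrt (real n))"
  proof (rule increment_le_of_deriv_le[where c="sqrt R"])
    fix x assume x: "sqrt (real n) < x" "x < sqrt (real (Suc n))" "x \<noteq> sqrt R"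
    have s0: "0 < sqrt (real n)" using n by simp
    have x0: "x > 0" using x(1) s0 by linarith
    have "(sqrt (real n))^2 < x^2" using x(1) s0 by (intro power_strict_mono) auto
    then have 1: "real n < x^2" by simp
    have "x^2 < (sqrt (real (Suc n)))^2" using x(2) x0 by (intro power_strict_mono) auto
    then have 2: "x^2 < real n + 1" by simp
    have ne: "x^2 \<noteq> R" using x(3) x0 by auto
    have "ln \<bar>R - x^2\<bar> \<le> ln (\<bar>R - real n\<bar> + 1)" using ne 1 2 by (subst ln_le_cancel_iff) auto
    moreover have "ln (real n) \<le> 2 * ln x"
    proof -
      have "ln (real n) \<le> ln (x^2)" using 1 n by (subst ln_le_cancel_iff) auto
      then show ?thesis using x0 by (simp add: ln_realpow)
    qed
    ultimately have "2 * (ln \<bar>R - x^2\<bar> - 2 * ln x) \<le> D" by (simp add: D_def)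
    moreover have "(slit_primitive (sqrt R) has_real_derivative 2 * (ln \<bar>R - x^2\<bar> - 2 * ln x)) (at x)"
      using slit_primitive_deriv[of x "sqrt R"] x0 x(3) R by simp
    ultimately show "\<exists>f'. (slit_primitive (sqrt R) has_real_derivative f') (at x) \<and> f' \<le> D" by blast
  qed (auto intro: slit_primitive_cont)
  then show ?thesis by (simp add: D_def algebra_simps)
qed

lemma summable_three_halves: "summable (\<lambda>j. real (Suc j) powr (-3/2))"
  using summable_Suc_iff[of "\<lambda>j. real j powr (-3/2)"] summable_real_powr_iff[of "-3/2"] by simp

text \<open>Split the second sum at the integer part of \<open>R\<close>; each half is dominated by the convergent
  series of the first sum.\<close>

lemma sum_three_halves_distance_bound:
  obtains Z where "Z \<ge> 0" "\<And>N. (\<Sum>n<N. real (Suc n) powr (-3/2)) \<le> Z"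
    "\<And>R N. R \<ge> 0 \<Longrightarrow> (\<Sum>n<N. (1 + \<bar>R - real n\<bar>) powr (-3/2)) \<le> Z"
proof -
  let ?c = "\<lambda>j. real (Suc j) powr (-3/2)"
  define S where "S = (\<Sum>j. ?c j)"
  have fin: "(\<Sum>j\<in>A. ?c j) \<le> S" if "finite A" for A
    unfolding S_def by (rule sum_le_suminf[OF summable_three_halves that]) auto
  have S0: "S \<ge> 0" using fin[of "{}"] by simp
  have "(\<Sum>n<N. (1 + \<bar>R - real n\<bar>) powr (-3/2)) \<le> 2 * S" if R: "R \<ge> 0" for R N
  proof -
    define m where "m = nat \<lfloor>R\<rfloor>"
    have m: "real m \<le> R" "R < real m + 1" using R by (auto simp: m_def)
    have le: "(1 + \<bar>R - real n\<bar>) powr (-3/2) \<le> (if n \<le> m then ?c (m - n) else ?c (n - Suc m))" for n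
    proof (cases "n \<le> m")
      case True
      have "(1 + \<bar>R - real n\<bar>) powr (-3/2) \<le> real (Suc (m - n)) powr (-3/2)"
        using True m by (intro powr_mono2') (auto simp: of_nat_diff)
      then show ?thesis using True by simp
    next
      case False
      have "(1 + \<bar>R - real n\<bar>) powr (-3/2) \<le> real (Suc (n - Suc m)) powr (-3/2)"
        using False m by (intro powr_mono2') (auto simp: of_nat_diff)
      then show ?thesis using False by simp
    qed
    have "(\<Sum>n<N. (1 + \<bar>R - real n\<bar>) powr (-3/2)) \<le> (\<Sum>n<N. if n \<le> m then ?c (m - n) else ?c (n - Suc m))"
      by (intro sum_mono le)
    also have "\<dots> = (\<Sum>n\<in>{..<N} \<inter> {n. n \<le> m}. ?c (m - n)) + (\<Sum>n\<in>{..<N} \<inter> - {n. n \<le> m}. ?c (n - Suc m))"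
      by (rule sum.If_cases) simp
    also have "(\<Sum>n\<in>{..<N} \<inter> {n. n \<le> m}. ?c (m - n)) = (\<Sum>j\<in>(\<lambda>n. m - n) ` ({..<N} \<inter> {n. n \<le> m}). ?c j)"
      by (subst sum.reindex) (auto simp: inj_on_def)
    also have "\<dots> \<le> S" by (intro fin) auto
    also have "(\<Sum>n\<in>{..<N} \<inter> - {n. n \<le> m}. ?c (n - Suc m)) = (\<Sum>j\<in>(\<lambda>n. n - Suc m) ` ({..<N} \<inter> - {n. n \<le> m}). ?c j)"
      by (subst sum.reindex) (auto simp: inj_on_def)
    also have "\<dots> \<le> S" by (intro fin) auto
    finally show ?thesis by simp
  qed
  moreover have "(\<Sum>n<N. ?c n) \<le> 2 * S" for N using fin[of "{..<N}"] S0 by simp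
  ultimately show ?thesis using that[of "2 * S"] S0 by simp
qed

section \<open>Potentials that imitate the half-line\<close>

lemma sqrt_increment:
  shows "sqrt (real (Suc n)) - sqrt (real n) \<ge> 0"
    and "2 * (sqrt (real (Suc n)) - sqrt (real n)) \<le> 2 * real (Suc n) powr (-1/2)"
    and "n \<ge> 1 \<Longrightarrow> 2 * (sqrt (real (Suc n)) - sqrt (real n)) \<le> real n powr (-1/2)"
proof -
  let ?d = "sqrt (real (Suc n)) - sqrt (real n)"
  show d0: "?d \<ge> 0" by simp
  have pr: "?d * (sqrt (real (Suc n)) + sqrt (real n)) = 1"
    by (simp add: algebra_simps flip: power2_eq_square)
  have hp: "x powr (-1/2) = 1 / sqrt x" if "x > 0" for x :: real
    using that by (simp add: powr_minus_divide powr_half_sqrt[symmetric] minus_divide_left[symmetric])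
  have "?d * sqrt (real (Suc n)) \<le> 1" using pr mult_left_mono[OF _ d0, of "sqrt (real (Suc n))" "sqrt (real (Suc n)) + sqrt (real n)"] by simp
  then have "?d \<le> 1 / sqrt (real (Suc n))" by (simp add: pos_le_divide_eq)
  then show "2 * ?d \<le> 2 * real (Suc n) powr (-1/2)" by (subst hp) auto
  assume n: "n \<ge> 1"
  have "?d * (sqrt (real n) + sqrt (real n)) \<le> 1"
    using pr mult_left_mono[OF _ d0, of "sqrt (real n) + sqrt (real n)" "sqrt (real (Suc n)) + sqrt (real n)"] by simp
  also have "?d * (sqrt (real n) + sqrt (real n)) = 2 * ?d * sqrt (real n)" by (simp add: algebra_simps)
  finally have "2 * ?d \<le> 1 / sqrt (real n)" using n by (subst pos_le_divide_eq) auto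
  then show "2 * ?d \<le> real n powr (-1/2)" using n by (subst hp) auto
qed

lemma powr_half_three_halves: "(x::real) powr (-1/2) * x powr (-1) = x powr (-3/2)"
  by (subst powr_add[symmetric]) simp

text \<open>Replace the larger of \<open>n\<close> and \<open>d\<close> by the smaller one.\<close>

lemma inverse_root_times_inverse_le:
  assumes "n \<ge> (1::nat)" "d \<ge> 1"
  shows "real n powr (-1/2) * (1 / d) \<le> real n powr (-3/2) + d powr (-3/2)"
proof (cases "real n \<le> d")
  case True
  have "1 / d \<le> 1 / real n" using True assms by (intro divide_left_mono) auto
  then have "real n powr (-1/2) * (1/d) \<le> real n powr (-1/2) * (1 / real n)" by (intro mult_left_mono) auto
  also have "\<dots> = real n powr (-1/2) * real n powr (-1)" using assms by (simp add: powr_minus_divide)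
  also have "\<dots> = real n powr (-3/2)" by (rule powr_half_three_halves)
  finally show ?thesis using powr_ge_zero[of d "-3/2"] by linarith
next
  case False
  have "real n powr (-1/2) \<le> d powr (-1/2)" using False assms by (intro powr_mono2') auto
  then have "real n powr (-1/2) * (1/d) \<le> d powr (-1/2) * (1 / d)" using assms by (intro mult_right_mono) auto
  also have "\<dots> = d powr (-1/2) * d powr (-1)" using assms by (simp add: powr_minus_divide)
  also have "\<dots> = d powr (-3/2)" by (rule powr_half_three_halves)
  finally show ?thesis using powr_ge_zero[of "real n" "-3/2"] by linarith
qed

text \<open>Here \<open>h n\<close> stands for the value at a point of modulus \<open>R\<close> of the potential of the
  \<open>n\<close>-th translated measure. Up to an error of order \<open>1 / n + 1 / (1 + \<bar>R - n\<bar>)\<close> it is at least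
  \<open>ln \<bar>R / t - 1\<bar>\<close> for \<open>t\<close> between \<open>n\<close> and \<open>n + 1\<close>. Against the weights, which decay like
  \<open>n powr (-1/2)\<close>, these errors sum to a constant that depends neither on \<open>R\<close> nor on \<open>N\<close>, and
  the main terms telescope to the potential of the truncated half-line, which is nonnegative.\<close>

lemma half_line_potential_lower_bound:
  fixes h :: "nat \<Rightarrow> real"
  assumes B: "B \<ge> 1" and M: "M \<ge> 0" and R: "R \<ge> 0" and N: "N \<ge> 1"
    and Z: "Z \<ge> 0" "\<And>N. (\<Sum>n<N. real (Suc n) powr (-3/2)) \<le> Z" "(\<Sum>n<N. (1 + \<bar>R - real n\<bar>) powr (-3/2)) \<le> Z"
    and near: "\<And>n. h n \<ge> - M - ln (real n + B)"
    and far: "\<And>n. \<bar>R - real n\<bar> > B \<Longrightarrow> h n \<ge> ln (\<bar>R - real n\<bar> - B) - ln (real n + B)"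
  shows "(\<Sum>n<N. 2 * (sqrt (real (Suc n)) - sqrt (real n)) * h n)
     \<ge> - (B * Z + 2 * (4 * (B + 1) + (M + ln (2 * B + 3)) * (2 * B + 3)) * Z + (2 * M + 4 + 4 * ln (sqrt (2 * B + 2) + 1) + 4 * ln 2 + 2 * ln B + 2 * ln 2))"
proof -
  define a where "a n = 2 * (sqrt (real (Suc n)) - sqrt (real n))" for n
  define W where "W = slit_primitive (sqrt R)"
  define E where "E = 4 * (B + 1) + (M + ln (2 * B + 3)) * (2 * B + 3)"
  define C0 where "C0 = 2 * M + 4 + 4 * ln (sqrt (2 * B + 2) + 1) + 4 * ln 2 + 2 * ln B + 2 * ln 2"
  have a0: "a n \<ge> 0" for n using sqrt_increment(1) by (simp add: a_def)
  have lnB: "ln (2 * B + 3) \<ge> 0" "ln B \<ge> 0" using B by auto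
  have E0: "E \<ge> 0" unfolding E_def using B M lnB by (intro add_nonneg_nonneg mult_nonneg_nonneg) auto
  have logstep: "ln (\<bar>R - real n\<bar> + 1) - ln (real n) \<le> h n + B / real n + E / (1 + \<bar>R - real n\<bar>)" if n: "n \<ge> 1" for n
  proof -
    have nB: "ln (real n + B) - ln (real n) \<le> B / real n"
    proof -
      have "ln ((real n + B) / real n) \<le> (real n + B) / real n - 1" using n B by (intro ln_le_minus_one) auto
      also have "\<dots> = B / real n" using n by (simp add: field_simps)
      finally show ?thesis using n B by (simp add: ln_div)
    qed
    define D where "D = \<bar>R - real n\<bar>"
    have D0: "D \<ge> 0" by (simp add: D_def)
    have "ln (D + 1) \<le> h n + ln (real n + B) + E / (1 + D)"
    proof (cases "D \<ge> 2 * B + 2")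
      case True
      have "ln ((D + 1) / (D - B)) \<le> (D + 1) / (D - B) - 1" using True B by (intro ln_le_minus_one) auto
      also have "\<dots> = (B + 1) / (D - B)" using True B by (simp add: field_simps)
      also have "\<dots> \<le> (B + 1) / ((1 + D) / 4)" using True B by (intro divide_left_mono) auto
      also have "\<dots> = 4 * (B + 1) / (1 + D)" by simp
      also have "\<dots> \<le> E / (1 + D)" unfolding E_def using D0 B M lnB by (intro divide_right_mono) auto
      finally have "ln (D + 1) - ln (D - B) \<le> E / (1 + D)" using True B by (simp add: ln_div)
      moreover have "h n \<ge> ln (D - B) - ln (real n + B)" using far[of n] True B unfolding D_def by simp
      ultimately show ?thesis by linarith
    next
      case False
      have "ln (D + 1) \<le> ln (2 * B + 3)" using False D0 by (subst ln_le_cancel_iff) auto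
      moreover have "M + ln (2 * B + 3) \<le> E / (1 + D)"
      proof -
        have "(M + ln (2 * B + 3)) * (1 + D) \<le> (M + ln (2 * B + 3)) * (2 * B + 3)"
          using False M lnB by (intro mult_left_mono) auto
        also have "\<dots> \<le> E" unfolding E_def using B by simp
        finally show ?thesis using D0 by (simp add: pos_le_divide_eq)
      qed
      ultimately show ?thesis using near[of n] by linarith
    qed
    then show ?thesis using nB unfolding D_def by linarith
  qed
  have step: "W (sqrt (real (Suc n))) - W (sqrt (real n)) \<le> a n * h n + (B * real n powr (-3/2) + E * (real n powr (-3/2) + (1 + \<bar>R - real n\<bar>) powr (-3/2)))"
    if n: "n \<ge> 1" for n
  proof -
    define D where "D = 1 + \<bar>R - real n\<bar>"
    have D1: "D \<ge> 1" by (simp add: D_def)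
    have "W (sqrt (real (Suc n))) - W (sqrt (real n)) \<le> a n * (ln (\<bar>R - real n\<bar> + 1) - ln (real n))"
      unfolding W_def a_def by (rule slit_primitive_increment[OF n R])
    also have "\<dots> \<le> a n * (h n + B / real n + E / D)" using logstep[OF n] a0 unfolding D_def by (intro mult_left_mono) auto
    also have "\<dots> = a n * h n + a n * (B / real n + E / D)" by (simp add: algebra_simps)
    also have "a n * (B / real n + E / D) \<le> real n powr (-1/2) * (B / real n + E / D)"
      using sqrt_increment(3)[OF n] B E0 D1 unfolding a_def by (intro mult_right_mono) auto
    also have "\<dots> = B * (real n powr (-1/2) * real n powr (-1)) + E * (real n powr (-1/2) * (1 / D))"
    proof -
      have "x * (B / y + E / D) = B * (x * (1 / y)) + E * (x * (1 / D))" for x y by (simp add: distrib_left mult.commute)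
      moreover have "real n powr (-1) = 1 / real n" using n by (simp add: powr_minus_divide)
      ultimately show ?thesis by (simp only:)
    qed
    also have "real n powr (-1/2) * real n powr (-1) = real n powr (-3/2)" by (rule powr_half_three_halves)
    also have "E * (real n powr (-1/2) * (1 / D)) \<le> E * (real n powr (-3/2) + D powr (-3/2))"
      using inverse_root_times_inverse_le[OF n D1] E0 by (intro mult_left_mono)
    finally show ?thesis unfolding D_def by simp
  qed
  have zero: "W 1 \<le> 2 * h 0 + C0"
  proof -
    have w1: "W 1 \<le> 4 + 4 * ln (sqrt R + 1)" unfolding W_def using R by (intro slit_primitive_one) auto
    show ?thesis
    proof (cases "R \<ge> 2 * B + 2")
      case True
      have s1: "sqrt R \<ge> 1" using True B by simp
      have "ln (sqrt R + 1) \<le> ln (2 * sqrt R)" using s1 by (subst ln_le_cancel_iff) linarith+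
      also have "\<dots> = ln 2 + ln R / 2" using s1 True B by (simp add: ln_mult ln_sqrt)
      finally have 1: "4 * ln (sqrt R + 1) \<le> 4 * ln 2 + 2 * ln R" by simp
      have "h 0 \<ge> ln (R - B) - ln B" using far[of 0] True B by simp
      moreover have "ln (R - B) \<ge> ln (R / 2)" using True B by (subst ln_le_cancel_iff) auto
      moreover have "ln (R / 2) = ln R - ln 2" using True B by (simp add: ln_div)
      moreover have "ln (sqrt (2 * B + 2) + 1) \<ge> 0" using B by simp
      ultimately show ?thesis using w1 1 M unfolding C0_def by linarith
    next
      case False
      have "ln (sqrt R + 1) \<le> ln (sqrt (2 * B + 2) + 1)" using False R B
        by (subst ln_le_cancel_iff) (auto intro: add_nonneg_pos)
      moreover have "ln (2::real) \<ge> 0" by simp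
      moreover have "- M - ln B \<le> h 0" using near[of 0] by simp
      ultimately show ?thesis using w1 unfolding C0_def by linarith
    qed
  qed
  obtain m where m: "N = Suc m" using N by (cases N) auto
  have tel: "W (sqrt (real N)) - W 1 = (\<Sum>n=1..<N. W (sqrt (real (Suc n))) - W (sqrt (real n)))"
    using sum_Suc_diff'[of 1 N "\<lambda>n. W (sqrt (real n))"] N by simp
  have "W (sqrt (real N)) - W 1 \<le> (\<Sum>n=1..<N. a n * h n + (B * real n powr (-3/2) + E * (real n powr (-3/2) + (1 + \<bar>R - real n\<bar>) powr (-3/2))))"
    unfolding tel by (intro sum_mono step) auto
  also have "\<dots> = (\<Sum>n=1..<N. a n * h n) + (B + E) * (\<Sum>n=1..<N. real n powr (-3/2)) + E * (\<Sum>n=1..<N. (1 + \<bar>R - real n\<bar>) powr (-3/2))"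
    by (simp add: sum.distrib sum_distrib_left algebra_simps)
  also have "(\<Sum>n=1..<N. real n powr (-3/2)) = (\<Sum>n<m. real (Suc n) powr (-3/2))"
    unfolding m by (subst sum.shift_bounds_Suc_ivl[of _ 0, simplified One_nat_def[symmetric]]) (simp add: atLeast0LessThan)
  also have "(B + E) * \<dots> \<le> (B + E) * Z" using B E0 by (intro mult_left_mono Z) auto
  also have "(\<Sum>n=1..<N. (1 + \<bar>R - real n\<bar>) powr (-3/2)) \<le> (\<Sum>n<N. (1 + \<bar>R - real n\<bar>) powr (-3/2))"
    by (intro sum_mono2) auto
  also have "\<dots> \<le> Z" by (rule Z(3))
  finally have "W (sqrt (real N)) - W 1 \<le> (\<Sum>n=1..<N. a n * h n) + (B + E) * Z + E * Z"
    using E0 by (simp add: mult_left_mono)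
  moreover have "W (sqrt (real N)) \<ge> 0" unfolding W_def using N R by (intro slit_primitive_nonneg) auto
  moreover have "(\<Sum>n<N. a n * h n) = a 0 * h 0 + (\<Sum>n=1..<N. a n * h n)"
    using N by (subst lessThan_atLeast0, subst sum.atLeast_Suc_lessThan) auto
  moreover have "a 0 = 2" by (simp add: a_def)
  ultimately have "(\<Sum>n<N. a n * h n) \<ge> - C0 - (B + E) * Z - E * Z" using zero by simp
  then show ?thesis unfolding a_def E_def[symmetric] C0_def[symmetric] by (simp add: algebra_simps)
qed

section \<open>From weak type estimates to Hardy spaces\<close>

lemma translate_nat_closed:
  assumes "\<And>z. z \<in> \<Omega> \<Longrightarrow> z + 1 \<in> (\<Omega> :: complex set)" "z \<in> \<Omega>"
  shows "z + of_nat n \<in> \<Omega>"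
proof (induction n)
  case (Suc n)
  have "z + of_nat (Suc n) = (z + of_nat n) + 1" by simp
  then show ?case using assms(1)[OF Suc] by metis
qed (use assms in simp)

text \<open>Sum the weak type bound over \<open>N = 4 ^ k\<close>: the \<open>k\<close>-th shell contributes at most a constant
  times \<open>4 powr (p * k) / 2 ^ k\<close>, and the series converges because \<open>p < 1/2\<close>.\<close>

lemma hardy_space_of_weak_type:
  fixes f :: "complex \<Rightarrow> complex" and B C p :: real
  assumes hol: "f holomorphic_on ball 0 1" and B: "B \<ge> 0" and C: "C \<ge> 0" and p: "0 < p" "p < 1/2"
    and weak: "\<And>r g N. 0 < r \<Longrightarrow> r < 1 \<Longrightarrow> N \<ge> 1 \<Longrightarrow> continuous_on UNIV g \<Longrightarrow> (\<And>\<xi>. norm \<xi> = 1 \<Longrightarrow> g \<xi> = f (of_real r * \<xi>)) \<Longrightarrow> range g \<subseteq> f ` cball 0 r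
       \<Longrightarrow> measure circle_measure {\<xi>. norm (g \<xi>) \<ge> 8 * (real N + B)} \<le> C / sqrt (real N)"
  shows "f \<in> hardy_space p"
proof -
  define T where "T k = 8 * (4^k + B)" for k :: nat
  define c where "c k = (T 0 * 4^Suc k) powr p" for k
  have T0: "T 0 > 0" using B by (simp add: T_def)
  have TS: "T k \<le> T 0 * 4^k" for k
  proof -
    have "B * 1 \<le> B * 4^k" using B by (intro mult_left_mono) auto
    then show ?thesis by (simp add: T_def algebra_simps)
  qed
  have c0: "c k \<ge> 0" for k by (simp add: c_def)
  define s where "s k = c k * (C / 2^k)" for k
  have s0: "s k \<ge> 0" for k unfolding s_def using c0 C by simp
  have "summable s"
  proof -
    have "(4::real) powr p < 4 powr (1/2)" using p by (intro powr_less_mono) auto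
    then have q: "(4::real) powr p / 2 < 1" by (simp add: powr_half_sqrt)
    have "s k = T 0 powr p * 4 powr p * C * (4 powr p / 2)^k" for k
    proof -
      have "((4::real) ^ Suc k) powr p = 4 powr p * (4 powr p)^k"
        by (simp add: powr_mult powr_power powr_realpow[symmetric] powr_powr mult.commute)
      then show ?thesis using T0 unfolding s_def c_def by (simp add: powr_mult power_divide)
    qed
    then have se: "s = (\<lambda>k. T 0 powr p * 4 powr p * C * (4 powr p / 2)^k)" by (rule ext)
    show ?thesis unfolding se by (intro summable_mult summable_geometric) (use q in simp)
  qed
  note sums = this
  define D where "D = ennreal (T 0 powr p) + ennreal (\<Sum>k. s k)"
  have "(\<integral>\<^sup>+ \<xi>. ennreal (norm (f (complex_of_real r * \<xi>)) powr p) \<partial>circle_measure) \<le> D" if r: "r \<in> {0<..<1}" for r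
  proof -
    have r': "0 \<le> r" "r < 1" "0 < r" using r by auto
    obtain g where g: "continuous_on UNIV g" "\<And>\<xi>. norm \<xi> = 1 \<Longrightarrow> g \<xi> = f (of_real r * \<xi>)" "\<And>\<xi>. g \<xi> \<in> f ` cball 0 r"
      using radial_extension[OF hol r'(1,2)] by blast
    have [measurable]: "g \<in> borel_measurable borel" using g(1) by (rule borel_measurable_contI)
    define S where "S k = {\<xi>. norm (g \<xi>) \<ge> T k}" for k
    have [measurable]: "S k \<in> sets borel" for k unfolding S_def by measurable
    have mS: "emeasure circle_measure (S k) \<le> ennreal (C / 2^k)" for k
    proof -
      have "measure circle_measure {\<xi>. norm (g \<xi>) \<ge> 8 * (real (4^k) + B)} \<le> C / sqrt (real (4^k))"
      proof (rule weak[OF r'(3,2) _ g(1,2)])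
        show "range g \<subseteq> f ` cball 0 r" using g(3) by (rule image_subsetI)
      qed simp_all
      moreover have "sqrt (real (4^k)) = 2^k"
      proof -
        have "((2::real)^k)^2 = (2^2)^k" by (simp only: power_mult[symmetric] mult.commute)
        then have "((2::real)^k)^2 = real (4^k)" by simp
        then show ?thesis by (rule real_sqrt_unique) simp
      qed
      ultimately have "measure circle_measure (S k) \<le> C / 2^k" by (simp add: S_def T_def)
      then show ?thesis by (simp add: circle.emeasure_eq_measure ennreal_leI)
    qed
    have pw: "ennreal (norm (g \<xi>) powr p) \<le> ennreal (T 0 powr p) + (\<Sum>k. ennreal (c k) * indicator (S k) \<xi>)" for \<xi>
    proof (cases "norm (g \<xi>) < T 0")
      case True
      then have "norm (g \<xi>) powr p \<le> T 0 powr p" using p by (intro powr_mono2) auto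
      then show ?thesis by (intro add_increasing2) (auto intro: ennreal_leI)
    next
      case False
      have "\<exists>k. norm (g \<xi>) < T k"
      proof -
        obtain k where "norm (g \<xi>) < 4^k" using real_arch_pow[of 4 "norm (g \<xi>)"] by auto
        moreover have "4^k \<le> T k" using B by (simp add: T_def)
        ultimately show ?thesis by (intro exI[of _ k]) linarith
      qed
      then obtain k where k: "norm (g \<xi>) < T k" "\<And>j. j < k \<Longrightarrow> \<not> norm (g \<xi>) < T j"
        using exists_least_iff[of "\<lambda>k. norm (g \<xi>) < T k"] by blast
      have "k \<noteq> 0" using k(1) False by (metis)
      then obtain j where j: "k = Suc j" using not0_implies_Suc by blast
      have "\<xi> \<in> S j" using k(2)[of j] j by (simp add: S_def)
      have "norm (g \<xi>) \<le> T 0 * 4^Suc j" using k(1) TS[of k] j by simp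
      then have "norm (g \<xi>) powr p \<le> c j" unfolding c_def using p by (intro powr_mono2) auto
      then have "ennreal (norm (g \<xi>) powr p) \<le> ennreal (c j) * indicator (S j) \<xi>" using \<open>\<xi> \<in> S j\<close> by (simp add: ennreal_leI)
      also have "\<dots> \<le> (\<Sum>k. ennreal (c k) * indicator (S k) \<xi>)"
      proof -
        define e where "e k = ennreal (c k) * indicator (S k) \<xi>" for k
        have "sum e {j} \<le> suminf e" by (rule sum_le_suminf) auto
        then have "e j \<le> suminf e" by simp
        then show ?thesis unfolding e_def .
      qed
      finally show ?thesis by (intro add_increasing) auto
    qed
    have "(\<integral>\<^sup>+ \<xi>. ennreal (norm (f (complex_of_real r * \<xi>)) powr p) \<partial>circle_measure) = (\<integral>\<^sup>+ \<xi>. ennreal (norm (g \<xi>) powr p) \<partial>circle_measure)"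
      by (rule nn_integral_cong_AE, rule AE_mp[OF AE_circle], rule AE_I2) (use g(2) in auto)
    also have "\<dots> \<le> (\<integral>\<^sup>+ \<xi>. ennreal (T 0 powr p) + (\<Sum>k. ennreal (c k) * indicator (S k) \<xi>) \<partial>circle_measure)"
      by (intro nn_integral_mono pw)
    also have "\<dots> = ennreal (T 0 powr p) + (\<Sum>k. ennreal (c k) * emeasure circle_measure (S k))"
      by (subst nn_integral_add) (auto simp: nn_integral_suminf nn_integral_cmult_indicator circle.emeasure_space_1[simplified])
    also have "\<dots> \<le> ennreal (T 0 powr p) + (\<Sum>k. ennreal (s k))"
    proof (intro add_left_mono suminf_le)
      fix k
      have "ennreal (c k) * emeasure circle_measure (S k) \<le> ennreal (c k) * ennreal (C / 2^k)" by (intro mult_left_mono mS) auto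
      also have "\<dots> = ennreal (s k)" unfolding s_def by (rule ennreal_mult[symmetric]) (use c0 C in auto)
      finally show "ennreal (c k) * emeasure circle_measure (S k) \<le> ennreal (s k)" .
    qed auto
    also have "\<dots> = D" unfolding D_def by (simp add: suminf_ennreal2[OF s0 sums])
    finally show ?thesis .
  qed
  then have "(SUP r\<in>{0<..<1}. \<integral>\<^sup>+ \<xi>. ennreal (norm (f (complex_of_real r * \<xi>)) powr p) \<partial>circle_measure) \<le> D"
    by (intro SUP_least)
  also have "\<dots> < \<infinity>" by (simp add: D_def)
  finally show ?thesis using hol by (simp add: hardy_space_def)
qed

lemma log_potential_integrable:
  fixes \<nu> :: "complex measure"
  assumes \<nu>: "prob_space \<nu>" "sets \<nu> = sets borel" "AE w in \<nu>. norm w \<le> L"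
    and M: "(\<integral>\<^sup>+w. ennreal (- ln (norm (z - w))) \<partial>\<nu>) \<le> ennreal M" "M \<ge> 0"
  shows "integrable \<nu> (\<lambda>w. ln (norm (z - w)))" and "(LINT w|\<nu>. ln (norm (z - w))) \<ge> - M"
proof -
  interpret prob_space \<nu> by fact
  have [measurable_cong]: "sets \<nu> = sets borel" by fact
  define U where "U = ln (norm z + \<bar>L\<bar> + 1)"
  have U: "U \<ge> 0" by (simp add: U_def)
  have "AE w in \<nu>. ln (norm (z - w)) \<le> U"
    using \<nu>(3)
  proof eventually_elim
    case (elim w)
    show ?case
    proof (cases "z = w")
      case False
      have "norm (z - w) \<le> norm z + \<bar>L\<bar> + 1" using norm_triangle_ineq4[of z w] elim by linarith
      moreover have "0 < norm z + \<bar>L\<bar> + 1" using norm_ge_zero[of z] by linarith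
      moreover have "0 < norm (z - w)" using False by simp
      ultimately show ?thesis unfolding U_def by (simp only: ln_le_cancel_iff)
    qed (use U in simp)
  qed
  then have "AE w in \<nu>. ennreal (norm (ln (norm (z - w)))) \<le> ennreal U + ennreal (- ln (norm (z - w)))"
  proof eventually_elim
    case (elim w)
    have "norm (ln (norm (z - w))) \<le> U + max 0 (- ln (norm (z - w)))" using elim U by (auto simp: abs_if max_def)
    then have "ennreal (norm (ln (norm (z - w)))) \<le> ennreal (U + max 0 (- ln (norm (z - w))))" by (rule ennreal_leI)
    also have "\<dots> = ennreal U + ennreal (- ln (norm (z - w)))"
      using U by (subst ennreal_plus) (auto simp: max_def ennreal_neg)
    finally show ?case .
  qed
  then have "(\<integral>\<^sup>+w. ennreal (norm (ln (norm (z - w)))) \<partial>\<nu>) \<le> (\<integral>\<^sup>+w. ennreal U + ennreal (- ln (norm (z - w))) \<partial>\<nu>)"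
    by (rule nn_integral_mono_AE)
  also have "\<dots> = ennreal U + (\<integral>\<^sup>+w. ennreal (- ln (norm (z - w))) \<partial>\<nu>)"
    by (subst nn_integral_add) (auto simp: emeasure_space_1)
  also have "\<dots> \<le> ennreal U + ennreal M" by (intro add_left_mono M)
  also have "\<dots> < \<infinity>" by simp
  finally show i: "integrable \<nu> (\<lambda>w. ln (norm (z - w)))" by (intro integrableI_bounded) auto
  have i': "integrable \<nu> (\<lambda>w. max 0 (- ln (norm (z - w))))" using i by auto
  have "(LINT w|\<nu>. max 0 (- ln (norm (z - w)))) = enn2real (\<integral>\<^sup>+w. ennreal (max 0 (- ln (norm (z - w)))) \<partial>\<nu>)"
    by (rule integral_eq_nn_integral) auto
  also have "(\<integral>\<^sup>+w. ennreal (max 0 (- ln (norm (z - w)))) \<partial>\<nu>) = (\<integral>\<^sup>+w. ennreal (- ln (norm (z - w))) \<partial>\<nu>)"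
    by (intro nn_integral_cong) (auto simp: max_def ennreal_neg)
  also have "enn2real \<dots> \<le> M" using M by (intro enn2real_leI) auto
  finally have "(LINT w|\<nu>. max 0 (- ln (norm (z - w)))) \<le> M" .
  moreover have "(LINT w|\<nu>. - max 0 (- ln (norm (z - w)))) \<le> (LINT w|\<nu>. ln (norm (z - w)))"
    by (intro integral_mono i integrable_minus i') auto
  ultimately show "(LINT w|\<nu>. ln (norm (z - w))) \<ge> - M" by simp
qed

text \<open>For \<open>w\<close> outside \<open>\<Omega>\<close> the function \<open>f - w\<close> has no zeros, so each \<open>ln \<bar>f - w\<bar>\<close> satisfies
  the mean value equation; integrate over \<open>w\<close> and exchange the integrals.\<close>

lemma log_potential_mean:
  fixes \<nu> :: "complex measure"
  assumes \<nu>: "prob_space \<nu>" "sets \<nu> = sets borel" "AE w in \<nu>. w \<notin> \<Omega> \<and> norm w \<le> L" and \<Omega>: "open \<Omega>"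
    and f: "f holomorphic_on ball 0 1" "f ` ball 0 1 \<subseteq> \<Omega>" and r: "0 < r" "r < 1"
    and g: "continuous_on UNIV g" "\<And>\<xi>. norm \<xi> = 1 \<Longrightarrow> g \<xi> = f (of_real r * \<xi>)" "range g \<subseteq> f ` cball 0 r"
  shows "integrable circle_measure (\<lambda>\<xi>. LINT w|\<nu>. ln (norm (g \<xi> - w)))"
    and "(LINT \<xi>|circle_measure. LINT w|\<nu>. ln (norm (g \<xi> - w))) = (LINT w|\<nu>. ln (norm (f 0 - w)))"
proof -
  interpret \<nu>: prob_space \<nu> by fact
  interpret P: pair_prob_space circle_measure \<nu> ..
  have [measurable_cong]: "sets \<nu> = sets borel" by fact
  have [measurable]: "g \<in> borel_measurable borel" using g(1) by (rule borel_measurable_contI)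
  define K where "K = f ` cball 0 r"
  have sub: "cball (0::complex) r \<subseteq> ball 0 1" using r by auto
  have K: "compact K" "K \<subseteq> \<Omega>" unfolding K_def using f sub
    by (auto intro!: compact_continuous_image holomorphic_on_imp_continuous_on holomorphic_on_subset[OF f(1)])
  obtain \<delta> where d: "\<delta> > 0" "\<And>x y. x \<in> K \<Longrightarrow> norm (y - x) < \<delta> \<Longrightarrow> y \<in> \<Omega>"
    using compact_open_margin[OF K(1) \<Omega> K(2)] by blast
  obtain R where R: "\<And>x. x \<in> K \<Longrightarrow> norm x \<le> R" using compact_imp_bounded[OF K(1)] unfolding bounded_iff by blast
  define Q where "Q = \<bar>ln \<delta>\<bar> + \<bar>ln (\<bar>R\<bar> + \<bar>L\<bar> + 1)\<bar>"
  have gK: "g \<xi> \<in> K" for \<xi> using g(3) by (auto simp: K_def)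
  have bd: "norm (ln (norm (g \<xi> - w))) \<le> Q" if w: "w \<notin> \<Omega> \<and> norm w \<le> L" for \<xi> w
  proof -
    have 1: "\<delta> \<le> norm (g \<xi> - w)" using d(2)[OF gK, of w \<xi>] w by (force simp: norm_minus_commute not_less)
    have 2: "norm (g \<xi> - w) \<le> \<bar>R\<bar> + \<bar>L\<bar> + 1" using norm_triangle_ineq4[of "g \<xi>" w] R[OF gK, of \<xi>] w by linarith
    have "ln \<delta> \<le> ln (norm (g \<xi> - w))" using 1 d(1) by (subst ln_le_cancel_iff) auto
    moreover have "ln (norm (g \<xi> - w)) \<le> ln (\<bar>R\<bar> + \<bar>L\<bar> + 1)" using 1 2 d(1) by (subst ln_le_cancel_iff) auto
    ultimately show ?thesis unfolding Q_def real_norm_def by linarith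
  qed
  have int: "integrable (circle_measure \<Otimes>\<^sub>M \<nu>) (\<lambda>(\<xi>, w). ln (norm (g \<xi> - w)))"
  proof (rule P.P.integrable_const_bound[where B=Q])
    show "AE x in circle_measure \<Otimes>\<^sub>M \<nu>. norm (case x of (\<xi>, w) \<Rightarrow> ln (norm (g \<xi> - w))) \<le> Q"
    proof (rule P.AE_pair_measure)
      show "AE \<xi> in circle_measure. AE w in \<nu>. norm (case (\<xi>, w) of (\<xi>, w) \<Rightarrow> ln (norm (g \<xi> - w))) \<le> Q"
      proof (rule AE_I2)
        fix \<xi>
        show "AE w in \<nu>. norm (case (\<xi>, w) of (\<xi>, w) \<Rightarrow> ln (norm (g \<xi> - w))) \<le> Q"
          using \<nu>(3) by eventually_elim (use bd in auto)
      qed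
    qed measurable
  qed measurable
  show "integrable circle_measure (\<lambda>\<xi>. LINT w|\<nu>. ln (norm (g \<xi> - w)))"
    by (rule P.integrable_fst[OF int])
  have "(LINT \<xi>|circle_measure. LINT w|\<nu>. ln (norm (g \<xi> - w))) = (LINT w|\<nu>. LINT \<xi>|circle_measure. ln (norm (g \<xi> - w)))"
    by (rule P.Fubini_integral[OF int, symmetric])
  also have "\<dots> = (LINT w|\<nu>. ln (norm (f 0 - w)))"
  proof (rule integral_cong_AE)
    show "AE w in \<nu>. (LINT \<xi>|circle_measure. ln (norm (g \<xi> - w))) = ln (norm (f 0 - w))"
      using \<nu>(3)
    proof eventually_elim
      case (elim w)
      have "w \<notin> K" using elim K(2) by blast
      then have nz: "g \<xi> - w \<noteq> 0" for \<xi> using gK[of \<xi>] by auto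
      have nzf: "f z - w \<noteq> 0" if "z \<in> ball 0 1" for z
      proof
        assume "f z - w = 0"
        then have "w = f z" by simp
        then show False using elim f(2) that by blast
      qed
      have gc: "continuous_on {0..2*pi} (\<lambda>t. g (cis t))"
        by (rule continuous_on_compose2[OF g(1)]) (auto intro!: continuous_intros)
      have c: "continuous_on {0..2*pi} (\<lambda>t. ln (norm (g (cis t) - w)))"
        using nz by (intro continuous_intros gc) auto
      have "((\<lambda>t. ln (norm (f (0 + of_real r * cis t) - w))) has_integral 2 * pi * ln (norm (f 0 - w))) {0..2*pi}"
        by (rule circle_log_mean_value[of "\<lambda>z. f z - w" 0 1]) (use f nzf r in \<open>auto intro!: holomorphic_intros\<close>)
      then have "integral {0..2*pi} (\<lambda>t. ln (norm (g (cis t) - w))) = 2 * pi * ln (norm (f 0 - w))"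
        by (simp add: g(2) integral_unique)
      then show ?case by (subst circle_integral(1)[OF _ c]) auto
    qed
    show "(\<lambda>w. LINT \<xi>|circle_measure. ln (norm (g \<xi> - w))) \<in> borel_measurable \<nu>" by measurable
  qed measurable
  finally show "(LINT \<xi>|circle_measure. LINT w|\<nu>. ln (norm (g \<xi> - w))) = (LINT w|\<nu>. ln (norm (f 0 - w)))" .
qed

section \<open>The weak type estimate for Koenigs domains\<close>

text \<open>The function \<open>u N\<close> is the potential of the translates of \<open>\<nu>\<close> by \<open>- n0, - n0 - 1, \<dots>\<close>,
  all of which live on the complement of \<open>\<Omega>\<close>, with the weights \<open>a n\<close>, normalised to vanish at the
  origin. It is at least \<open>- C1\<close> on \<open>\<Omega>\<close>, at least \<open>2 * sqrt N\<close> at points of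
  modulus \<open>8 * (N + B)\<close> or more, and bounded at \<open>f 0\<close> independently of \<open>N\<close>. Since it is harmonic
  on \<open>\<Omega>\<close>, its mean along a circle under \<open>f\<close> equals its value at \<open>f 0\<close>, and Markov's inequality
  gives the claim.\<close>

lemma Koenigs_weak_type:
  assumes \<Omega>: "open \<Omega>" and shift: "\<And>z. z \<in> \<Omega> \<Longrightarrow> z + 1 \<in> \<Omega>" and cap: "log_capacity (- \<Omega>) > 0"
    and f: "f holomorphic_on ball 0 1" "f ` ball 0 1 \<subseteq> \<Omega>"
  obtains B C where "B \<ge> 0" "C \<ge> 0"
    "\<And>r g N. 0 < r \<Longrightarrow> r < 1 \<Longrightarrow> N \<ge> 1 \<Longrightarrow> continuous_on UNIV g \<Longrightarrow> (\<And>\<xi>. norm \<xi> = 1 \<Longrightarrow> g \<xi> = f (of_real r * \<xi>)) \<Longrightarrow> range g \<subseteq> f ` cball 0 r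
       \<Longrightarrow> measure circle_measure {\<xi>. norm (g \<xi>) \<ge> 8 * (real N + B)} \<le> C / sqrt (real N)"
proof -
  have "closed (- \<Omega>)" using \<Omega> by (rule closed_Compl)
  from positive_capacity_bounded_potential[OF cap this]
  obtain \<nu> :: "complex measure" and L M :: real where \<nu>: "prob_space \<nu>" "sets \<nu> = sets borel"
    and AE\<nu>: "AE w in \<nu>. w \<in> - \<Omega> \<and> norm w \<le> L" and LM: "M \<ge> 0" "L \<ge> 0"
    and pot: "\<And>z. z \<notin> - \<Omega> \<Longrightarrow> (\<integral>\<^sup>+w. ennreal (- ln (norm (z - w))) \<partial>\<nu>) \<le> ennreal M" by blast
  interpret \<nu>: prob_space \<nu> by fact
  have [measurable_cong]: "sets \<nu> = sets borel" by fact
  have AE1: "AE w in \<nu>. w \<notin> \<Omega> \<and> norm w \<le> L" using AE\<nu> by simp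
  have AE2: "AE w in \<nu>. norm w \<le> L" using AE1 by eventually_elim simp
  have potI: "integrable \<nu> (\<lambda>w. ln (norm (z - w)))" "(LINT w|\<nu>. ln (norm (z - w))) \<ge> - M" if "z \<in> \<Omega>" for z
    using log_potential_integrable[OF \<nu> AE2 pot LM(1), of z] that by auto
  \<comment> \<open>translates, started far enough to the left to stay away from the origin\<close>
  define n0 where "n0 = nat \<lceil>L\<rceil> + 1"
  have n0: "real n0 \<ge> L + 1" unfolding n0_def by linarith
  define B where "B = L + real n0"
  have B: "B \<ge> 1" unfolding B_def using n0 LM by linarith
  define c where "c n = (of_nat (n + n0) :: complex)" for n
  have cn: "norm (c n) = real n + real n0" for n unfolding c_def 
    using norm_of_nat[of "n + n0", where 'a=complex] by (simp only: of_nat_add)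
  have c\<Omega>: "z + c n \<in> \<Omega>" if "z \<in> \<Omega>" for z n unfolding c_def by (rule translate_nat_closed[OF shift that])
  have cw: "real n + 1 \<le> norm (c n - w)" "norm (c n - w) \<le> real n + B" if "norm w \<le> L" for n w
    using norm_triangle_ineq2[of "c n" w] norm_triangle_ineq4[of "c n" w] that n0 unfolding cn B_def by linarith+
  have lncw: "0 \<le> ln (norm (c n - w))" "ln (norm (c n - w)) \<le> ln (real n + B)" if "norm w \<le> L" for n w
  proof -
    have p: "1 \<le> norm (c n - w)" using cw(1)[OF that, of n] by linarith
    then show "0 \<le> ln (norm (c n - w))" by simp
    show "ln (norm (c n - w)) \<le> ln (real n + B)" using p cw(2)[OF that, of n]
      by (intro iffD2[OF ln_le_cancel_iff]) linarith+
  qed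
  have ci: "integrable \<nu> (\<lambda>w. ln (norm (c n - w)))" for n
  proof (rule \<nu>.integrable_const_bound[where B="ln (real n + B)"])
    show "AE w in \<nu>. norm (ln (norm (c n - w))) \<le> ln (real n + B)"
      using AE2 by eventually_elim (use lncw in auto)
  qed measurable
  define h where "h n z = (LINT w|\<nu>. ln (norm (z + c n - w))) - (LINT w|\<nu>. ln (norm (c n - w)))" for n z
  have hi: "h n z = (LINT w|\<nu>. ln (norm (z + c n - w)) - ln (norm (c n - w)))" if "z \<in> \<Omega>" for n z
    unfolding h_def using potI(1)[OF c\<Omega>[OF that]] ci by simp
  have cle: "(LINT w|\<nu>. ln (norm (c n - w))) \<le> ln (real n + B)" for n
  proof -
    have "(LINT w|\<nu>. ln (norm (c n - w))) \<le> (LINT w|\<nu>. ln (real n + B))"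
      by (rule integral_mono_AE[OF ci]) (use AE2 in \<open>auto elim!: eventually_mono intro: lncw\<close>)
    then show ?thesis by (simp add: \<nu>.prob_space)
  qed
  have near: "h n z \<ge> - M - ln (real n + B)" if "z \<in> \<Omega>" for n z
    unfolding h_def using potI(2)[OF c\<Omega>[OF that], of n] cle[of n] by linarith
  have far: "h n z \<ge> ln (\<bar>norm z - real n\<bar> - B) - ln (real n + B)" if z: "z \<in> \<Omega>" and d: "\<bar>norm z - real n\<bar> > B" for n z
  proof -
    have "(LINT w|\<nu>. ln (\<bar>norm z - real n\<bar> - B)) \<le> (LINT w|\<nu>. ln (norm (z + c n - w)))"
    proof (rule integral_mono_AE[OF _ potI(1)[OF c\<Omega>[OF z]]])
      show "AE w in \<nu>. ln (\<bar>norm z - real n\<bar> - B) \<le> ln (norm (z + c n - w))"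
        using AE2
      proof eventually_elim
        case (elim w)
        have "\<bar>norm z - real n\<bar> \<le> norm (z + of_nat n)"
          using norm_triangle_ineq3[of z "- of_nat n"] by simp
        moreover have "z + of_nat n = (z + c n - w) - (of_nat n0 - w)" by (simp add: c_def)
        then have "norm (z + of_nat n) \<le> norm (z + c n - w) + norm (of_nat n0 - w)" by (metis norm_triangle_ineq4)
        moreover have "norm (of_nat n0 - w) \<le> B" using norm_triangle_ineq4[of "of_nat n0" w] elim by (simp add: B_def)
        ultimately have le: "\<bar>norm z - real n\<bar> - B \<le> norm (z + c n - w)" by linarith
        then show ?case using d by (intro iffD2[OF ln_le_cancel_iff]) linarith+
      qed
    qed simp
    then have "ln (\<bar>norm z - real n\<bar> - B) \<le> (LINT w|\<nu>. ln (norm (z + c n - w)))" by (simp add: \<nu>.prob_space)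
    then show ?thesis unfolding h_def using cle[of n] by linarith
  qed
  have upper: "h n z \<le> norm z / (real n + 1)" if z: "z \<in> \<Omega>" for n z
  proof -
    have "h n z \<le> (LINT w|\<nu>. norm z / (real n + 1))"
      unfolding hi[OF z]
    proof (rule integral_mono_AE)
      show "AE w in \<nu>. ln (norm (z + c n - w)) - ln (norm (c n - w)) \<le> norm z / (real n + 1)"
        using AE1
      proof eventually_elim
        case (elim w)
        have p: "0 < norm (z + c n - w)" using c\<Omega>[OF z, of n] elim by auto
        have q: "real n + 1 \<le> norm (c n - w)" using cw(1) elim by blast
        then have q0: "0 < norm (c n - w)" by linarith
        have "z + c n - w = z + (c n - w)" by simp
        then have tri: "norm (z + c n - w) \<le> norm z + norm (c n - w)" by (metis norm_triangle_ineq)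
        have "ln (norm (z + c n - w)) - ln (norm (c n - w)) = ln (norm (z + c n - w) / norm (c n - w))"
          using p q0 by (simp add: ln_div)
        also have "\<dots> \<le> norm (z + c n - w) / norm (c n - w) - 1" using p q0 by (intro ln_le_minus_one divide_pos_pos)
        also have "\<dots> \<le> (norm z + norm (c n - w)) / norm (c n - w) - 1"
          using tri by (intro diff_right_mono divide_right_mono) auto
        also have "\<dots> = norm z / norm (c n - w)" using q0 by (simp add: add_divide_distrib)
        also have "\<dots> \<le> norm z / (real n + 1)" using q q0 by (intro divide_left_mono) auto
        finally show ?case .
      qed
    qed (use potI(1)[OF c\<Omega>[OF z]] ci in auto)
    then show ?thesis by (simp add: \<nu>.prob_space)
  qed
  obtain Z where Z: "Z \<ge> 0" "\<And>N. (\<Sum>n<N. real (Suc n) powr (-3/2)) \<le> Z"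
    "\<And>R N. R \<ge> 0 \<Longrightarrow> (\<Sum>n<N. (1 + \<bar>R - real n\<bar>) powr (-3/2)) \<le> Z"
    using sum_three_halves_distance_bound by blast
  define a where "a n = 2 * (sqrt (real (Suc n)) - sqrt (real n))" for n
  have a0: "a n \<ge> 0" for n using sqrt_increment(1) by (simp add: a_def)
  have asum: "(\<Sum>n<N. a n) = 2 * sqrt (real N)" for N
  proof -
    have "(\<Sum>n<N. sqrt (real (Suc n)) - sqrt (real n)) = sqrt (real N)"
      using sum_lessThan_telescope[of "\<lambda>n. sqrt (real n)" N] by simp
    then show ?thesis unfolding a_def sum_distrib_left[symmetric] by simp
  qed
  define C1 where "C1 = max 0 (B * Z + 2 * (4 * (B + 1) + (M + ln (2 * B + 3)) * (2 * B + 3)) * Z + (2 * M + 4 + 4 * ln (sqrt (2 * B + 2) + 1) + 4 * ln 2 + 2 * ln B + 2 * ln 2))"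
  have C1: "C1 \<ge> 0" by (simp add: C1_def)
  define u where "u N z = (\<Sum>n<N. a n * h n z)" for N z
  have lower: "u N z \<ge> - C1" if z: "z \<in> \<Omega>" and N: "N \<ge> 1" for N z
  proof -
    have "u N z \<ge> - (B * Z + 2 * (4 * (B + 1) + (M + ln (2 * B + 3)) * (2 * B + 3)) * Z + (2 * M + 4 + 4 * ln (sqrt (2 * B + 2) + 1) + 4 * ln 2 + 2 * ln B + 2 * ln 2))"
      unfolding u_def a_def
      by (rule half_line_potential_lower_bound[where R="norm z", OF B LM(1) norm_ge_zero N Z(1,2) Z(3)[OF norm_ge_zero] near[OF z] far[OF z]])
    then show ?thesis unfolding C1_def by linarith
  qed
  \<comment> \<open>the factor 8 leaves \<open>ln 7 \<ge> 1\<close> for each of the \<open>N\<close> terms\<close>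
  have big: "u N z \<ge> 2 * sqrt (real N)" if z: "z \<in> \<Omega>" and R: "norm z \<ge> 8 * (real N + B)" for N z
  proof -
    have "1 \<le> h n z" if n: "n < N" for n
    proof -
      have nN: "real n < real N" using n by simp
      define q where "q = real n + B"
      define Q where "Q = real N + B"
      have q: "0 < q" "q \<le> Q" "real n \<le> q" "B \<le> q" "8 * Q \<le> norm z" using nN B R by (auto simp: q_def Q_def)
      have d: "7 * q \<le> \<bar>norm z - real n\<bar> - B" 
      proof -
        have "norm z - real n \<ge> 8 * q - real n" using q by linarith
        moreover have "8 * q - real n - B = 7 * q" by (simp add: q_def)
        ultimately show ?thesis by linarith
      qed
      have "\<bar>norm z - real n\<bar> > B" using d q by linarith
      from far[OF z this] have "h n z \<ge> ln (\<bar>norm z - real n\<bar> - B) - ln q" unfolding q_def .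
      moreover have "ln (7 * q) \<le> ln (\<bar>norm z - real n\<bar> - B)" using d q(1)
        by (intro iffD2[OF ln_le_cancel_iff]) linarith+
      moreover have "ln (7 * q) = ln 7 + ln q" using q(1) by (simp add: ln_mult)
      moreover have "ln (7::real) \<ge> 1" using exp_le by (subst ln_ge_iff) auto
      ultimately show ?thesis by linarith
    qed
    then have "(\<Sum>n<N. a n * 1) \<le> u N z" unfolding u_def using a0 by (intro sum_mono mult_left_mono) auto
    then show ?thesis using asum[of N] by simp
  qed
  have f0: "f 0 \<in> \<Omega>" using f(2) by auto
  have start: "u N (f 0) \<le> 2 * norm (f 0) * Z" for N
  proof -
    have "u N (f 0) \<le> (\<Sum>n<N. 2 * norm (f 0) * real (Suc n) powr (-3/2))"
      unfolding u_def
    proof (rule sum_mono)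
      fix n
      have "a n * h n (f 0) \<le> a n * (norm (f 0) / (real n + 1))" using upper[OF f0] a0 by (intro mult_left_mono)
      also have "\<dots> \<le> (2 * real (Suc n) powr (-1/2)) * (norm (f 0) / (real n + 1))"
        using sqrt_increment(2)[of n] unfolding a_def by (intro mult_right_mono) auto
      also have "\<dots> = 2 * norm (f 0) * (real (Suc n) powr (-1/2) * real (Suc n) powr (-1))"
        by (simp add: powr_minus_divide add.commute)
      also have "\<dots> = 2 * norm (f 0) * real (Suc n) powr (-3/2)" by (simp only: powr_half_three_halves)
      finally show "a n * h n (f 0) \<le> 2 * norm (f 0) * real (Suc n) powr (-3/2)" .
    qed
    also have "\<dots> = 2 * norm (f 0) * (\<Sum>n<N. real (Suc n) powr (-3/2))" by (simp only: sum_distrib_left)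
    also have "\<dots> \<le> 2 * norm (f 0) * Z" by (intro mult_left_mono Z) auto
    finally show ?thesis .
  qed
  define C where "C = (2 * norm (f 0) * Z + C1) / 2"
  have C: "C \<ge> 0" unfolding C_def using Z(1) C1 by simp
  have "measure circle_measure {\<xi>. norm (g \<xi>) \<ge> 8 * (real N + B)} \<le> C / sqrt (real N)"
    if r: "0 < r" "r < 1" and N: "N \<ge> 1" and g: "continuous_on UNIV g" "\<And>\<xi>. norm \<xi> = 1 \<Longrightarrow> g \<xi> = f (of_real r * \<xi>)" "range g \<subseteq> f ` cball 0 r"
    for r g N
  proof -
    have sub: "cball (0::complex) r \<subseteq> ball 0 1" using r by auto
    have g\<Omega>: "g \<xi> \<in> \<Omega>" for \<xi> using g(3) f(2) sub by blast
    have [measurable]: "g \<in> borel_measurable borel" using g(1) by (rule borel_measurable_contI)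
    have ftrans: "(\<lambda>z. f z + c n) holomorphic_on ball 0 1" "(\<lambda>z. f z + c n) ` ball 0 1 \<subseteq> \<Omega>" for n
      using f c\<Omega> by (auto intro!: holomorphic_intros)
    have gtrans: "continuous_on UNIV (\<lambda>\<xi>. g \<xi> + c n)" "\<And>\<xi>. norm \<xi> = 1 \<Longrightarrow> g \<xi> + c n = f (of_real r * \<xi>) + c n"
      "range (\<lambda>\<xi>. g \<xi> + c n) \<subseteq> (\<lambda>z. f z + c n) ` cball 0 r" for n
      using g by (auto intro!: continuous_intros)
    note mean = log_potential_mean[OF \<nu> AE1 \<Omega> ftrans r gtrans]
    have hint: "integrable circle_measure (\<lambda>\<xi>. h n (g \<xi>))" for n
      unfolding h_def by (intro Bochner_Integration.integrable_diff mean(1)) auto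
    have hmean: "(LINT \<xi>|circle_measure. h n (g \<xi>)) = h n (f 0)" for n
      unfolding h_def using mean(1)[of n] mean(2)[of n] by simp
    have uint: "integrable circle_measure (\<lambda>\<xi>. u N (g \<xi>))"
      unfolding u_def by (intro Bochner_Integration.integrable_sum integrable_mult_right hint)
    have umean: "(LINT \<xi>|circle_measure. u N (g \<xi>)) = u N (f 0)"
      unfolding u_def by (subst Bochner_Integration.integral_sum) (auto simp: hint hmean)
    define S where "S = {\<xi>. norm (g \<xi>) \<ge> 8 * (real N + B)}"
    have S[measurable]: "S \<in> sets borel" unfolding S_def by measurable
    have iS: "integrable circle_measure (\<lambda>\<xi>. 2 * sqrt (real N) * indicator S \<xi>)"
      by (intro integrable_mult_right integrable_real_indicator) (auto simp: circle.emeasure_eq_measure)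
    have "2 * sqrt (real N) * measure circle_measure S = (LINT \<xi>|circle_measure. 2 * sqrt (real N) * indicator S \<xi>)"
      by simp
    also have "\<dots> \<le> (LINT \<xi>|circle_measure. u N (g \<xi>) + C1)"
    proof (rule integral_mono[OF iS])
      fix \<xi>
      show "2 * sqrt (real N) * indicator S \<xi> \<le> u N (g \<xi>) + C1"
        using lower[OF g\<Omega> N, of \<xi>] big[OF g\<Omega>, of N \<xi>] C1 by (cases "\<xi> \<in> S") (auto simp: S_def)
    qed (use uint in simp)
    also have "\<dots> = u N (f 0) + C1" using uint umean by simp
    also have "\<dots> \<le> 2 * C"
    proof -
      have "2 * C = 2 * norm (f 0) * Z + C1" by (simp add: C_def)
      then show ?thesis using start[of N] by linarith
    qed
    finally have "sqrt (real N) * measure circle_measure S \<le> C" by simp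
    then show ?thesis unfolding S_def[symmetric] using N by (simp add: pos_le_divide_eq mult.commute)
  qed
  then show ?thesis using that[of B C] B C by auto
qed

lemma hardy_number_ge_half_of_regular:
  assumes \<Omega>: "open \<Omega>" and shift: "\<And>z. z \<in> \<Omega> \<Longrightarrow> z + 1 \<in> \<Omega>" and cap: "log_capacity (- \<Omega>) > 0"
  shows "hardy_number \<Omega> \<ge> 1/2"
  unfolding hardy_number_def
proof (rule Inf_greatest)
  fix x assume "x \<in> {hardy_number_fun f |f. f holomorphic_on ball 0 1 \<and> f ` ball 0 1 \<subseteq> \<Omega>}"
  then obtain f where f: "f holomorphic_on ball 0 1" "f ` ball 0 1 \<subseteq> \<Omega>" and x: "x = hardy_number_fun f" by blast
  obtain B C where BC: "B \<ge> 0" "C \<ge> 0"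
    "\<And>r g N. 0 < r \<Longrightarrow> r < 1 \<Longrightarrow> N \<ge> 1 \<Longrightarrow> continuous_on UNIV g \<Longrightarrow> (\<And>\<xi>. norm \<xi> = 1 \<Longrightarrow> g \<xi> = f (of_real r * \<xi>)) \<Longrightarrow> range g \<subseteq> f ` cball 0 r
       \<Longrightarrow> measure circle_measure {\<xi>. norm (g \<xi>) \<ge> 8 * (real N + B)} \<le> C / sqrt (real N)"
    using Koenigs_weak_type[OF assms f] by blast
  have half: "(1/2 :: ennreal) = ennreal (1/2)"
    using divide_ennreal[of 1 2] by (simp only: ennreal_1 ennreal_numeral zero_le_one zero_less_numeral simp_thms)
  show "1/2 \<le> x"
  proof (rule dense_le)
    fix y :: ennreal assume y: "y < 1/2"
    then obtain p where p: "y = ennreal p" "p \<ge> 0" by (cases y) (auto simp: top.not_eq_extremum)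
    have "ennreal p < ennreal (1/2)" using y by (simp only: half p)
    then have "p < 1/2" using p(2) by (simp only: ennreal_less_iff)
    show "y \<le> x"
    proof (cases "p = 0")
      case False
      then have p0: "0 < p" using p(2) by simp
      have "f \<in> hardy_space p"
        by (rule hardy_space_of_weak_type[OF f(1) BC(1,2) p0 \<open>p < 1/2\<close> BC(3)])
      then show ?thesis unfolding x hardy_number_fun_def p(1) using p0
        by (intro Sup_upper UnI2 CollectI exI[of _ p]) simp
    qed (simp add: p)
  qed
qed

section \<open>The Hardy number of a Koenigs domain\<close>

theorem theorem1p1:
  fixes \<Omega> :: "complex set"
  assumes "Koenigs_domain \<Omega>"
  shows "(hardy_number \<Omega> \<ge> 1 / 2 \<longleftrightarrow> regular_domain \<Omega>) \<and>
         hardy_number \<Omega> \<in> {0} \<union> {1 / 2..\<infinity>}"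
proof -
  have dom: "complex_domain \<Omega>" and \<Omega>: "open \<Omega>" "\<Omega> \<noteq> {}"
    using assms by (auto simp: Koenigs_domain_def hyperbolic_domain_def complex_domain_def)
  have UNIV: "\<Omega> \<noteq> UNIV" using assms by (auto simp: Koenigs_domain_def hyperbolic_domain_def)
  have shift: "z + 1 \<in> \<Omega>" if "z \<in> \<Omega>" for z using assms that by (auto simp: Koenigs_domain_def)
  show ?thesis
  proof (cases "log_capacity (- \<Omega>) = 0")
    case True
    then have "hardy_number \<Omega> = 0" by (rule hardy_number_zero_of_capacity_zero[OF \<Omega>(1) UNIV \<Omega>(2)])
    moreover have "\<not> regular_domain \<Omega>" using True by (simp add: regular_domain_def)
    moreover have "\<not> (1/2 :: ennreal) \<le> 0" by (simp add: ennreal_divide_eq_0_iff)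
    ultimately show ?thesis by simp
  next
    case False
    then have "log_capacity (- \<Omega>) > 0" by (rule zero_less_iff_neq_zero[THEN iffD2])
    moreover from this have "hardy_number \<Omega> \<ge> 1/2" using hardy_number_ge_half_of_regular[OF \<Omega>(1)] shift by blast
    ultimately show ?thesis using dom by (simp add: regular_domain_def)
  qed
qed

end
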